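(* Let $E$ be a compact metric space, $0<\alpha<1$, $a\in C_{++}(E)$, $m$ a non-null finite Borel measure on $E$, and suppose that $b\in C_{++}(E)$. Let $\gamma>0$ be a constant. Let $D$ be the linear span of the functions $F_\lambda(z)=e^{-\lambda z}$ on $[0,\infty)$, $\lambda>0$. If for every $F\in D$ $$\int_{(0,\infty)}\Lambda(dz)(F(z)-F(0))^2\le\frac\gamma2\left[\int_{(0,\infty)}\Lambda(dz)\,z\int_{(0,\infty)} n_B(dy)(F(z+y)-F(z))^2+\int_{(0,\infty)} n_I(dy)(F(y)-F(0))^2\right],$$ then for any $\Psi\in\mathcal D$ $$\mathrm{var}(\Psi)\le\gamma\ \mathop{\mathrm{ess\,sup}}_{(E,m)}(b^{-1})\ \mathcal{E}(\Psi),$$ and it holds that $$\mathrm{gap}\big(\overline{\mathcal{L}_\alpha}^{(2)}\big)\ge\gamma^{-1}\mathop{\mathrm{ess\,inf}}_{(E,m)} b.$$ Here $\mathop{\mathrm{ess\,sup}}_{(E,m)}$ and $\mathop{\mathrm{ess\,inf}}_{(E,m)}$ are the essential supremum and infimum with respect to $m$, and $\Lambda,n_B,n_I,\mathcal D,\mathrm{var},\mathcal E,\mathrm{gap},\overline{\mathcal L_\alpha}^{(2)}$ are defined in the context.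
   Context: $C_{++}(E)$ is the set of uniformly positive continuous functions on $E$; $B_+(E)$ the set of nonnegative bounded Borel functions; $\mathcal{M}(E)$ the space of finite Borel measures on $E$ with the weak topology; $\mathcal{M}(E)^\circ$ the set of its non-null elements. $\langle\eta,f\rangle=\int_E f\,d\eta$, $\frac{\delta\Psi}{\delta\eta}(r)=\frac{d}{d\epsilon}\Psi(\eta+\epsilon\delta_r)|_{\epsilon=0}$, $\Psi_f(\eta)=e^{-\langle\eta,f\rangle}$. $\mathcal D$ is the linear span of the functions $\Psi_f$ with $f\in C_{++}(E)$. $\Lambda$ is the Lévy measure on $(0,\infty)$ determined by $\log(1+\lambda^\alpha)=\int\Lambda(dz)(1-e^{-\lambda z})$, $\lambda\ge0$. Moreover $n_B(dz)=\frac{\alpha+1}{\Gamma(1-\alpha)}z^{-\alpha-2}dz$ and $n_I(dz)=\frac{\alpha}{\Gamma(1-\alpha)}z^{-\alpha-1}dz$ on $(0,\infty)$. The operator $\mathcal{L}_\alpha$ is $$\mathcal{L}_\alpha\Psi(\eta)=\int_0^\infty n_B(dz)\int_E\eta(dr)a(r)\Big[\Psi(\eta+z\delta_r)-\Psi(\eta)-z\frac{\delta\Psi}{\delta\eta}(r)\Big]-\frac1\alpha\Big\langle\eta,b\frac{\delta\Psi}{\delta\eta}\Big\rangle+\int_0^\infty n_I(dz)\int_E m(dr)\big[\Psi(\eta+z\delta_r)-\Psi(\eta)\big].$$ $\mathcal F$ is the class of functions $\Psi(\eta)=\varphi(\langle\eta,f_1\rangle,\dots,\langle\eta,f_n\rangle)$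 with $n\ge1$, $\varphi\in C^2([0,\infty)^n)$ of compact support, $f_i\in C_{++}(E)$. The closure of $(\mathcal{L}_\alpha,\mathcal F)$ in $C_\infty(\mathcal M(E))$ (continuous functions vanishing at infinity) generates a $C_0$-semigroup, for which $\mathcal D$ is a core; the corresponding Markov process has a unique stationary distribution $Q_\alpha$, a probability measure on $\mathcal M(E)^\circ$ with $\int Q_\alpha(d\eta)\Psi_f(\eta)=\exp[-\langle m,a^{-1}\log(1+ab^{-1}f^\alpha)\rangle]$ for $f\in B_+(E)$. $(\mathcal{L}_\alpha,\mathcal F)$ is closable in $L^2(Q_\alpha)$, and the closure $(\overline{\mathcal{L}_\alpha}^{(2)},D(\overline{\mathcal{L}_\alpha}^{(2)}))$ generates a $C_0$-semigroup on $L^2(Q_\alpha)$. For $\Psi\in D(\overline{\mathcal{L}_\alpha}^{(2)})$ put $\mathcal{E}(\Psi)=E^{Q_\alpha}[(-\overline{\mathcal{L}_\alpha}^{(2)})\Psi\cdot\Psi]$; $\mathrm{var}(\Psi)$ is the variance of $\Psi$ under $Q_\alpha$; and $\mathrm{gap}(\overline{\mathcal{L}_\alpha}^{(2)})=\inf\{\mathcal{E}(\Psi):\mathrm{var}(\Psi)=1,\ \Psi\in D(\overline{\mathcal{L}_\alpha}^{(2)})\}$. *)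

theory Defs
  imports "HOL-Probability.Probability"
begin

section \<open>Finite measures on \<open>E\<close> with the weak topology\<close>

text \<open>The compact metric space \<open>E\<close> is a type of class \<^class>\<open>metric_space\<close>; its compactness
  is a hypothesis of the theorem.\<close>

definition fin_measures :: "'a::topological_space measure set" where
  "fin_measures = {\<eta>. sets \<eta> = sets borel \<and> finite_measure \<eta>}"

definition nonnull_measures :: "'a::topological_space measure set" where
  "nonnull_measures = {\<eta> \<in> fin_measures. emeasure \<eta> UNIV \<noteq> 0}"

definition pairing :: "'a measure \<Rightarrow> ('a \<Rightarrow> real) \<Rightarrow> real" where
  "pairing \<eta> f = (\<integral>r. f r \<partial>\<eta>)"

definition weak_topology :: "'a::topological_space measure topology" where
  "weak_topology = topology_generated_by
     {{\<eta> \<in> fin_measures. pairing \<eta> f \<in> U} | f U.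
        continuous_on UNIV f \<and> bounded (range f) \<and> open U}"

definition borel_weak :: "'a::topological_space measure measure" where
  "borel_weak = sigma fin_measures {U. openin weak_topology U}"

definition C_pp :: "('a::topological_space \<Rightarrow> real) set" where
  "C_pp = {f. continuous_on UNIV f \<and> (\<exists>c>0. \<forall>r. c \<le> f r)}"

definition B_plus :: "('a::topological_space \<Rightarrow> real) set" where
  "B_plus = {f \<in> borel_measurable borel. bounded (range f) \<and> (\<forall>r. 0 \<le> f r)}"

text \<open>\<open>add_atom \<eta> z r\<close> is the measure \<open>\<eta> + z \<delta>\<^sub>r\<close>, for \<open>z \<ge> 0\<close>.\<close>

definition add_atom :: "'a::topological_space measure \<Rightarrow> real \<Rightarrow> 'a \<Rightarrow> 'a measure" where
  "add_atom \<eta> z r = measure_of UNIV (sets borel) (\<lambda>A. emeasure \<eta> A + ennreal z * indicator A r)"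

text \<open>Functions on \<open>\<M>(E)\<close> are represented by functions on the whole type of measures, of which
  only the values on \<^const>\<open>fin_measures\<close> matter. Since \<open>\<eta> + \<epsilon> \<delta>\<^sub>r\<close> need not be a (nonnegative)
  measure for \<open>\<epsilon> < 0\<close>, the derivative in the direction \<open>\<delta>\<^sub>r\<close> at \<open>\<epsilon> = 0\<close> is the one from
  the right.\<close>

definition fderiv :: "('a::topological_space measure \<Rightarrow> real) \<Rightarrow> 'a measure \<Rightarrow> 'a \<Rightarrow> real" where
  "fderiv \<Psi> \<eta> r = Lim (at_right 0) (\<lambda>\<epsilon>. (\<Psi> (add_atom \<eta> \<epsilon> r) - \<Psi> \<eta>) / \<epsilon>)"


section \<open>The Levy measures and the operator\<close>

definition is_Lambda :: "real \<Rightarrow> real measure \<Rightarrow> bool" where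
  "is_Lambda \<alpha> \<Lambda> \<longleftrightarrow> sets \<Lambda> = sets borel \<and> emeasure \<Lambda> {..0} = 0 \<and>
     (\<forall>l\<ge>0. (\<integral>\<^sup>+z. ennreal (1 - exp (- l * z)) \<partial>\<Lambda>) = ennreal (ln (1 + l powr \<alpha>)))"

definition n_B :: "real \<Rightarrow> real measure" where
  "n_B \<alpha> = density lborel (\<lambda>z. ennreal (indicator {0<..} z *
     ((\<alpha> + 1) / Gamma (1 - \<alpha>) * z powr (- \<alpha> - 2))))"

definition n_I :: "real \<Rightarrow> real measure" where
  "n_I \<alpha> = density lborel (\<lambda>z. ennreal (indicator {0<..} z *
     (\<alpha> / Gamma (1 - \<alpha>) * z powr (- \<alpha> - 1))))"

definition L_op :: "real \<Rightarrow> ('a::topological_space \<Rightarrow> real) \<Rightarrow> ('a \<Rightarrow> real) \<Rightarrow> 'a measure \<Rightarrow>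
    ('a measure \<Rightarrow> real) \<Rightarrow> 'a measure \<Rightarrow> real" where
  "L_op \<alpha> a b m \<Psi> \<eta> =
     (\<integral>z. (\<integral>r. a r * (\<Psi> (add_atom \<eta> z r) - \<Psi> \<eta> - z * fderiv \<Psi> \<eta> r) \<partial>\<eta>) \<partial>n_B \<alpha>)
     - 1 / \<alpha> * pairing \<eta> (\<lambda>r. b r * fderiv \<Psi> \<eta> r)
     + (\<integral>z. (\<integral>r. \<Psi> (add_atom \<eta> z r) - \<Psi> \<eta> \<partial>m) \<partial>n_I \<alpha>)"


section \<open>The classes \<open>\<D>\<close> and \<open>\<F>\<close>, and the span \<open>D\<close> of exponentials\<close>

definition D_exp :: "('a::topological_space measure \<Rightarrow> real) set" where
  "D_exp = {\<Psi>. \<exists>(n::nat) c f. (\<forall>i<n. f i \<in> C_pp) \<and>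
     \<Psi> = (\<lambda>\<eta>. \<Sum>i<n. c i * exp (- pairing \<eta> (f i)))}"

definition D_exp_real :: "(real \<Rightarrow> real) set" where
  "D_exp_real = {F. \<exists>(n::nat) c l. (\<forall>i<n. 0 < l i) \<and>
     F = (\<lambda>z. \<Sum>i<n. c i * exp (- l i * z))}"

text \<open>\<open>[0,\<infinity>)\<^sup>n\<close>: since \<open>n\<close> varies inside the definition of \<open>\<F>\<close>, its points are
  sequences vanishing from index \<open>n\<close> on, with the product topology of \<^typ>\<open>nat \<Rightarrow> real\<close>.\<close>

definition orthant :: "nat \<Rightarrow> (nat \<Rightarrow> real) set" where
  "orthant n = {x. (\<forall>i<n. 0 \<le> x i) \<and> (\<forall>i\<ge>n. x i = 0)}"

text \<open>\<open>Ck_orthant k n \<phi>\<close>: the partial derivatives of \<open>\<phi>\<close> up to order \<open>k\<close> exist and are continuous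
  on \<open>[0,\<infinity>)\<^sup>n\<close>, where on the boundary derivatives are one-sided.\<close>

fun Ck_orthant :: "nat \<Rightarrow> nat \<Rightarrow> ((nat \<Rightarrow> real) \<Rightarrow> real) \<Rightarrow> bool" where
  "Ck_orthant 0 n \<phi> \<longleftrightarrow> continuous_on (orthant n) \<phi>"
| "Ck_orthant (Suc k) n \<phi> \<longleftrightarrow> continuous_on (orthant n) \<phi> \<and>
     (\<exists>g. \<forall>i<n. Ck_orthant k n (g i) \<and>
        (\<forall>x\<in>orthant n.
           ((\<lambda>t. \<phi> (x(i := t))) has_real_derivative g i x) (at (x i) within {0..})))"

definition F_class :: "('a::topological_space measure \<Rightarrow> real) set" where
  "F_class = {\<Psi>. \<exists>n \<phi> f. 1 \<le> n \<and> Ck_orthant 2 n \<phi> \<and>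
     compact (closure {x \<in> orthant n. \<phi> x \<noteq> 0}) \<and> (\<forall>i<n. f i \<in> C_pp) \<and>
     \<Psi> = (\<lambda>\<eta>. \<phi> (\<lambda>i. if i < n then pairing \<eta> (f i) else 0))}"


section \<open>The semigroup on \<open>C\<^sub>\<infinity>(\<M>(E))\<close>\<close>

text \<open>Operators are represented by their graphs. All graphs obtained by closure are saturated under
  changing functions outside \<^const>\<open>fin_measures\<close>.\<close>

definition C_inf :: "('a::topological_space measure \<Rightarrow> real) set" where
  "C_inf = {\<Phi>. continuous_map weak_topology euclideanreal \<Phi> \<and>
     (\<forall>\<epsilon>>0. \<exists>K. compactin weak_topology K \<and> (\<forall>\<eta>\<in>fin_measures - K. \<bar>\<Phi> \<eta>\<bar> < \<epsilon>))}"

definition op_graph :: "('b \<Rightarrow> 'c) \<Rightarrow> 'b set \<Rightarrow> ('b \<times> 'c) set" where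
  "op_graph L S = {(\<Phi>, L \<Phi>) | \<Phi>. \<Phi> \<in> S}"

definition closure_C_inf ::
    "(('a::topological_space measure \<Rightarrow> real) \<times> ('a measure \<Rightarrow> real)) set \<Rightarrow>
     (('a measure \<Rightarrow> real) \<times> ('a measure \<Rightarrow> real)) set" where
  "closure_C_inf R = {(\<Phi>, \<Theta>). \<Phi> \<in> C_inf \<and> \<Theta> \<in> C_inf \<and>
     (\<exists>u v. (\<forall>n::nat. (u n, v n) \<in> R) \<and>
        uniform_limit fin_measures u \<Phi> sequentially \<and>
        uniform_limit fin_measures v \<Theta> sequentially)}"

definition C0_semigroup ::
    "(real \<Rightarrow> ('a::topological_space measure \<Rightarrow> real) \<Rightarrow> ('a measure \<Rightarrow> real)) \<Rightarrow> bool" where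
  "C0_semigroup T \<longleftrightarrow>
     (\<forall>t\<ge>0. \<forall>\<Phi>\<in>C_inf. T t \<Phi> \<in> C_inf) \<and>
     (\<forall>t\<ge>0. \<forall>\<Phi>\<in>C_inf. \<forall>\<Theta>\<in>C_inf. \<forall>c d. \<forall>\<eta>\<in>fin_measures.
        T t (\<lambda>\<xi>. c * \<Phi> \<xi> + d * \<Theta> \<xi>) \<eta> = c * T t \<Phi> \<eta> + d * T t \<Theta> \<eta>) \<and>
     (\<forall>t\<ge>0. \<exists>C. \<forall>\<Phi>\<in>C_inf. \<forall>B. (\<forall>\<eta>\<in>fin_measures. \<bar>\<Phi> \<eta>\<bar> \<le> B) \<longrightarrow>
        (\<forall>\<eta>\<in>fin_measures. \<bar>T t \<Phi> \<eta>\<bar> \<le> C * B)) \<and>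
     (\<forall>\<Phi>\<in>C_inf. \<forall>\<eta>\<in>fin_measures. T 0 \<Phi> \<eta> = \<Phi> \<eta>) \<and>
     (\<forall>s\<ge>0. \<forall>t\<ge>0. \<forall>\<Phi>\<in>C_inf. \<forall>\<eta>\<in>fin_measures. T (s + t) \<Phi> \<eta> = T s (T t \<Phi>) \<eta>) \<and>
     (\<forall>\<Phi>\<in>C_inf. uniform_limit fin_measures (\<lambda>t. T t \<Phi>) \<Phi> (at_right 0))"

definition generator ::
    "(real \<Rightarrow> ('a::topological_space measure \<Rightarrow> real) \<Rightarrow> ('a measure \<Rightarrow> real)) \<Rightarrow>
     (('a measure \<Rightarrow> real) \<times> ('a measure \<Rightarrow> real)) set" where
  "generator T = {(\<Phi>, \<Theta>). \<Phi> \<in> C_inf \<and> \<Theta> \<in> C_inf \<and>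
     uniform_limit fin_measures (\<lambda>t \<eta>. (T t \<Phi> \<eta> - \<Phi> \<eta>) / t) \<Theta> (at_right 0)}"

definition is_core ::
    "('a::topological_space measure \<Rightarrow> real) set \<Rightarrow>
     (('a measure \<Rightarrow> real) \<times> ('a measure \<Rightarrow> real)) set \<Rightarrow> bool" where
  "is_core S G \<longleftrightarrow> S \<subseteq> Domain G \<and> closure_C_inf {(\<Phi>, \<Theta>) \<in> G. \<Phi> \<in> S} = G"

definition stationary ::
    "(real \<Rightarrow> ('a::topological_space measure \<Rightarrow> real) \<Rightarrow> ('a measure \<Rightarrow> real)) \<Rightarrow>
     'a measure measure \<Rightarrow> bool" where
  "stationary T Q \<longleftrightarrow> prob_space Q \<and> sets Q = sets borel_weak \<and>
     (\<forall>t\<ge>0. \<forall>\<Phi>\<in>C_inf. (\<integral>\<eta>. T t \<Phi> \<eta> \<partial>Q) = (\<integral>\<eta>. \<Phi> \<eta> \<partial>Q))"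


section \<open>The closure in \<open>L\<^sup>2(Q)\<close>, energy, and spectral gap\<close>

text \<open>Elements of \<open>L\<^sup>2(Q)\<close> are represented by square-integrable functions, identified when
  equal almost everywhere; the closures below are saturated under this identification.\<close>

definition L2_space :: "'b measure \<Rightarrow> ('b \<Rightarrow> real) set" where
  "L2_space Q = {\<Phi> \<in> borel_measurable Q. integrable Q (\<lambda>\<eta>. (\<Phi> \<eta>)\<^sup>2)}"

definition closure_L2 ::
    "'b measure \<Rightarrow> (('b \<Rightarrow> real) \<times> ('b \<Rightarrow> real)) set \<Rightarrow> (('b \<Rightarrow> real) \<times> ('b \<Rightarrow> real)) set" where
  "closure_L2 Q R = {(\<Phi>, \<Theta>). \<Phi> \<in> L2_space Q \<and> \<Theta> \<in> L2_space Q \<and>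
     (\<exists>u v. (\<forall>n::nat. (u n, v n) \<in> R \<and> u n \<in> L2_space Q \<and> v n \<in> L2_space Q) \<and>
        (\<lambda>n. \<integral>\<eta>. (u n \<eta> - \<Phi> \<eta>)\<^sup>2 \<partial>Q) \<longlonglongrightarrow> 0 \<and>
        (\<lambda>n. \<integral>\<eta>. (v n \<eta> - \<Theta> \<eta>)\<^sup>2 \<partial>Q) \<longlonglongrightarrow> 0)}"

definition closable_L2 :: "'b measure \<Rightarrow> (('b \<Rightarrow> real) \<times> ('b \<Rightarrow> real)) set \<Rightarrow> bool" where
  "closable_L2 Q R \<longleftrightarrow>
     (\<forall>(\<Phi>, \<Theta>) \<in> closure_L2 Q R. (AE \<eta> in Q. \<Phi> \<eta> = 0) \<longrightarrow> (AE \<eta> in Q. \<Theta> \<eta> = 0))"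

text \<open>The graph of the closed operator \<open>(\<L>\<^sub>\<alpha>, \<F>)\<close> in \<open>L\<^sup>2(Q)\<close>, its domain, and its values.
  By closability, \<open>Lbar\<close> is determined almost everywhere.\<close>

definition Lbar_graph :: "real \<Rightarrow> ('a::topological_space \<Rightarrow> real) \<Rightarrow> ('a \<Rightarrow> real) \<Rightarrow> 'a measure \<Rightarrow>
    'a measure measure \<Rightarrow> (('a measure \<Rightarrow> real) \<times> ('a measure \<Rightarrow> real)) set" where
  "Lbar_graph \<alpha> a b m Q = closure_L2 Q (op_graph (L_op \<alpha> a b m) F_class)"

definition Lbar_dom :: "real \<Rightarrow> ('a::topological_space \<Rightarrow> real) \<Rightarrow> ('a \<Rightarrow> real) \<Rightarrow> 'a measure \<Rightarrow>
    'a measure measure \<Rightarrow> ('a measure \<Rightarrow> real) set" where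
  "Lbar_dom \<alpha> a b m Q = Domain (Lbar_graph \<alpha> a b m Q)"

definition Lbar :: "real \<Rightarrow> ('a::topological_space \<Rightarrow> real) \<Rightarrow> ('a \<Rightarrow> real) \<Rightarrow> 'a measure \<Rightarrow>
    'a measure measure \<Rightarrow> ('a measure \<Rightarrow> real) \<Rightarrow> 'a measure \<Rightarrow> real" where
  "Lbar \<alpha> a b m Q \<Psi> = (SOME \<Theta>. (\<Psi>, \<Theta>) \<in> Lbar_graph \<alpha> a b m Q)"

definition energy :: "real \<Rightarrow> ('a::topological_space \<Rightarrow> real) \<Rightarrow> ('a \<Rightarrow> real) \<Rightarrow> 'a measure \<Rightarrow>
    'a measure measure \<Rightarrow> ('a measure \<Rightarrow> real) \<Rightarrow> real" where
  "energy \<alpha> a b m Q \<Psi> = (\<integral>\<eta>. - Lbar \<alpha> a b m Q \<Psi> \<eta> * \<Psi> \<eta> \<partial>Q)"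

text \<open>The gap is an infimum in the extended reals.\<close>

definition gap :: "real \<Rightarrow> ('a::topological_space \<Rightarrow> real) \<Rightarrow> ('a \<Rightarrow> real) \<Rightarrow> 'a measure \<Rightarrow>
    'a measure measure \<Rightarrow> ereal" where
  "gap \<alpha> a b m Q = Inf {ereal (energy \<alpha> a b m Q \<Psi>) | \<Psi>.
     \<Psi> \<in> Lbar_dom \<alpha> a b m Q \<and> prob_space.variance Q \<Psi> = 1}"

text \<open>The counterpart of the library's \<^const>\<open>esssup\<close>.\<close>

definition essinf :: "'b measure \<Rightarrow> ('b \<Rightarrow> ereal) \<Rightarrow> ereal" where
  "essinf M f = (if f \<in> borel_measurable M then Liminf (ae_filter M) f else bot)"

end

theory Submission
  imports Defs
begin

text \<open>
  Under \<open>Q\<close> the random measure is a sum of atoms \<open>z \<delta>\<^sub>r\<close> of a Poisson process, and both sides of the claim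
  can be computed on \<open>\<Psi> = \<Sum>\<^sub>i c\<^sub>i exp (- \<langle>\<eta>, f\<^sub>i\<rangle>)\<close> from the Laplace functional alone. With \<open>d\<^sub>i = c\<^sub>i E[exp (- \<langle>\<eta>, f\<^sub>i\<rangle>)]\<close>
  and \<open>k\<^sub>i\<^sub>j\<close> the Gram matrix of the functions \<open>1 - exp (- z f\<^sub>i(r))\<close> under the intensity of the Poisson process,
  the variance is \<open>\<Sum> d\<^sub>i d\<^sub>j (exp k\<^sub>i\<^sub>j - 1)\<close> and the energy is \<open>1/2 \<Sum> d\<^sub>i d\<^sub>j exp k\<^sub>i\<^sub>j \<langle>m, \<epsilon>\<^sub>i\<^sub>j\<rangle>\<close>. The one-dimensional
  inequality, rescaled by \<open>(a/b)\<^sup>1\<^sup>/\<^sup>\<alpha>\<close> at each point \<open>r\<close>, bounds \<open>k\<close> by a multiple of \<open>\<langle>m, \<epsilon>\<rangle>\<close> as quadratic forms. By the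
  Schur product theorem this survives entrywise multiplication by \<open>exp k\<close>, and
  \<open>exp k - 1 \<le> k exp k\<close> because \<open>x exp x - exp x + 1\<close> has nonnegative Taylor coefficients.

  The functions in \<open>\<F>\<close> and their images under \<open>\<L>\<^sub>\<alpha>\<close> lie in \<open>C\<^sub>\<infinity>\<close>, so that \<open>\<F>\<close> lies in the domain of the generator.
  Approximating the exponentials from \<open>\<F>\<close> identifies the generator on \<open>\<D>\<close>; since \<open>\<D>\<close> is a core, the
  inequality passes to \<open>\<F>\<close> by uniform limits and then to the \<open>L\<^sup>2\<close> closure.
\<close>

section \<open>The jump measures\<close>

text \<open>Three obstacles shape the proof. The Laplace exponent behaves like \<lambda> to the
  power \<alpha> < 1 near 0, so \<langle>\<eta>, g\<rangle> has infinite mean; it therefore appears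
  only together with the weight exp (- \<langle>\<eta>, f\<rangle>), and is dominated through g
  \<le> D f on the compact space. The coefficients of the operator are affine in \<eta>, hence
  unbounded. A cutoff of exp (- x) that is to approximate in the graph norm must be accurate, with
  two derivatives, to a small multiple of 1 / (1 + x). Vanishing at infinity requires weakly compact
  sets of measures. They are not constructed by a tightness argument but read off from the core
  hypothesis, which places the functions exp (- \<langle>\<eta>, f\<rangle>) in
  \<open>C_inf\<close>. As to constants, the factor 1/2 beside \<gamma> in the hypothesis is
  compensated by the 1/2 that the energy acquires when its matrix is symmetrised, and the essential
  supremum of 1/b enters because the rescaling at a point of E multiplies the right-hand side by a/b
  while the exponent itself carries 1/a.\<close>

lemma sets_n_B [measurable_cong, simp]: "sets (n_B \<alpha>) = sets borel"
  and sets_n_I [measurable_cong, simp]: "sets (n_I \<alpha>) = sets borel"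
  by (simp_all add: n_B_def n_I_def)

lemma space_n_B [simp]: "space (n_B \<alpha>) = UNIV"
  and space_n_I [simp]: "space (n_I \<alpha>) = UNIV"
  by (simp_all add: n_B_def n_I_def)

lemma sigma_finite_n_B: "sigma_finite_measure (n_B \<alpha>)"
  and sigma_finite_n_I: "sigma_finite_measure (n_I \<alpha>)"
  unfolding n_B_def n_I_def
  by (subst sigma_finite_measure.sigma_finite_iff_density_finite[OF lborel.sigma_finite_measure_axioms]; simp)+

lemma AE_n_B_pos: "AE z in n_B \<alpha>. 0 < z"
  and AE_n_I_pos: "AE z in n_I \<alpha>. 0 < z"
  unfolding n_B_def n_I_def by (subst AE_density; simp add: indicator_def)+

text \<open>The Gamma integral after the substitution of t z for z. Every explicit integral against
  the two jump measures comes down to it.\<close>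

lemma nn_integral_powr_exp:
  fixes s t :: real
  assumes "0 < s" "0 < t"
  shows "(\<integral>\<^sup>+z. ennreal (indicator {0<..} z * (z powr (s - 1) * exp (- t * z))) \<partial>lborel)
     = ennreal (Gamma s * t powr (- s))"
proof -
  let ?f = "\<lambda>z::real. ennreal (indicator {0..} z * z powr (s - 1) / exp z)"
  have "ennreal (Gamma s) = (\<integral>\<^sup>+z. ?f z \<partial>lborel)"
    using Gamma_conv_nn_integral_real[OF assms(1)] by simp
  also have "\<dots> = ennreal \<bar>t\<bar> * (\<integral>\<^sup>+z. ?f (0 + t * z) \<partial>lborel)"
    by (rule nn_integral_real_affine) (use assms in auto)
  also have "(\<integral>\<^sup>+z. ?f (0 + t * z) \<partial>lborel) =
     (\<integral>\<^sup>+z. ennreal (t powr (s - 1)) * ennreal (indicator {0<..} z * (z powr (s - 1) * exp (- t * z))) \<partial>lborel)"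
    using assms
    by (intro nn_integral_cong)
       (auto simp: indicator_def powr_mult exp_minus divide_simps zero_le_mult_iff simp flip: ennreal_mult)
  also have "\<dots> = ennreal (t powr (s - 1)) *
      (\<integral>\<^sup>+z. ennreal (indicator {0<..} z * (z powr (s - 1) * exp (- t * z))) \<partial>lborel)"
    by (rule nn_integral_cmult) auto
  finally have "ennreal (Gamma s) = ennreal t * (ennreal (t powr (s - 1)) *
      (\<integral>\<^sup>+z. ennreal (indicator {0<..} z * (z powr (s - 1) * exp (- t * z))) \<partial>lborel))" (is "_ = _ * (_ * ?I)")
    using assms by simp
  also have "\<dots> = ennreal (t powr s) * ?I"
    using assms by (simp add: mult.assoc[symmetric] powr_mult_base flip: ennreal_mult)
  finally have *: "ennreal (t powr s) * ?I = ennreal (Gamma s)" by simp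
  have "?I = ennreal (t powr (-s)) * (ennreal (t powr s) * ?I)"
    using assms by (simp add: mult.assoc[symmetric] flip: ennreal_mult powr_add)
  also have "\<dots> = ennreal (Gamma s * t powr (- s))"
    unfolding * using assms by (simp add: mult.commute Gamma_real_pos flip: ennreal_mult)
  finally show ?thesis .
qed

lemma nn_integral_n_I_exp:
  assumes "0 < \<alpha>" "\<alpha> < 1" "0 < t"
  shows "(\<integral>\<^sup>+z. ennreal (z * exp (- t * z)) \<partial>n_I \<alpha>) = ennreal (\<alpha> * t powr (\<alpha> - 1))"
proof -
  have G: "0 < Gamma (1 - \<alpha>)" using assms by (simp add: Gamma_real_pos)
  have "(\<integral>\<^sup>+z. ennreal (z * exp (- t * z)) \<partial>n_I \<alpha>) =
     (\<integral>\<^sup>+z. ennreal (\<alpha> / Gamma (1 - \<alpha>)) * ennreal (indicator {0<..} z * (z powr ((1 - \<alpha>) - 1) * exp (- t * z))) \<partial>lborel)"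
  proof -
    have "z powr (- \<alpha> - 1) * z = z powr (- \<alpha>)" if "0 < z" for z
      using powr_mult_base[of z "- \<alpha> - 1"] that by (simp add: mult.commute)
    then have "ennreal (indicator {0<..} z * (\<alpha> / Gamma (1 - \<alpha>) * z powr (- \<alpha> - 1))) * ennreal (z * exp (- t * z))
        = ennreal (\<alpha> / Gamma (1 - \<alpha>)) * ennreal (indicator {0<..} z * (z powr ((1 - \<alpha>) - 1) * exp (- t * z)))" for z
      using assms G by (cases "0 < z") (simp_all add: algebra_simps flip: ennreal_mult)
    then show ?thesis
      unfolding n_I_def by (subst nn_integral_density) simp_all
  qed
  also have "\<dots> = ennreal (\<alpha> / Gamma (1 - \<alpha>)) * ennreal (Gamma (1 - \<alpha>) * t powr (- (1 - \<alpha>)))"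
    using assms by (subst nn_integral_cmult, simp, subst nn_integral_powr_exp) auto
  finally show ?thesis
    using assms G by (simp flip: ennreal_mult)
qed

text \<open>Comparing densities turns branching integrals into immigration integrals. The
  singularity of \<open>n_B\<close> at 0 is too strong for the Gamma integral to be applied to it
  directly.\<close>

lemma nn_integral_n_B:
  assumes "0 < \<alpha>" "\<alpha> < 1" "g \<in> borel_measurable borel"
  shows "(\<integral>\<^sup>+z. ennreal z * g z \<partial>n_B \<alpha>) = ennreal ((\<alpha> + 1) / \<alpha>) * (\<integral>\<^sup>+z. g z \<partial>n_I \<alpha>)"
proof -
  have G: "0 < Gamma (1 - \<alpha>)" using assms by (simp add: Gamma_real_pos)
  note [measurable] = assms(3)
  have dens: "ennreal (indicator {0<..} z * ((\<alpha> + 1) / Gamma (1 - \<alpha>) * z powr (- \<alpha> - 2))) * (ennreal z * g z)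
      = ennreal ((\<alpha> + 1) / \<alpha>) * (ennreal (indicator {0<..} z * (\<alpha> / Gamma (1 - \<alpha>) * z powr (- \<alpha> - 1))) * g z)" for z
  proof (cases "0 < z")
    case True
    then have "z powr (- \<alpha> - 2) * z = z powr (- \<alpha> - 1)"
      using powr_mult_base[of z "- \<alpha> - 2"] by (simp add: mult.commute minus_diff_commute)
    then have "indicator {0<..} z * ((\<alpha> + 1) / Gamma (1 - \<alpha>) * z powr (- \<alpha> - 2)) * z =
      (\<alpha> + 1) / \<alpha> * (indicator {0<..} z * (\<alpha> / Gamma (1 - \<alpha>) * z powr (- \<alpha> - 1)))"
      using True assms G by (simp add: mult.assoc)
    then have "ennreal (indicator {0<..} z * ((\<alpha> + 1) / Gamma (1 - \<alpha>) * z powr (- \<alpha> - 2))) * ennreal z =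
      ennreal ((\<alpha> + 1) / \<alpha>) * ennreal (indicator {0<..} z * (\<alpha> / Gamma (1 - \<alpha>) * z powr (- \<alpha> - 1)))"
      using True assms G by (simp flip: ennreal_mult)
    then show ?thesis by (simp add: mult.assoc[symmetric])
  qed simp
  have "(\<integral>\<^sup>+z. ennreal z * g z \<partial>n_B \<alpha>) = (\<integral>\<^sup>+z. ennreal ((\<alpha> + 1) / \<alpha>) *
      (ennreal (indicator {0<..} z * (\<alpha> / Gamma (1 - \<alpha>) * z powr (- \<alpha> - 1))) * g z) \<partial>lborel)"
    unfolding n_B_def by (subst nn_integral_density) (simp_all only: dens, auto)
  also have "\<dots> = ennreal ((\<alpha> + 1) / \<alpha>) * (\<integral>\<^sup>+z. g z \<partial>n_I \<alpha>)"
    unfolding n_I_def by (subst nn_integral_cmult) (auto simp: nn_integral_density)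
  finally show ?thesis .
qed

text \<open>Tonelli, used with \<open>k t z\<close> the derivative in t of the integrand of
  interest: integrating in t from 0 to l raises the order of the integrand at 0 by one. The formula
  for the z-integral holds only for t > 0, so the null set t = 0 is discarded.\<close>

lemma nn_integral_interchange_Icc:
  fixes k :: "real \<Rightarrow> real \<Rightarrow> real"
  assumes "sigma_finite_measure M" and M: "sets M = sets borel" "AE z in M. 0 < z"
    and k: "(\<lambda>(t, z). k t z) \<in> borel_measurable (borel \<Otimes>\<^sub>M borel)"
    and F: "\<And>z. 0 < z \<Longrightarrow> (\<integral>\<^sup>+t. ennreal (k t z) * indicator {0..l} t \<partial>lborel) = ennreal (F z)"
    and G: "\<And>t. 0 < t \<Longrightarrow> (\<integral>\<^sup>+z. ennreal (k t z) \<partial>M) = ennreal (G t)"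
  shows "(\<integral>\<^sup>+z. ennreal (F z) \<partial>M) = (\<integral>\<^sup>+t. ennreal (G t) * indicator {0..l} t \<partial>lborel)"
proof -
  interpret M: sigma_finite_measure M by fact
  interpret pair_sigma_finite lborel M ..
  have [measurable_cong]: "sets M = sets borel" by fact
  have [measurable]: "case_prod k \<in> borel_measurable (borel \<Otimes>\<^sub>M borel)" using k by simp
  have "(\<integral>\<^sup>+z. ennreal (F z) \<partial>M) = (\<integral>\<^sup>+z. (\<integral>\<^sup>+t. ennreal (k t z) * indicator {0..l} t \<partial>lborel) \<partial>M)"
    using M(2) by (intro nn_integral_cong_AE) (auto simp: F)
  also have "\<dots> = (\<integral>\<^sup>+t. (\<integral>\<^sup>+z. ennreal (k t z) * indicator {0..l} t \<partial>M) \<partial>lborel)"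
    by (subst Fubini') auto
  also have "\<dots> = (\<integral>\<^sup>+t. ennreal (G t) * indicator {0..l} t \<partial>lborel)"
  proof (rule nn_integral_cong_AE)
    have "AE t in lborel. t \<noteq> (0::real)" by (rule AE_lborel_singleton)
    then show "AE t in lborel. (\<integral>\<^sup>+z. ennreal (k t z) * indicator {0..l} t \<partial>M) = ennreal (G t) * indicator {0..l} t"
    proof eventually_elim
      case (elim t)
      have "(\<lambda>z. ennreal (k t z)) \<in> borel_measurable M" by measurable
      then show ?case using elim G[of t]
        by (subst nn_integral_multc) (auto simp: indicator_def)
    qed
  qed
  finally show ?thesis .
qed

lemma nn_integral_powr_Icc:
  fixes p l :: real
  assumes "- 1 < p" "0 \<le> l" "0 \<le> C"
  shows "(\<integral>\<^sup>+t. ennreal (C * t powr p) * indicator {0..l} t \<partial>lborel) = ennreal (C * (l powr (p + 1) / (p + 1)))"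
  by (rule nn_integral_has_integral_lebesgue')
     (use assms in \<open>auto intro!: has_integral_mult_right has_integral_powr_from_0 simp del: times_divide_eq_right\<close>)

lemma nn_integral_n_I_one_minus_exp:
  assumes "0 < \<alpha>" "\<alpha> < 1" "0 \<le> l"
  shows "(\<integral>\<^sup>+z. ennreal (1 - exp (- l * z)) \<partial>n_I \<alpha>) = ennreal (l powr \<alpha>)"
proof -
  have "(\<integral>\<^sup>+z. ennreal (1 - exp (- l * z)) \<partial>n_I \<alpha>) =
     (\<integral>\<^sup>+t. ennreal (\<alpha> * t powr (\<alpha> - 1)) * indicator {0..l} t \<partial>lborel)"
  proof (rule nn_integral_interchange_Icc[where k = "\<lambda>t z. z * exp (- t * z)"])
    show "(\<integral>\<^sup>+t. ennreal (z * exp (- t * z)) * indicator {0..l} t \<partial>lborel) = ennreal (1 - exp (- l * z))"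
      if "0 < z" for z
    proof -
      have "(\<integral>\<^sup>+t. ennreal (z * exp (- t * z)) * indicator {0..l} t \<partial>lborel)
          = (- exp (- l * z)) - (- exp (- 0 * z))"
        by (rule nn_integral_FTC_Icc) (use that assms in \<open>auto intro!: derivative_eq_intros\<close>)
      then show ?thesis by simp
    qed
  qed (use assms in \<open>auto simp: sigma_finite_n_I AE_n_I_pos nn_integral_n_I_exp[simplified]\<close>)
  also have "\<dots> = ennreal (\<alpha> * (l powr (\<alpha> - 1 + 1) / (\<alpha> - 1 + 1)))"
    by (rule nn_integral_powr_Icc) (use assms in auto)
  finally show ?thesis using assms by simp
qed

lemma nn_integral_n_B_one_minus_exp:
  assumes "0 < \<alpha>" "\<alpha> < 1" "0 \<le> l"
  shows "(\<integral>\<^sup>+z. ennreal (z * (1 - exp (- l * z))) \<partial>n_B \<alpha>) = ennreal ((\<alpha> + 1) / \<alpha> * l powr \<alpha>)"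
proof -
  have "(\<integral>\<^sup>+z. ennreal (z * (1 - exp (- l * z))) \<partial>n_B \<alpha>) = (\<integral>\<^sup>+z. ennreal z * ennreal (1 - exp (- l * z)) \<partial>n_B \<alpha>)"
    using AE_n_B_pos[of \<alpha>] assms
    by (intro nn_integral_cong_AE) (auto elim!: eventually_mono simp: ennreal_mult)
  also have "\<dots> = ennreal ((\<alpha> + 1) / \<alpha> * l powr \<alpha>)"
    using assms by (subst nn_integral_n_B) (auto simp: nn_integral_n_I_one_minus_exp[simplified] simp flip: ennreal_mult)
  finally show ?thesis .
qed

lemma exp_minus_ge: "0 \<le> exp (- x) - 1 + (x::real)"
  using exp_ge_add_one_self[of "-x"] by simp

lemma nn_integral_n_B_exp:
  assumes "0 < \<alpha>" "\<alpha> < 1" "0 \<le> l"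
  shows "(\<integral>\<^sup>+z. ennreal (exp (- l * z) - 1 + l * z) \<partial>n_B \<alpha>) = ennreal (l powr (\<alpha> + 1) / \<alpha>)"
proof -
  have "(\<integral>\<^sup>+z. ennreal (exp (- l * z) - 1 + l * z) \<partial>n_B \<alpha>) =
     (\<integral>\<^sup>+t. ennreal ((\<alpha> + 1) / \<alpha> * t powr \<alpha>) * indicator {0..l} t \<partial>lborel)"
  proof (rule nn_integral_interchange_Icc[where k = "\<lambda>t z. z * (1 - exp (- t * z))"])
    show "(\<integral>\<^sup>+t. ennreal (z * (1 - exp (- t * z))) * indicator {0..l} t \<partial>lborel) = ennreal (exp (- l * z) - 1 + l * z)"
      if "0 < z" for z
    proof -
      have "(\<integral>\<^sup>+t. ennreal (z * (1 - exp (- t * z))) * indicator {0..l} t \<partial>lborel)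
          = (exp (- l * z) + l * z) - (exp (- 0 * z) + 0 * z)"
        by (rule nn_integral_FTC_Icc) (use that assms in \<open>auto intro!: derivative_eq_intros simp: algebra_simps\<close>)
      then show ?thesis by (simp add: algebra_simps)
    qed
  qed (use assms in \<open>auto simp: sigma_finite_n_B AE_n_B_pos nn_integral_n_B_one_minus_exp[simplified]\<close>)
  also have "\<dots> = ennreal ((\<alpha> + 1) / \<alpha> * (l powr (\<alpha> + 1) / (\<alpha> + 1)))"
    by (rule nn_integral_powr_Icc) (use assms in auto)
  finally show ?thesis using assms by simp
qed

lemma has_bochner_integral_n_I:
  assumes "0 < \<alpha>" "\<alpha> < 1" "0 \<le> l"
  shows "has_bochner_integral (n_I \<alpha>) (\<lambda>z. 1 - exp (- l * z)) (l powr \<alpha>)"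
  using assms AE_n_I_pos[of \<alpha>]
  by (intro has_bochner_integral_nn_integral nn_integral_n_I_one_minus_exp) (auto elim!: eventually_mono)

lemma has_bochner_integral_n_B:
  assumes "0 < \<alpha>" "\<alpha> < 1" "0 \<le> l"
  shows "has_bochner_integral (n_B \<alpha>) (\<lambda>z. exp (- l * z) - 1 + l * z) (l powr (\<alpha> + 1) / \<alpha>)"
  using assms
  by (intro has_bochner_integral_nn_integral nn_integral_n_B_exp) (auto intro!: exp_minus_ge)

text \<open>All jump estimates use the weight \<open>min 1 z\<close>; the function 1 - exp (- z),
  whose integrals are explicit, controls it because exp z \<ge> 1 + z.\<close>

lemma min_le_one_minus_exp: "min 1 z \<le> 2 * (1 - exp (- z))" if "0 \<le> z" for z :: real
proof -
  have "exp (- z) \<le> 1 / (1 + z)"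
    using exp_ge_add_one_self[of z] that by (simp add: exp_minus divide_simps)
  moreover have "min 1 z \<le> 2 * (1 - 1 / (1 + z))"
  proof (cases "z \<le> 1")
    case True
    then have "z * z \<le> z" using that by (simp add: mult_left_le)
    then show ?thesis using that True by (auto simp: divide_simps min_def algebra_simps)
  qed (use that in \<open>auto simp: divide_simps min_def algebra_simps\<close>)
  ultimately show ?thesis
    unfolding right_diff_distrib by linarith
qed

lemma integrable_n_I_min:
  assumes "0 < \<alpha>" "\<alpha> < 1"
  shows "integrable (n_I \<alpha>) (\<lambda>z. min 1 z)"
proof (rule Bochner_Integration.integrable_bound)
  show "integrable (n_I \<alpha>) (\<lambda>z. 2 * (1 - exp (- 1 * z)))"
    using has_bochner_integral_n_I[OF assms, of 1] by (intro integrable_mult_right) (auto simp: has_bochner_integral_iff)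
  show "AE z in n_I \<alpha>. norm (min 1 z) \<le> norm (2 * (1 - exp (- 1 * z)))"
    using AE_n_I_pos[of \<alpha>] by eventually_elim (use min_le_one_minus_exp in auto)
qed simp

lemma integrable_n_B_min:
  assumes "0 < \<alpha>" "\<alpha> < 1"
  shows "integrable (n_B \<alpha>) (\<lambda>z. z * min 1 z)"
proof (rule Bochner_Integration.integrable_bound)
  have "has_bochner_integral (n_B \<alpha>) (\<lambda>z. z * (1 - exp (- 1 * z))) ((\<alpha> + 1) / \<alpha> * 1 powr \<alpha>)"
    using assms AE_n_B_pos[of \<alpha>]
    by (intro has_bochner_integral_nn_integral nn_integral_n_B_one_minus_exp) (auto elim!: eventually_mono)
  then show "integrable (n_B \<alpha>) (\<lambda>z. 2 * (z * (1 - exp (- 1 * z))))"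
    by (intro integrable_mult_right) (auto simp: has_bochner_integral_iff)
  show "AE z in n_B \<alpha>. norm (z * min 1 z) \<le> norm (2 * (z * (1 - exp (- 1 * z))))"
    using AE_n_B_pos[of \<alpha>]
  proof eventually_elim
    case (elim z)
    then have "z * min 1 z \<le> z * (2 * (1 - exp (- z)))"
      using min_le_one_minus_exp[of z] by (intro mult_left_mono) auto
    then show ?case using elim by (simp add: abs_mult)
  qed
qed simp

section \<open>The Levy measure and quadratic forms\<close>

lemma sets_Lambda: "is_Lambda \<alpha> \<Lambda> \<Longrightarrow> sets \<Lambda> = sets borel"
  by (simp add: is_Lambda_def)

lemma AE_Lambda_pos:
  assumes "is_Lambda \<alpha> \<Lambda>"
  shows "AE z in \<Lambda>. 0 < z"
proof (rule AE_I[where N = "{..0}"])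
  show "{..0} \<in> sets \<Lambda>" using assms by (simp add: is_Lambda_def)
qed (use assms in \<open>auto simp: is_Lambda_def\<close>)

lemma has_bochner_integral_Lambda:
  assumes "is_Lambda \<alpha> \<Lambda>" "0 \<le> l"
  shows "has_bochner_integral \<Lambda> (\<lambda>z. 1 - exp (- l * z)) (ln (1 + l powr \<alpha>))"
proof (rule has_bochner_integral_nn_integral)
  note [measurable_cong] = sets_Lambda[OF assms(1)]
  show "(\<lambda>z. 1 - exp (- l * z)) \<in> borel_measurable \<Lambda>" by measurable
  show "AE z in \<Lambda>. 0 \<le> 1 - exp (- l * z)"
    using AE_Lambda_pos[OF assms(1)] assms(2) by (auto elim!: eventually_mono)
qed (use assms in \<open>auto simp: is_Lambda_def\<close>)

text \<open>Differentiation under an integral goes through dominated convergence, hence through a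
  sequence of steps; 1 / (n + 1) is the one used throughout.\<close>

lemma DERIV_sequentially:
  fixes f :: "real \<Rightarrow> real"
  assumes "(f has_real_derivative D) (at x)"
  shows "(\<lambda>n. (f (x + inverse (real (Suc n))) - f x) * real (Suc n)) \<longlonglongrightarrow> D"
proof -
  have "((\<lambda>h. (f (x + h) - f x) / h) \<longlongrightarrow> D) (at 0)"
    using assms by (simp add: DERIV_def)
  moreover have "filterlim (\<lambda>n. inverse (real (Suc n))) (at 0) sequentially"
    by (intro filterlim_atI LIMSEQ_inverse_real_of_nat) auto
  ultimately have "(\<lambda>n. (f (x + inverse (real (Suc n))) - f x) / inverse (real (Suc n))) \<longlonglongrightarrow> D"
    by (rule filterlim_compose)
  then show ?thesis by (simp add: divide_inverse)
qed

lemma mult_exp_minus_le: "t * exp (- t) \<le> 1 - exp (- t)" for t :: real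
proof -
  have "(1 + t) * exp (- t) \<le> exp t * exp (- t)"
    by (intro mult_right_mono) (auto simp: exp_ge_add_one_self)
  then show ?thesis by (simp add: algebra_simps flip: exp_add)
qed

text \<open>The identity defining \<Lambda> is differentiated in l. Its own integrand, divided by l,
  dominates the difference quotients, so the integrability needed is already contained in that
  identity.\<close>

lemma has_bochner_integral_Lambda_deriv:
  assumes "is_Lambda \<alpha> \<Lambda>" "0 < l"
  shows "has_bochner_integral \<Lambda> (\<lambda>z. z * exp (- l * z)) (\<alpha> * l powr (\<alpha> - 1) / (1 + l powr \<alpha>))"
proof -
  note [measurable_cong] = sets_Lambda[OF assms(1)]
  let ?h = "\<lambda>n. inverse (real (Suc n))"
  define X where "X n z = ((1 - exp (- (l + ?h n) * z)) - (1 - exp (- l * z))) * real (Suc n)" for n z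
  have int: "has_bochner_integral \<Lambda> (X n) ((ln (1 + (l + ?h n) powr \<alpha>) - ln (1 + l powr \<alpha>)) * real (Suc n))" for n
    unfolding X_def using assms
    by (intro has_bochner_integral_mult_left has_bochner_integral_diff has_bochner_integral_Lambda) auto
  have lim: "(\<lambda>n. X n z) \<longlonglongrightarrow> z * exp (- l * z)" for z
    unfolding X_def by (rule DERIV_sequentially[where f = "\<lambda>l. 1 - exp (- l * z)"])
      (auto intro!: derivative_eq_intros simp: algebra_simps)
  \<comment> \<open>The quotient with step h is exp (- l z) (1 - exp (- h z)) / h, at most z exp (-
    l z) for every h; \<open>mult_exp_minus_le\<close> then brings in the integrable
    majorant.\<close>
  have bound: "\<bar>X n z\<bar> \<le> (1 - exp (- l * z)) / l" if "0 < z" for n z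
  proof -
    have "X n z = exp (- l * z) * (1 - exp (- ?h n * z)) * real (Suc n)"
      by (simp add: X_def algebra_simps flip: exp_add)
    moreover have "0 \<le> 1 - exp (- ?h n * z)" "1 - exp (- ?h n * z) \<le> ?h n * z"
      using that exp_minus_ge[of "?h n * z"] by auto
    ultimately have "0 \<le> X n z" "X n z \<le> exp (- l * z) * (?h n * z) * real (Suc n)"
      by (auto intro!: mult_right_mono mult_left_mono mult_nonneg_nonneg)
    moreover have "exp (- l * z) * (?h n * z) * real (Suc n) = exp (- l * z) * z"
      by (simp add: field_simps)
    moreover have "exp (- l * z) * z \<le> (1 - exp (- l * z)) / l"
      using mult_exp_minus_le[of "l * z"] assms(2) by (simp add: field_simps)
    ultimately have "X n z \<le> (1 - exp (- l * z)) / l" by linarith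
    with \<open>0 \<le> X n z\<close> show ?thesis by (simp only: abs_of_nonneg)
  qed
  have dom: "integrable \<Lambda> (\<lambda>z. (1 - exp (- l * z)) / l)"
    using has_bochner_integral_Lambda[OF assms(1), of l] assms(2) by (auto simp: has_bochner_integral_iff)
  have AEb: "AE z in \<Lambda>. norm (X n z) \<le> (1 - exp (- l * z)) / l" for n
    using AE_Lambda_pos[OF assms(1)] by eventually_elim (simp only: real_norm_def bound)
  have meas: "(\<lambda>z. z * exp (- l * z)) \<in> borel_measurable \<Lambda>" "\<And>n. X n \<in> borel_measurable \<Lambda>"
    unfolding X_def by measurable
  have I: "integrable \<Lambda> (\<lambda>z. z * exp (- l * z))"
    by (rule integrable_dominated_convergence[where s = X, OF meas dom _ AEb]) (intro AE_I2 lim)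
  have "(\<lambda>n. integral\<^sup>L \<Lambda> (X n)) \<longlonglongrightarrow> (\<integral>z. z * exp (- l * z) \<partial>\<Lambda>)"
    by (rule integral_dominated_convergence[where s = X, OF meas dom _ AEb]) (intro AE_I2 lim)
  moreover have "(\<lambda>n. integral\<^sup>L \<Lambda> (X n)) \<longlonglongrightarrow> \<alpha> * l powr (\<alpha> - 1) / (1 + l powr \<alpha>)"
    unfolding has_bochner_integral_integral_eq[OF int]
    by (rule DERIV_sequentially[where f = "\<lambda>l. ln (1 + l powr \<alpha>)"])
       (use assms in \<open>auto intro!: derivative_eq_intros simp: add_pos_nonneg\<close>)
  ultimately have "(\<integral>z. z * exp (- l * z) \<partial>\<Lambda>) = \<alpha> * l powr (\<alpha> - 1) / (1 + l powr \<alpha>)"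
    by (rule LIMSEQ_unique)
  with I show ?thesis by (simp add: has_bochner_integral_iff)
qed

section \<open>Quadratic forms and entrywise products\<close>

definition qform :: "nat \<Rightarrow> (nat \<Rightarrow> real) \<Rightarrow> (nat \<Rightarrow> nat \<Rightarrow> real) \<Rightarrow> real" where
  "qform n d A = (\<Sum>i<n. \<Sum>j<n. d i * d j * A i j)"

text \<open>No symmetry is asked of \<open>A\<close>: only the values of the form matter, and
  transposition does not change them. The energy matrix met later is not symmetric.\<close>

definition psd :: "nat \<Rightarrow> (nat \<Rightarrow> nat \<Rightarrow> real) \<Rightarrow> bool" where
  "psd n A \<longleftrightarrow> (\<forall>d. 0 \<le> qform n d A)"

lemma qform_cong: "(\<And>i j. i < n \<Longrightarrow> j < n \<Longrightarrow> A i j = B i j) \<Longrightarrow> qform n d A = qform n d B"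
  unfolding qform_def by (intro sum.cong) auto

lemma qform_add: "qform n d (\<lambda>i j. A i j + B i j) = qform n d A + qform n d B"
  by (simp add: qform_def distrib_left sum.distrib)

lemma qform_cmult: "qform n d (\<lambda>i j. c * A i j) = c * qform n d A"
  by (simp add: qform_def sum_distrib_left mult_ac)

lemma qform_diff: "qform n d (\<lambda>i j. A i j - B i j) = qform n d A - qform n d B"
  by (simp add: qform_def right_diff_distrib sum_subtractf)

lemma qform_sum: "qform n d (\<lambda>i j. \<Sum>p\<in>P. A p i j) = (\<Sum>p\<in>P. qform n d (A p))"
  by (induction P rule: infinite_finite_induct) (simp_all add: qform_add, simp_all add: qform_def)

lemma qform_scale: "qform n d (\<lambda>i j. x i * x j * A i j) = qform n (\<lambda>i. d i * x i) A"
  by (simp add: qform_def mult_ac)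

lemma qform_square: "qform n d (\<lambda>i j. x i * x j) = (\<Sum>i<n. d i * x i)\<^sup>2"
  by (simp add: qform_def power2_eq_square sum_product mult_ac)

lemma qform_sym: "qform n d (\<lambda>i j. A j i) = qform n d A"
  unfolding qform_def by (subst sum.swap) (simp add: mult_ac)

lemma has_bochner_integral_qform:
  assumes "\<And>i j. i < n \<Longrightarrow> j < n \<Longrightarrow> has_bochner_integral M (\<lambda>z. A z i j) (K i j)"
  shows "has_bochner_integral M (\<lambda>z. qform n d (A z)) (qform n d K)"
  unfolding qform_def
  by (intro has_bochner_integral_sum has_bochner_integral_mult_right assms) auto

text \<open>The form is linear in its matrix, so the sign passes through the integral. Kernels given
  as integrals of rank one matrices get their positivity here.\<close>

lemma psd_integral:
  assumes K: "\<And>i j. i < n \<Longrightarrow> j < n \<Longrightarrow> has_bochner_integral M (\<lambda>z. A z i j) (K i j)"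
    and psd: "AE z in M. psd n (A z)"
  shows "psd n K"
  unfolding psd_def
proof
  fix d
  have "has_bochner_integral M (\<lambda>z. qform n d (A z)) (qform n d K)"
    using K by (rule has_bochner_integral_qform)
  moreover have "AE z in M. 0 \<le> qform n d (A z)"
    using psd by eventually_elim (auto simp: psd_def)
  ultimately show "0 \<le> qform n d K"
    by (metis has_bochner_integral_integral_eq integral_nonneg_AE)
qed

text \<open>The conclusion of the Schur product theorem taken as a definition. The property is
  inherited under scaling and integration, can be iterated to entrywise powers, and holds for Gram
  matrices without factorising any positive matrix.\<close>

definition schur_multiplier :: "nat \<Rightarrow> (nat \<Rightarrow> nat \<Rightarrow> real) \<Rightarrow> bool" where
  "schur_multiplier n K \<longleftrightarrow> (\<forall>A. psd n A \<longrightarrow> psd n (\<lambda>i j. A i j * K i j))"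

text \<open>For fixed z, multiplying the entries by \<open>g i z * g j z\<close> only rescales the
  coefficient \<open>d i\<close> by \<open>g i z\<close>, so the form stays nonnegative; integration
  over z preserves this.\<close>

lemma schur_multiplier_gram:
  assumes K: "\<And>i j. i < n \<Longrightarrow> j < n \<Longrightarrow> has_bochner_integral M (\<lambda>z. g i z * g j z) (K i j)"
  shows "schur_multiplier n K"
  unfolding schur_multiplier_def
proof (intro allI impI)
  fix A assume A: "psd n A"
  show "psd n (\<lambda>i j. A i j * K i j)"
  proof (rule psd_integral[where M = M and A = "\<lambda>z i j. A i j * (g i z * g j z)"])
    show "AE z in M. psd n (\<lambda>i j. A i j * (g i z * g j z))"
    proof (intro AE_I2)
      fix z
      have "qform n d (\<lambda>i j. A i j * (g i z * g j z)) = qform n (\<lambda>i. d i * g i z) A" for d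
        by (simp add: mult_ac flip: qform_scale)
      with A show "psd n (\<lambda>i j. A i j * (g i z * g j z))" by (simp add: psd_def)
    qed
  qed (intro has_bochner_integral_mult_right K)
qed

text \<open>The covariance kernel to come is an integral over E of Gram matrices with respect to
  \<Lambda>, each at its own scale. This lemma performs the outer integration.\<close>

lemma schur_multiplier_integral:
  assumes K: "\<And>i j. i < n \<Longrightarrow> j < n \<Longrightarrow> has_bochner_integral M (\<lambda>r. k r i j) (K i j)"
    and "\<And>r. schur_multiplier n (k r)"
  shows "schur_multiplier n K"
  unfolding schur_multiplier_def
proof (intro allI impI)
  fix A assume A: "psd n A"
  show "psd n (\<lambda>i j. A i j * K i j)"
    by (rule psd_integral[where M = M and A = "\<lambda>r i j. A i j * k r i j"])
       (use assms A in \<open>auto simp: schur_multiplier_def intro!: has_bochner_integral_mult_right\<close>)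
qed

lemma schur_multiplier_cmult: "schur_multiplier n K \<Longrightarrow> 0 \<le> c \<Longrightarrow> schur_multiplier n (\<lambda>i j. c * K i j)"
  using qform_cmult[of n _ c] by (simp add: schur_multiplier_def psd_def mult.left_commute)

lemma psd_one: "psd n (\<lambda>i j. 1)"
  using qform_square[of n _ "\<lambda>_. 1"] by (simp add: psd_def)

text \<open>Each entrywise power of \<open>K\<close> is reached by iterating the multiplier on
  \<open>A\<close>; nonnegative coefficients keep the partial sums positive, and the finite form is
  continuous in its entries.\<close>

lemma psd_schur_power_series:
  assumes K: "schur_multiplier n K" and A: "psd n A"
    and c: "\<And>p. 0 \<le> c p"
    and S: "\<And>i j. i < n \<Longrightarrow> j < n \<Longrightarrow> (\<lambda>p. c p * K i j ^ p) sums S i j"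
  shows "psd n (\<lambda>i j. A i j * S i j)"
  unfolding psd_def
proof
  fix d
  have pow: "psd n (\<lambda>i j. A i j * K i j ^ p)" for p
  proof (induction p)
    case (Suc p)
    then have "psd n (\<lambda>i j. A i j * K i j ^ p * K i j)"
      using K by (simp add: schur_multiplier_def)
    then show ?case by (simp add: mult_ac)
  qed (use A in simp)
  have "(\<lambda>N. qform n d (\<lambda>i j. A i j * (\<Sum>p<N. c p * K i j ^ p))) \<longlonglongrightarrow> qform n d (\<lambda>i j. A i j * S i j)"
    unfolding qform_def using S
    by (intro tendsto_sum tendsto_mult tendsto_const) (auto simp: sums_def)
  moreover have "0 \<le> qform n d (\<lambda>i j. A i j * (\<Sum>p<N. c p * K i j ^ p))" for N
  proof -
    have "qform n d (\<lambda>i j. A i j * (\<Sum>p<N. c p * K i j ^ p)) = (\<Sum>p<N. c p * qform n d (\<lambda>i j. A i j * K i j ^ p))"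
      by (simp add: sum_distrib_left mult.left_commute qform_sum qform_cmult)
    also have "0 \<le> \<dots>" using pow c by (intro sum_nonneg mult_nonneg_nonneg) (auto simp: psd_def)
    finally show ?thesis .
  qed
  ultimately show "0 \<le> qform n d (\<lambda>i j. A i j * S i j)"
    by (intro LIMSEQ_le_const) auto
qed

lemma psd_mult_exp:
  assumes "schur_multiplier n K" "psd n A"
  shows "psd n (\<lambda>i j. A i j * exp (K i j))"
proof (rule psd_schur_power_series[OF assms, where c = "\<lambda>p. inverse (fact p)"])
  show "(\<lambda>p. inverse (fact p) * K i j ^ p) sums exp (K i j)" for i j
    using exp_converges[of "K i j"] by (simp add: scaleR_conv_of_real)
qed simp

lemma psd_exp_poincare:
  assumes "schur_multiplier n K"
  shows "psd n (\<lambda>i j. exp (K i j) * K i j - exp (K i j) + 1)"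
proof -
  \<comment> \<open>The coefficient of x^p in x exp x - exp x + 1 is 1/(p-1)! - 1/p! = (p-1)/p! for
    p \<ge> 1. At p = 0 the same expression gives -1, which the constant 1 cancels; hence the
    separate value 0.\<close>
  define c where "c p = (if p = 0 then 0 else (real p - 1) / fact p)" for p :: nat
  have "psd n (\<lambda>i j. 1 * (exp (K i j) * K i j - exp (K i j) + 1))"
  proof (rule psd_schur_power_series[OF assms psd_one, where c = c])
    show "0 \<le> c p" for p by (auto simp: c_def)
    show "(\<lambda>p. c p * K i j ^ p) sums (exp (K i j) * K i j - exp (K i j) + 1)" for i j
    proof -
      let ?x = "K i j"
      have e: "(\<lambda>p. ?x ^ p / fact p) sums exp ?x"
        using exp_converges[of ?x] by (simp add: scaleR_conv_of_real field_simps)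
      have "(\<lambda>p. real (Suc p) * ?x ^ Suc p / fact (Suc p)) sums (exp ?x * ?x)"
      proof -
        have "(\<lambda>p. (?x ^ p / fact p) * ?x) sums (exp ?x * ?x)" using e by (rule sums_mult2)
        moreover have "(?x ^ p / fact p) * ?x = real (Suc p) * ?x ^ Suc p / fact (Suc p)" for p
          by (simp add: field_simps del: of_nat_Suc)
        ultimately show ?thesis by (simp only:)
      qed
      then have "(\<lambda>p. real p * ?x ^ p / fact p) sums (exp ?x * ?x)"
        by (subst (asm) sums_Suc_iff) simp
      then have "(\<lambda>p. real p * ?x ^ p / fact p - ?x ^ p / fact p + (if p = 0 then 1 else 0)) sums (exp ?x * ?x - exp ?x + 1)"
        using e sums_If_finite[of "\<lambda>p. p = 0" "\<lambda>_. 1 :: real"] by (intro sums_add sums_diff) auto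
      moreover have "real p * ?x ^ p / fact p - ?x ^ p / fact p + (if p = 0 then 1 else 0) = c p * ?x ^ p" for p
        by (auto simp: c_def field_simps)
      ultimately show ?thesis by simp
    qed
  qed
  then show ?thesis by simp
qed

text \<open>Polarisation: a Gram entry of the functions 1 - exp (- l z) is the defect of additivity
  in l of their integral. All Gram matrices below thereby become explicit in the exponents.\<close>

lemma gram_exp:
  "(1 - exp (- l * z)) + (1 - exp (- k * z)) - (1 - exp (- (l + k) * z)) = (1 - exp (- l * z)) * (1 - exp (- k * z))"
  for l k z :: real
proof -
  have "- (l + k) * z = - l * z + - k * z" by (simp add: algebra_simps)
  then show ?thesis by (simp only: exp_add) (simp add: algebra_simps)
qed

lemma has_bochner_integral_Lambda_gram:
  assumes "is_Lambda \<alpha> \<Lambda>" "0 \<le> l" "0 \<le> k"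
  shows "has_bochner_integral \<Lambda> (\<lambda>z. (1 - exp (- l * z)) * (1 - exp (- k * z)))
     (ln (1 + l powr \<alpha>) + ln (1 + k powr \<alpha>) - ln (1 + (l + k) powr \<alpha>))"
proof -
  have "has_bochner_integral \<Lambda> (\<lambda>z. (1 - exp (- l * z)) + (1 - exp (- k * z)) - (1 - exp (- (l + k) * z)))
     (ln (1 + l powr \<alpha>) + ln (1 + k powr \<alpha>) - ln (1 + (l + k) powr \<alpha>))"
    using assms by (intro has_bochner_integral_add has_bochner_integral_diff has_bochner_integral_Lambda) auto
  moreover have "(1 - exp (- l * z)) + (1 - exp (- k * z)) - (1 - exp (- (l + k) * z)) = (1 - exp (- l * z)) * (1 - exp (- k * z))" for z
    by (rule gram_exp)
  ultimately show ?thesis by (simp only:)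
qed

lemma has_bochner_integral_n_I_gram:
  assumes "0 < \<alpha>" "\<alpha> < 1" "0 \<le> l" "0 \<le> k"
  shows "has_bochner_integral (n_I \<alpha>) (\<lambda>z. (1 - exp (- l * z)) * (1 - exp (- k * z)))
     (l powr \<alpha> + k powr \<alpha> - (l + k) powr \<alpha>)"
proof -
  have "has_bochner_integral (n_I \<alpha>) (\<lambda>z. (1 - exp (- l * z)) + (1 - exp (- k * z)) - (1 - exp (- (l + k) * z)))
     (l powr \<alpha> + k powr \<alpha> - (l + k) powr \<alpha>)"
    using assms by (intro has_bochner_integral_add has_bochner_integral_diff has_bochner_integral_n_I) auto
  moreover have "(1 - exp (- l * z)) + (1 - exp (- k * z)) - (1 - exp (- (l + k) * z)) = (1 - exp (- l * z)) * (1 - exp (- k * z))" for z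
    by (rule gram_exp)
  ultimately show ?thesis by (simp only:)
qed

text \<open>For l > 0 the function 1 - exp (- l z) is not integrable against \<open>n_B\<close>, but
  its compensated version is. The compensators cancel in the polarisation because (l + k) z = l z +
  k z.\<close>

lemma has_bochner_integral_n_B_gram:
  assumes "0 < \<alpha>" "\<alpha> < 1" "0 \<le> l" "0 \<le> k"
  shows "has_bochner_integral (n_B \<alpha>) (\<lambda>z. (1 - exp (- l * z)) * (1 - exp (- k * z)))
     (((l + k) powr (\<alpha> + 1) - l powr (\<alpha> + 1) - k powr (\<alpha> + 1)) / \<alpha>)"
proof -
  have "has_bochner_integral (n_B \<alpha>) (\<lambda>z. (exp (- (l + k) * z) - 1 + (l + k) * z) - (exp (- l * z) - 1 + l * z) - (exp (- k * z) - 1 + k * z))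
     ((l + k) powr (\<alpha> + 1) / \<alpha> - l powr (\<alpha> + 1) / \<alpha> - k powr (\<alpha> + 1) / \<alpha>)"
    using assms by (intro has_bochner_integral_add has_bochner_integral_diff has_bochner_integral_n_B) auto
  moreover have "(exp (- (l + k) * z) - 1 + (l + k) * z) - (exp (- l * z) - 1 + l * z) - (exp (- k * z) - 1 + k * z)
      = (1 - exp (- l * z)) * (1 - exp (- k * z))" for z
    unfolding gram_exp[symmetric] by (simp add: distrib_right)
  ultimately show ?thesis by (simp only: diff_divide_distrib)
qed

lemma nn_integral_has_bochner_integral:
  assumes "has_bochner_integral M f x" "AE z in M. 0 \<le> f z"
  shows "(\<integral>\<^sup>+z. ennreal (f z) \<partial>M) = ennreal x"
  using assms nn_integral_eq_integral[of M f] by (simp add: has_bochner_integral_iff)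

text \<open>On a combination of exponentials with coefficients \<open>c\<close>, the hypothesis
  compares two quadratic forms in \<open>c\<close>. Squared increments are forms in
  \<open>G\<close>; integrating the increment y turns \<open>G\<close> into \<open>KB\<close>, and
  integrating the starting point z turns the remaining weight z exp (- (l i + l j) z) into
  \<open>D\<close>.\<close>

lemma one_dim_qform:
  assumes L: "is_Lambda \<alpha> \<Lambda>" and \<alpha>: "0 < \<alpha>" "\<alpha> < 1" and \<gamma>: "0 < \<gamma>"
    and one_dim: "\<And>F. F \<in> D_exp_real \<Longrightarrow>
      (\<integral>\<^sup>+z. ennreal ((F z - F 0)\<^sup>2) \<partial>\<Lambda>)
        \<le> ennreal (\<gamma> / 2) *
          ((\<integral>\<^sup>+z. ennreal z * (\<integral>\<^sup>+y. ennreal ((F (z + y) - F z)\<^sup>2) \<partial>n_B \<alpha>) \<partial>\<Lambda>)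
           + (\<integral>\<^sup>+y. ennreal ((F y - F 0)\<^sup>2) \<partial>n_I \<alpha>))"
    and l: "\<And>i. i < n \<Longrightarrow> 0 < l i"
  shows "qform n c (\<lambda>i j. ln (1 + l i powr \<alpha>) + ln (1 + l j powr \<alpha>) - ln (1 + (l i + l j) powr \<alpha>))
    \<le> \<gamma> / 2 * qform n c (\<lambda>i j. l i powr \<alpha> + l j powr \<alpha> - (l i + l j) powr \<alpha>
        + (l i + l j) powr (\<alpha> - 1) * ((l i + l j) powr (\<alpha> + 1) - l i powr (\<alpha> + 1) - l j powr (\<alpha> + 1))
          / (1 + (l i + l j) powr \<alpha>))"
proof -
  define F where "F = (\<lambda>z. \<Sum>i<n. c i * exp (- l i * z))"
  have F: "F \<in> D_exp_real" unfolding D_exp_real_def F_def using l by blast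
  define G where "G z = (\<lambda>i j. (1 - exp (- l i * z)) * (1 - exp (- l j * z)))" for z
  define KL where "KL = (\<lambda>i j. ln (1 + l i powr \<alpha>) + ln (1 + l j powr \<alpha>) - ln (1 + (l i + l j) powr \<alpha>))"
  define KI where "KI = (\<lambda>i j. l i powr \<alpha> + l j powr \<alpha> - (l i + l j) powr \<alpha>)"
  define KB where "KB = (\<lambda>i j. ((l i + l j) powr (\<alpha> + 1) - l i powr (\<alpha> + 1) - l j powr (\<alpha> + 1)) / \<alpha>)"
  define D where "D = (\<lambda>i j. \<alpha> * (l i + l j) powr (\<alpha> - 1) / (1 + (l i + l j) powr \<alpha>))"
  have sq: "(F (z + y) - F z)\<^sup>2 = qform n (\<lambda>i. c i * exp (- l i * z)) (G y)" for z y
  proof -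
    have "F (z + y) - F z = - (\<Sum>i<n. c i * exp (- l i * z) * (1 - exp (- l i * y)))"
    proof -
      have "exp (- l i * (z + y)) = exp (- l i * z) * exp (- l i * y)" for i
        by (simp only: distrib_left exp_add)
      then show ?thesis
        by (simp only: F_def sum_subtractf[symmetric] sum_negf[symmetric]) (simp add: right_diff_distrib mult.assoc)
    qed
    then show ?thesis by (simp add: G_def qform_square)
  qed
  have sq0: "(F y - F 0)\<^sup>2 = qform n c (G y)" for y using sq[of 0 y] by simp
  have G_pos: "0 \<le> qform n d (G y)" for d y by (simp add: G_def qform_square)
  have IL: "(\<integral>\<^sup>+z. ennreal (qform n c (G z)) \<partial>\<Lambda>) = ennreal (qform n c KL)"
    by (intro nn_integral_has_bochner_integral has_bochner_integral_qform AE_I2 G_pos)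
       (auto simp: G_def KL_def intro!: has_bochner_integral_Lambda_gram[OF L, simplified] less_imp_le l)
  have II: "(\<integral>\<^sup>+z. ennreal (qform n c (G z)) \<partial>n_I \<alpha>) = ennreal (qform n c KI)"
    by (intro nn_integral_has_bochner_integral has_bochner_integral_qform AE_I2 G_pos)
       (auto simp: G_def KI_def intro!: has_bochner_integral_n_I_gram[OF \<alpha>, simplified] less_imp_le l)
  have B: "(\<integral>\<^sup>+z. ennreal (qform n d (G z)) \<partial>n_B \<alpha>) = ennreal (qform n d KB)" for d
    by (intro nn_integral_has_bochner_integral has_bochner_integral_qform AE_I2 G_pos)
       (auto simp: G_def KB_def intro!: has_bochner_integral_n_B_gram[OF \<alpha>, simplified] less_imp_le l)
  have KB_pos: "0 \<le> qform n d KB" for d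
    by (rule psd_integral[of n "n_B \<alpha>" G, unfolded psd_def, rule_format])
       (auto simp: G_def KB_def G_pos[unfolded G_def, simplified] intro!: has_bochner_integral_n_B_gram[OF \<alpha>, simplified] less_imp_le l)
  have KI_pos: "0 \<le> qform n d KI" for d
    by (rule psd_integral[of n "n_I \<alpha>" G, unfolded psd_def, rule_format])
       (auto simp: G_def KI_def G_pos[unfolded G_def, simplified] intro!: has_bochner_integral_n_I_gram[OF \<alpha>, simplified] less_imp_le l)
  \<comment> \<open>The exponential factors into an i-part and a j-part, so for each z this is
    \<open>KB\<close> at rescaled coefficients. That gives the sign of the form without
    \<open>D\<close> being examined on its own.\<close>
  have split: "qform n d (\<lambda>i j. z * exp (- (l i + l j) * z) * KB i j) = z * qform n (\<lambda>i. d i * exp (- l i * z)) KB" for z d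
  proof -
    have "- (l i + l j) * z = - l i * z + - l j * z" for i j by (simp add: algebra_simps)
    then show ?thesis
      unfolding qform_scale[symmetric] qform_cmult[symmetric] by (simp only: exp_add mult.assoc)
  qed
  have "(\<integral>\<^sup>+z. ennreal z * ennreal (qform n (\<lambda>i. c i * exp (- l i * z)) KB) \<partial>\<Lambda>)
      = (\<integral>\<^sup>+z. ennreal (qform n c (\<lambda>i j. z * exp (- (l i + l j) * z) * KB i j)) \<partial>\<Lambda>)"
  proof (intro nn_integral_cong_AE, use AE_Lambda_pos[OF L] in eventually_elim)
    case (elim z)
    then show ?case using KB_pos unfolding split by (simp add: ennreal_mult')
  qed
  also have "\<dots> = ennreal (qform n c (\<lambda>i j. D i j * KB i j))"
  proof (rule nn_integral_has_bochner_integral)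
    show "has_bochner_integral \<Lambda> (\<lambda>z. qform n c (\<lambda>i j. z * exp (- (l i + l j) * z) * KB i j)) (qform n c (\<lambda>i j. D i j * KB i j))"
      unfolding D_def using l
      by (intro has_bochner_integral_qform has_bochner_integral_mult_left has_bochner_integral_Lambda_deriv L)
         (auto intro!: add_pos_pos)
    show "AE z in \<Lambda>. 0 \<le> qform n c (\<lambda>i j. z * exp (- (l i + l j) * z) * KB i j)"
      using AE_Lambda_pos[OF L]
    proof eventually_elim
      case (elim z)
      then show ?case using KB_pos unfolding split by simp
    qed
  qed
  finally have BL: "(\<integral>\<^sup>+z. ennreal z * ennreal (qform n (\<lambda>i. c i * exp (- l i * z)) KB) \<partial>\<Lambda>)
     = ennreal (qform n c (\<lambda>i j. D i j * KB i j))" .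
  have DKB_pos: "0 \<le> qform n c (\<lambda>i j. D i j * KB i j)"
  proof -
    have "psd n (\<lambda>i j. D i j * KB i j)"
    proof (rule psd_integral[where M = \<Lambda> and A = "\<lambda>z i j. z * exp (- (l i + l j) * z) * KB i j"])
      show "AE z in \<Lambda>. psd n (\<lambda>i j. z * exp (- (l i + l j) * z) * KB i j)"
        using AE_Lambda_pos[OF L]
      proof (eventually_elim, unfold psd_def, intro allI)
        fix z d assume z: "0 < (z::real)"
        then show "0 \<le> qform n d (\<lambda>i j. z * exp (- (l i + l j) * z) * KB i j)"
          using KB_pos unfolding split by simp
      qed
      show "has_bochner_integral \<Lambda> (\<lambda>z. z * exp (- (l i + l j) * z) * KB i j) (D i j * KB i j)" if "i < n" "j < n" for i j
        unfolding D_def using l that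
        by (intro has_bochner_integral_mult_left has_bochner_integral_Lambda_deriv L) (auto intro!: add_pos_pos)
    qed
    then show ?thesis by (simp add: psd_def)
  qed
  \<comment> \<open>The hypothesis lives in the extended nonnegative reals, where
    \<open>ennreal\<close> sends negative numbers to 0. The signs established above are what allow
    the comparison to descend to the reals.\<close>
  from one_dim[OF F] have "ennreal (qform n c KL) \<le> ennreal (\<gamma> / 2) * (ennreal (qform n c (\<lambda>i j. D i j * KB i j)) + ennreal (qform n c KI))"
    by (simp only: sq sq0 IL II B BL)
  also have "\<dots> = ennreal (\<gamma> / 2 * (qform n c (\<lambda>i j. D i j * KB i j) + qform n c KI))"
    using \<gamma> DKB_pos KI_pos by (subst ennreal_mult) (auto intro: add_nonneg_nonneg)
  finally have "qform n c KL \<le> \<gamma> / 2 * (qform n c (\<lambda>i j. D i j * KB i j) + qform n c KI)"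
    using \<gamma> DKB_pos KI_pos by (subst (asm) ennreal_le_iff) auto
  also have "qform n c (\<lambda>i j. D i j * KB i j) + qform n c KI = qform n c (\<lambda>i j. KI i j +
       (l i + l j) powr (\<alpha> - 1) * ((l i + l j) powr (\<alpha> + 1) - l i powr (\<alpha> + 1) - l j powr (\<alpha> + 1))
          / (1 + (l i + l j) powr \<alpha>))"
    unfolding qform_add[symmetric] using \<alpha> by (intro qform_cong) (simp add: D_def KB_def)
  finally show ?thesis unfolding KL_def KI_def .
qed

section \<open>Finite measures and the weak topology\<close>

lemma fin_measuresD:
  assumes "\<eta> \<in> fin_measures"
  shows "sets \<eta> = sets borel" "finite_measure \<eta>" "space \<eta> = UNIV"
  using assms sets_eq_imp_space_eq[of \<eta> borel] by (auto simp: fin_measures_def)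

lemma compact_UNIV_bounded:
  fixes f :: "'a::topological_space \<Rightarrow> real"
  assumes "compact (UNIV :: 'a set)" "continuous_on UNIV f"
  obtains B where "0 < B" "\<And>r. \<bar>f r\<bar> \<le> B"
proof -
  have "bounded (range f)" using assms by (intro compact_imp_bounded compact_continuous_image)
  then obtain B where "0 < B" "\<forall>x\<in>range f. norm x \<le> B" by (auto simp: bounded_pos)
  then show ?thesis using that by auto
qed

lemma integrable_fin_measures:
  fixes f :: "'a::topological_space \<Rightarrow> real"
  assumes "\<eta> \<in> fin_measures" "f \<in> borel_measurable borel" "\<And>r. \<bar>f r\<bar> \<le> B"
  shows "integrable \<eta> f"
proof -
  interpret finite_measure \<eta> using assms(1) by (rule fin_measuresD)
  show ?thesis
    using assms fin_measuresD(1)[OF assms(1)]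
    by (intro integrable_const_bound[where B = B]) (auto cong: measurable_cong_sets)
qed

lemma integrable_continuous_fin_measures:
  fixes f :: "'a::topological_space \<Rightarrow> real"
  assumes "compact (UNIV :: 'a set)" "\<eta> \<in> fin_measures" "continuous_on UNIV f"
  shows "integrable \<eta> f"
proof -
  obtain B where "\<And>r. \<bar>f r\<bar> \<le> B" using compact_UNIV_bounded[OF assms(1,3)] by blast
  with assms show ?thesis
    by (intro integrable_fin_measures borel_measurable_continuous_onI) auto
qed

lemma pairing_nonneg: "(\<And>r. 0 \<le> f r) \<Longrightarrow> 0 \<le> pairing \<eta> f"
  by (simp add: pairing_def)

lemma pairing_mono:
  fixes f g :: "'a::topological_space \<Rightarrow> real"
  assumes "compact (UNIV :: 'a set)" "\<eta> \<in> fin_measures" "continuous_on UNIV f" "continuous_on UNIV g"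
    and "\<And>r. f r \<le> g r"
  shows "pairing \<eta> f \<le> pairing \<eta> g"
  unfolding pairing_def using assms by (intro integral_mono integrable_continuous_fin_measures) auto

lemma sets_add_atom [simp]: "sets (add_atom \<eta> z r) = sets borel"
  and space_add_atom [simp]: "space (add_atom \<eta> z r) = UNIV"
  using sets.sets_measure_of_eq[of borel] sets.sigma_sets_eq[of borel]
  by (auto simp: add_atom_def)

lemma emeasure_add_atom:
  assumes "\<eta> \<in> fin_measures" "A \<in> sets borel"
  shows "emeasure (add_atom \<eta> z r) A = emeasure \<eta> A + ennreal z * indicator A r"
proof (rule emeasure_measure_of[OF add_atom_def])
  show "countably_additive (sets (add_atom \<eta> z r)) (\<lambda>A. emeasure \<eta> A + ennreal z * indicator A r)"
  proof (rule countably_additiveI)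
    fix F :: "nat \<Rightarrow> 'a set"
    assume F: "range F \<subseteq> sets (add_atom \<eta> z r)" "disjoint_family F"
    have "(\<Sum>i. emeasure \<eta> (F i) + ennreal z * indicator (F i) r)
        = (\<Sum>i. emeasure \<eta> (F i)) + (\<Sum>i. ennreal z * indicator (F i) r)"
      by (rule suminf_add[symmetric]) auto
    also have "(\<Sum>i. emeasure \<eta> (F i)) = emeasure \<eta> (\<Union>i. F i)"
      using F fin_measuresD[OF assms(1)] by (intro suminf_emeasure) auto
    also have "(\<Sum>i. ennreal z * indicator (F i) r) = ennreal z * indicator (\<Union>i. F i) r"
      using F(2) by (simp add: suminf_indicator)
    finally show "(\<Sum>i. emeasure \<eta> (F i) + ennreal z * indicator (F i) r)
      = emeasure \<eta> (\<Union>i. F i) + ennreal z * indicator (\<Union>i. F i) r" .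
  qed
qed (use assms in \<open>auto simp: positive_def\<close>)

lemma add_atom_fin_measures:
  assumes "\<eta> \<in> fin_measures"
  shows "add_atom \<eta> z r \<in> fin_measures"
proof -
  interpret finite_measure \<eta> using assms by (rule fin_measuresD)
  have "emeasure (add_atom \<eta> z r) UNIV \<noteq> \<infinity>"
    using emeasure_add_atom[OF assms, of UNIV z r] emeasure_finite[of UNIV] by (simp add: ennreal_mult_eq_top_iff)
  then show ?thesis by (auto simp: fin_measures_def intro: finite_measureI)
qed

lemma nn_integral_add_atom:
  assumes "\<eta> \<in> fin_measures" "f \<in> borel_measurable borel"
  shows "(\<integral>\<^sup>+s. f s \<partial>add_atom \<eta> z r) = (\<integral>\<^sup>+s. f s \<partial>\<eta>) + ennreal z * f r"
  using assms(2)
proof (induction rule: borel_measurable_induct)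
  case (cong f g)
  then show ?case by (auto cong: nn_integral_cong simp: fun_eq_iff)
next
  case (set A)
  then show ?case using assms(1) fin_measuresD[OF assms(1)] by (simp add: emeasure_add_atom)
next
  case (mult u c)
  then have "u \<in> borel_measurable (add_atom \<eta> z r)" "u \<in> borel_measurable \<eta>"
    using fin_measuresD[OF assms(1)] by (auto cong: measurable_cong_sets)
  then show ?case using mult by (simp add: nn_integral_cmult distrib_left mult.left_commute)
next
  case (add u v)
  then have "u \<in> borel_measurable (add_atom \<eta> z r)" "u \<in> borel_measurable \<eta>"
    "v \<in> borel_measurable (add_atom \<eta> z r)" "v \<in> borel_measurable \<eta>"
    using fin_measuresD[OF assms(1)] by (auto cong: measurable_cong_sets)
  then show ?case using add by (simp add: nn_integral_add distrib_left add_ac)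
next
  case (seq U)
  then have m: "U i \<in> borel_measurable (add_atom \<eta> z r)" "U i \<in> borel_measurable \<eta>" for i
    using fin_measuresD[OF assms(1)] by (auto cong: measurable_cong_sets)
  have inc: "incseq (\<lambda>i. \<integral>\<^sup>+s. U i s \<partial>\<eta>)" "incseq (\<lambda>i. ennreal z * U i r)"
    using \<open>incseq U\<close> by (auto simp: incseq_def le_fun_def intro!: nn_integral_mono mult_left_mono)
  have "(\<integral>\<^sup>+s. (SUP i. U i) s \<partial>add_atom \<eta> z r) = (SUP i. \<integral>\<^sup>+s. U i s \<partial>add_atom \<eta> z r)"
    using seq m by (simp add: nn_integral_monotone_convergence_SUP SUP_apply image_comp)
  also have "\<dots> = (SUP i. (\<integral>\<^sup>+s. U i s \<partial>\<eta>) + ennreal z * U i r)"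
    using seq by simp
  also have "\<dots> = (SUP i. \<integral>\<^sup>+s. U i s \<partial>\<eta>) + (SUP i. ennreal z * U i r)"
    by (rule ennreal_SUP_add[OF inc])
  also have "\<dots> = (\<integral>\<^sup>+s. (SUP i. U i) s \<partial>\<eta>) + ennreal z * (SUP i. U i) r"
    using seq m by (simp add: nn_integral_monotone_convergence_SUP SUP_apply image_comp SUP_mult_left_ennreal)
  finally show ?case .
qed

text \<open>Since \<open>ennreal z\<close> is 0 for negative z, a negative atom changes nothing;
  this is the origin of \<open>max 0 z\<close>. A formula valid for every real z makes the later
  integrands continuous in z on the whole line.\<close>

lemma pairing_add_atom:
  fixes f :: "'a::topological_space \<Rightarrow> real"
  assumes "compact (UNIV :: 'a set)" "\<eta> \<in> fin_measures" "continuous_on UNIV f"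
  shows "pairing (add_atom \<eta> z r) f = pairing \<eta> f + max 0 z * f r"
proof -
  have [measurable]: "f \<in> borel_measurable borel" by (rule borel_measurable_continuous_onI) fact
  have I: "integrable \<eta> f" "integrable (add_atom \<eta> z r) f"
    using assms by (auto intro: integrable_continuous_fin_measures add_atom_fin_measures)
  have fin: "(\<integral>\<^sup>+s. ennreal (f s) \<partial>\<eta>) < \<top>" "(\<integral>\<^sup>+s. ennreal (- f s) \<partial>\<eta>) < \<top>"
    using I(1) by (auto simp: real_integrable_def top.not_eq_extremum)
  have "pairing (add_atom \<eta> z r) f = enn2real ((\<integral>\<^sup>+s. f s \<partial>\<eta>) + ennreal z * f r) - enn2real ((\<integral>\<^sup>+s. - f s \<partial>\<eta>) + ennreal z * (- f r))"
    unfolding pairing_def real_lebesgue_integral_def[OF I(2)] using assms by (simp add: nn_integral_add_atom)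
  also have "\<dots> = (enn2real (\<integral>\<^sup>+s. f s \<partial>\<eta>) + enn2real (ennreal z * f r)) - (enn2real (\<integral>\<^sup>+s. - f s \<partial>\<eta>) + enn2real (ennreal z * (- f r)))"
    using fin by (simp add: enn2real_plus ennreal_mult_less_top)
  also have "enn2real (ennreal z * f r) = max 0 z * max 0 (f r)" by (simp add: enn2real_mult max_def ennreal_neg)
  also have "enn2real (ennreal z * (- f r)) = max 0 z * max 0 (- f r)" by (simp add: enn2real_mult max_def ennreal_neg)
  finally show ?thesis
    unfolding pairing_def real_lebesgue_integral_def[OF I(1)]
    by (cases "0 \<le> z"; cases "0 \<le> f r") (auto simp: algebra_simps)
qed

section \<open>The weak topology, its Borel sets, and functions vanishing at infinity\<close>

lemma topspace_weak_topology [simp]: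
  "topspace (weak_topology :: 'a::topological_space measure topology) = fin_measures"
proof -
  have "fin_measures \<in> {{\<eta> \<in> fin_measures. pairing \<eta> f \<in> U} | f U.
        continuous_on (UNIV :: 'a set) f \<and> bounded (range f) \<and> open U}"
    by (rule CollectI, rule exI[of _ "\<lambda>_. 0"], rule exI[of _ UNIV]) auto
  then show ?thesis
    unfolding weak_topology_def topology_generated_by_topspace by blast
qed

lemma continuous_map_weakI:
  assumes "\<And>U. open U \<Longrightarrow> openin weak_topology {\<eta> \<in> fin_measures. \<Phi> \<eta> \<in> U}"
  shows "continuous_map weak_topology euclidean \<Phi>"
  using assms by (auto simp: continuous_map_def)

lemma continuous_map_weakD:
  assumes "continuous_map weak_topology euclidean \<Phi>" "open U"
  shows "openin weak_topology {\<eta> \<in> fin_measures. \<Phi> \<eta> \<in> U}"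
  using assms by (auto simp: continuous_map_def)

lemma continuous_map_pairing:
  fixes f :: "'a::topological_space \<Rightarrow> real"
  assumes "compact (UNIV :: 'a set)" "continuous_on UNIV f"
  shows "continuous_map weak_topology euclideanreal (\<lambda>\<eta>. pairing \<eta> f)"
proof (rule continuous_map_weakI)
  fix U :: "real set" assume "open U"
  moreover have "bounded (range f)" using assms by (intro compact_imp_bounded compact_continuous_image)
  ultimately show "openin weak_topology {\<eta> \<in> fin_measures. pairing \<eta> f \<in> U}"
    unfolding weak_topology_def using assms(2) by (intro topology_generated_by_Basis) blast
qed

lemma measurable_continuous_map_weak:
  fixes \<Phi> :: "'a::topological_space measure \<Rightarrow> 'b::topological_space"
  assumes "continuous_map weak_topology euclidean \<Phi>" "sets Q = sets borel_weak"
  shows "\<Phi> \<in> borel_measurable Q"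
proof (rule borel_measurableI)
  have sub: "{U. openin weak_topology U} \<subseteq> Pow (fin_measures :: 'a measure set)"
    using openin_subset by force
  then have sp: "space Q = fin_measures"
    using sets_eq_imp_space_eq[OF assms(2)] by (simp add: borel_weak_def)
  fix S :: "'b set" assume "open S"
  then have "openin weak_topology {\<eta> \<in> fin_measures. \<Phi> \<eta> \<in> S}"
    using assms(1) by (auto simp: continuous_map_def)
  then have "{\<eta> \<in> fin_measures. \<Phi> \<eta> \<in> S} \<in> sets Q"
    unfolding assms(2) borel_weak_def using sub by simp
  moreover have "\<Phi> -` S \<inter> space Q = {\<eta> \<in> fin_measures. \<Phi> \<eta> \<in> S}" by (auto simp: sp)
  ultimately show "\<Phi> -` S \<inter> space Q \<in> sets Q" by simp
qed

lemma space_borel_weak: "sets Q = sets borel_weak \<Longrightarrow> space Q = fin_measures"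
  using openin_subset[of weak_topology] sets_eq_imp_space_eq[of Q borel_weak]
  by (subst (asm) (2) borel_weak_def) (auto simp: space_measure_of_conv)

lemma C_inf_bounded:
  assumes "\<Phi> \<in> C_inf"
  obtains B where "0 < B" "\<And>\<eta>. \<eta> \<in> fin_measures \<Longrightarrow> \<bar>\<Phi> \<eta>\<bar> \<le> B"
proof -
  obtain K where K: "compactin weak_topology K" "\<And>\<eta>. \<eta> \<in> fin_measures - K \<Longrightarrow> \<bar>\<Phi> \<eta>\<bar> < 1"
    using assms unfolding C_inf_def by (smt (verit) mem_Collect_eq zero_less_one)
  have "compactin euclideanreal (\<Phi> ` K)"
    using assms K(1) by (intro image_compactin) (auto simp: C_inf_def)
  then have "bounded (\<Phi> ` K)" by (simp add: compact_imp_bounded)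
  then obtain B where B: "0 < B" "\<forall>x\<in>\<Phi> ` K. norm x \<le> B" by (auto simp: bounded_pos)
  have "\<bar>\<Phi> \<eta>\<bar> \<le> max B 1" if "\<eta> \<in> fin_measures" for \<eta>
    using that K(2)[of \<eta>] B(2) by (cases "\<eta> \<in> K") (auto simp: max_def)
  then show ?thesis using that[of "max B 1"] by auto
qed

lemma continuous_map_pairing_param:
  fixes H :: "'b::topological_space \<Rightarrow> 'a::topological_space \<Rightarrow> real"
  assumes E: "compact (UNIV :: 'a set)"
    and X: "continuous_map weak_topology (top_of_set S) X"
    and H: "continuous_on (S \<times> UNIV) (\<lambda>(x, r). H x r)"
  shows "continuous_map weak_topology euclideanreal (\<lambda>\<eta>. pairing \<eta> (H (X \<eta>)))"
proof (rule continuous_map_weakI)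
  fix U :: "real set" assume U: "open U"
  have XS: "X \<eta> \<in> S" if "\<eta> \<in> fin_measures" for \<eta>
    using X that by (auto simp: continuous_map_def)
  have Hc: "continuous_on UNIV (H x)" if "x \<in> S" for x
    by (rule continuous_on_compose2[OF H, of UNIV "\<lambda>r. (x, r)", simplified]) (use that in \<open>auto intro!: continuous_intros\<close>)
  show "openin weak_topology {\<eta> \<in> fin_measures. pairing \<eta> (H (X \<eta>)) \<in> U}"
  proof (subst openin_subopen, intro ballI)
    fix \<eta>0 assume "\<eta>0 \<in> {\<eta> \<in> fin_measures. pairing \<eta> (H (X \<eta>)) \<in> U}"
    then have \<eta>0: "\<eta>0 \<in> fin_measures" "pairing \<eta>0 (H (X \<eta>0)) \<in> U" by auto
    obtain e where e: "0 < e" "\<And>y. dist y (pairing \<eta>0 (H (X \<eta>0))) < e \<Longrightarrow> y \<in> U"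
      using U \<eta>0(2) by (auto simp: open_dist)
    define M where "M = pairing \<eta>0 (\<lambda>_. 1)"
    have M: "0 \<le> M" by (simp add: M_def pairing_nonneg)
    define e1 where "e1 = e / (2 * (M + 1))"
    have e1: "0 < e1" using e M by (simp add: e1_def)
    define g where "g = H (X \<eta>0)"
    have g: "continuous_on UNIV g" unfolding g_def using XS[OF \<eta>0(1)] by (rule Hc)
    obtain X0 where X0: "X \<eta>0 \<in> X0" "open X0"
      "\<forall>x\<in>X0 \<inter> S. \<forall>r\<in>UNIV. dist (H x r) (H (X \<eta>0) r) \<le> e1"
      using continuous_on_prod_compactE[OF H E XS[OF \<eta>0(1)] e1] by (auto simp: split_beta)
    define V where "V = {\<eta> \<in> fin_measures. X \<eta> \<in> X0 \<inter> S} \<inter> {\<eta> \<in> fin_measures. pairing \<eta> (\<lambda>_. 1) \<in> {..<M + 1}}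
       \<inter> {\<eta> \<in> fin_measures. pairing \<eta> g \<in> ball (pairing \<eta>0 g) (e / 2)}"
    have "openin weak_topology V"
      unfolding V_def
    proof (intro openin_Int)
      have "openin (top_of_set S) (X0 \<inter> S)" using X0(2) by (metis openin_open_Int Int_commute)
      then show "openin weak_topology {\<eta> \<in> fin_measures. X \<eta> \<in> X0 \<inter> S}"
        using X by (auto simp: continuous_map_def)
      show "openin weak_topology {\<eta> \<in> (fin_measures :: 'a measure set). pairing \<eta> (\<lambda>_. 1) \<in> {..<M + 1}}"
        by (intro continuous_map_weakD continuous_map_pairing) (use E in auto)
      show "openin weak_topology {\<eta> \<in> fin_measures. pairing \<eta> g \<in> ball (pairing \<eta>0 g) (e / 2)}"
        by (intro continuous_map_weakD continuous_map_pairing) (use E g in auto)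
    qed
    moreover have "\<eta>0 \<in> V" using \<eta>0 X0 XS e by (auto simp: V_def M_def)
    moreover have "V \<subseteq> {\<eta> \<in> fin_measures. pairing \<eta> (H (X \<eta>)) \<in> U}"
    proof
      fix \<eta> assume "\<eta> \<in> V"
      then have \<eta>: "\<eta> \<in> fin_measures" "X \<eta> \<in> X0" "X \<eta> \<in> S" "pairing \<eta> (\<lambda>_. 1) < M + 1"
        "\<bar>pairing \<eta> g - pairing \<eta>0 g\<bar> < e / 2"
        by (auto simp: V_def dist_real_def abs_minus_commute)
      note I = integrable_continuous_fin_measures[OF E \<eta>(1)]
      have "\<bar>pairing \<eta> (H (X \<eta>)) - pairing \<eta> g\<bar> = \<bar>\<integral>r. H (X \<eta>) r - g r \<partial>\<eta>\<bar>"
        unfolding pairing_def using I[OF Hc[OF \<eta>(3)]] I[OF g] by simp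
      also have "\<dots> \<le> (\<integral>r. e1 \<partial>\<eta>)"
        using I[OF Hc[OF \<eta>(3)]] I[OF g] I[of "\<lambda>_. e1"] X0(3) \<eta>(2,3)
        by (intro integral_abs_bound[THEN order_trans] integral_mono) (auto simp: g_def dist_real_def)
      also have "\<dots> = e1 * pairing \<eta> (\<lambda>_. 1)" by (simp add: pairing_def)
      also have "\<dots> < e1 * (M + 1)" using e1 \<eta>(4) by simp
      also have "\<dots> = e / 2" using M by (simp add: e1_def field_simps)
      finally have "dist (pairing \<eta> (H (X \<eta>))) (pairing \<eta>0 (H (X \<eta>0))) < e"
        using \<eta>(5) unfolding dist_real_def g_def by linarith
      with e \<eta> show "\<eta> \<in> {\<eta> \<in> fin_measures. pairing \<eta> (H (X \<eta>)) \<in> U}" by auto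
    qed
    ultimately show "\<exists>T. openin weak_topology T \<and> \<eta>0 \<in> T \<and> T \<subseteq> {\<eta> \<in> fin_measures. pairing \<eta> (H (X \<eta>)) \<in> U}"
      by blast
  qed
qed

section \<open>The Laplace functional\<close>

lemma C_ppD:
  assumes "f \<in> C_pp"
  shows "continuous_on UNIV f" "0 < f r" "0 \<le> f r" "f r \<noteq> 0"
  using assms by (auto simp: C_pp_def intro: less_le_trans less_imp_le) (smt (verit))+

lemma C_ppI:
  fixes f :: "'a::topological_space \<Rightarrow> real"
  assumes "compact (UNIV :: 'a set)" "continuous_on UNIV f" "\<And>r. 0 < f r"
  shows "f \<in> C_pp"
proof -
  obtain x where "\<And>y. f x \<le> f y"
    using continuous_attains_inf[OF assms(1) _ assms(2)] by auto
  with assms show ?thesis by (auto simp: C_pp_def)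
qed

lemma C_pp_subset_B_plus:
  fixes f :: "'a::topological_space \<Rightarrow> real"
  assumes "compact (UNIV :: 'a set)" "f \<in> C_pp"
  shows "f \<in> B_plus"
  using C_ppD[OF assms(2)] assms(1)
  by (auto simp: B_plus_def intro!: borel_measurable_continuous_onI compact_imp_bounded compact_continuous_image)

text \<open>The quotient g / f is continuous on a compact space. This is what bounds a pairing with
  \<open>g\<close> by a multiple of the pairing with \<open>f\<close>, and so makes it harmless once
  multiplied by exp (- \<langle>\<eta>, f\<rangle>).\<close>

lemma continuous_pairing_ratio_bound:
  fixes f g :: "'a::topological_space \<Rightarrow> real"
  assumes "compact (UNIV :: 'a set)" "f \<in> C_pp" "continuous_on UNIV g"
  obtains C where "0 < C" "\<And>r. \<bar>g r\<bar> \<le> C * f r"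
proof -
  have "continuous_on UNIV (\<lambda>r. g r / f r)"
    using C_ppD[OF assms(2)] assms(3) by (intro continuous_intros) auto
  from compact_UNIV_bounded[OF assms(1) this] obtain C where C: "0 < C" "\<And>r. \<bar>g r / f r\<bar> \<le> C" by blast
  show ?thesis
    using C C_ppD[OF assms(2)] by (intro that[of C]) (auto simp: abs_div divide_le_eq mult.commute)
qed

lemma pairing_add:
  fixes f g :: "'a::topological_space \<Rightarrow> real"
  assumes "compact (UNIV :: 'a set)" "\<eta> \<in> fin_measures" "continuous_on UNIV f" "continuous_on UNIV g"
  shows "pairing \<eta> (\<lambda>r. f r + g r) = pairing \<eta> f + pairing \<eta> g"
  unfolding pairing_def by (intro Bochner_Integration.integral_add integrable_continuous_fin_measures assms)

lemma pairing_cmult: "pairing \<eta> (\<lambda>r. c * f r) = c * pairing \<eta> f"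
  by (simp add: pairing_def)

text \<open>A chain rule along a sequence: the inner quotient is known to converge, but only along
  the steps 1 / (n + 1). Caratheodory's slope function of exp (- t) at \<open>y0\<close> is
  continuous there, and y n tends to \<open>y0\<close> because the convergent quotient is multiplied
  by steps tending to 0.\<close>

lemma LIMSEQ_exp_difference_quotient:
  fixes y :: "nat \<Rightarrow> real"
  assumes "(\<lambda>n. (y n - y0) * real (Suc n)) \<longlonglongrightarrow> D"
  shows "(\<lambda>n. (exp (- y n) - exp (- y0)) * real (Suc n)) \<longlonglongrightarrow> - D * exp (- y0)"
proof -
  have "((\<lambda>t. exp (- t)) has_real_derivative - exp (- y0)) (at y0)"
    by (auto intro!: derivative_eq_intros)
  then obtain g where g: "\<And>z. exp (- z) - exp (- y0) = g z * (z - y0)" "isCont g y0" "g y0 = - exp (- y0)"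
    unfolding CARAT_DERIV by blast
  have "(\<lambda>n. (y n - y0) * real (Suc n) * inverse (real (Suc n))) \<longlonglongrightarrow> D * 0"
    by (intro tendsto_mult assms LIMSEQ_inverse_real_of_nat)
  moreover have "(y n - y0) * real (Suc n) * inverse (real (Suc n)) = y n - y0" for n
    by (simp add: mult.assoc del: of_nat_Suc)
  ultimately have "(\<lambda>n. y n - y0) \<longlonglongrightarrow> 0" by (simp only: mult_zero_right)
  then have "y \<longlonglongrightarrow> y0" by (simp add: LIM_zero_iff)
  then have "(\<lambda>n. g (y n)) \<longlonglongrightarrow> g y0" using g(2) by (rule isCont_tendsto_compose[rotated])
  then have "(\<lambda>n. g (y n) * ((y n - y0) * real (Suc n))) \<longlonglongrightarrow> g y0 * D"
    using assms by (rule tendsto_mult)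
  then show ?thesis by (simp add: g mult_ac)
qed

definition laplace_exponent :: "real \<Rightarrow> ('a \<Rightarrow> real) \<Rightarrow> ('a \<Rightarrow> real) \<Rightarrow> 'a measure \<Rightarrow> ('a \<Rightarrow> real) \<Rightarrow> real" where
  "laplace_exponent \<alpha> a b m f = pairing m (\<lambda>r. inverse (a r) * ln (1 + a r * inverse (b r) * f r powr \<alpha>))"

text \<open>For A \<ge> B > 0 the ratio (1 + c A) / (1 + c B) is at most A / B, which eliminates c.
  The resulting bound is therefore the same at all points r, whatever the value of a / b
  there.\<close>

lemma ln_powr_increment:
  fixes \<alpha> c x h :: real
  assumes "0 < \<alpha>" "0 < c" "0 < x" "0 \<le> h"
  shows "0 \<le> ln (1 + c * (x + h) powr \<alpha>) - ln (1 + c * x powr \<alpha>)"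
    and "ln (1 + c * (x + h) powr \<alpha>) - ln (1 + c * x powr \<alpha>) \<le> \<alpha> * (h / x)"
proof -
  define A where "A = (x + h) powr \<alpha>"
  define B where "B = x powr \<alpha>"
  have AB: "0 < B" "B \<le> A" unfolding A_def B_def using assms by (auto intro!: powr_mono2)
  have pos: "0 < 1 + c * A" "0 < 1 + c * B" using AB assms by (auto intro!: add_pos_pos mult_pos_pos)
  show "0 \<le> ln (1 + c * (x + h) powr \<alpha>) - ln (1 + c * x powr \<alpha>)"
    using AB assms pos unfolding A_def[symmetric] B_def[symmetric] by simp
  have "ln (1 + c * A) - ln (1 + c * B) = ln ((1 + c * A) / (1 + c * B))"
    using pos by (simp add: ln_div)
  also have "\<dots> \<le> ln (A / B)"
    using AB assms pos by (subst ln_le_cancel_iff) (auto simp: divide_simps algebra_simps)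
  also have "A / B = ((x + h) / x) powr \<alpha>" using assms by (simp add: A_def B_def powr_divide)
  also have "ln \<dots> = \<alpha> * ln (1 + h / x)" using assms by (simp add: ln_powr add_divide_distrib)
  also have "\<dots> \<le> \<alpha> * (h / x)" using assms by (intro mult_left_mono ln_add_one_self_le_self) auto
  finally show "ln (1 + c * (x + h) powr \<alpha>) - ln (1 + c * x powr \<alpha>) \<le> \<alpha> * (h / x)"
    by (simp add: A_def B_def)
qed

text \<open>The directional derivative of the exponent, taken under the integral over E. The
  quotients are at most \<alpha> g / (a f), a bounded function, and \<open>m\<close> is
  finite.\<close>

lemma laplace_exponent_difference_quotient:
  fixes a b f g :: "'a::topological_space \<Rightarrow> real"
  assumes E: "compact (UNIV :: 'a set)" and \<alpha>: "0 < \<alpha>"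
    and ab: "a \<in> C_pp" "b \<in> C_pp" and m: "m \<in> fin_measures" and fg: "f \<in> C_pp" "g \<in> C_pp"
  shows "(\<lambda>n. (laplace_exponent \<alpha> a b m (\<lambda>r. f r + inverse (real (Suc n)) * g r) - laplace_exponent \<alpha> a b m f) * real (Suc n))
     \<longlonglongrightarrow> pairing m (\<lambda>r. \<alpha> * f r powr (\<alpha> - 1) * g r / (b r + a r * f r powr \<alpha>))"
proof -
  note C = C_ppD[OF ab(1)] C_ppD[OF ab(2)] C_ppD[OF fg(1)] C_ppD[OF fg(2)]
  have nn: "0 < 1 + a r * inverse (b r) * x powr \<alpha>" "0 < b r + a r * x powr \<alpha>" for r x
    using C by (auto intro!: add_pos_nonneg mult_nonneg_nonneg)
  let ?h = "\<lambda>n. inverse (real (Suc n))"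
  define q where "q r x = inverse (a r) * ln (1 + a r * inverse (b r) * x powr \<alpha>)" for r x
  define X where "X n r = (q r (f r + ?h n * g r) - q r (f r)) * real (Suc n)" for n r
  have qcont: "continuous_on UNIV (\<lambda>r. q r (u r))" if "u \<in> C_pp" for u
    unfolding q_def using C C_ppD[OF that] nn
    by (intro continuous_intros) (auto intro!: less_imp_neq[THEN not_sym])
  have fh: "(\<lambda>r. f r + ?h n * g r) \<in> C_pp" for n
    using C by (intro C_ppI E continuous_intros) (auto intro!: add_pos_pos mult_pos_pos)
  obtain D where D: "0 < D" "\<And>r. \<bar>g r\<bar> \<le> D * f r"
    using continuous_pairing_ratio_bound[OF E fg(1) C(13)] by blast
  have "continuous_on UNIV (\<lambda>r. inverse (a r))" using C by (intro continuous_intros) auto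
  from compact_UNIV_bounded[OF E this] obtain A where A: "0 < A" "\<And>r. \<bar>inverse (a r)\<bar> \<le> A" by blast
  interpret m: finite_measure m using fin_measuresD[OF m] by simp
  have "(\<lambda>n. integral\<^sup>L m (X n)) \<longlonglongrightarrow> (\<integral>r. \<alpha> * f r powr (\<alpha> - 1) * g r / (b r + a r * f r powr \<alpha>) \<partial>m)"
  proof (rule integral_dominated_convergence[where w = "\<lambda>_. A * (\<alpha> * D)"])
    show "AE r in m. (\<lambda>n. X n r) \<longlonglongrightarrow> \<alpha> * f r powr (\<alpha> - 1) * g r / (b r + a r * f r powr \<alpha>)"
    proof (intro AE_I2)
      fix r
      have "((\<lambda>t. q r (f r + t * g r)) has_real_derivative
         inverse (a r) * ((a r * inverse (b r) * (\<alpha> * f r powr (\<alpha> - 1) * g r)) / (1 + a r * inverse (b r) * f r powr \<alpha>))) (at 0)"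
        unfolding q_def using C nn[of r "f r"] by (auto intro!: derivative_eq_intros simp: mult_ac)
      from DERIV_sequentially[OF this]
      show "(\<lambda>n. X n r) \<longlonglongrightarrow> \<alpha> * f r powr (\<alpha> - 1) * g r / (b r + a r * f r powr \<alpha>)"
        using C(2,6,10,14)[of r] by (simp add: X_def field_simps)
    qed
    show "AE r in m. norm (X n r) \<le> A * (\<alpha> * D)" for n
    proof (intro AE_I2)
      fix r
      have h: "0 \<le> ?h n * g r" using C by (auto intro!: mult_nonneg_nonneg)
      have c: "0 < a r * inverse (b r)" using C by auto
      let ?d = "ln (1 + a r * inverse (b r) * (f r + ?h n * g r) powr \<alpha>) - ln (1 + a r * inverse (b r) * f r powr \<alpha>)"
      have d: "0 \<le> ?d" "?d \<le> \<alpha> * (?h n * g r / f r)"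
        using ln_powr_increment[OF \<alpha> c C(10)[of r] h] by auto
      have "X n r = inverse (a r) * (?d * real (Suc n))"
        by (simp add: X_def q_def algebra_simps)
      also have "\<bar>\<dots>\<bar> \<le> A * (\<alpha> * D)"
      proof -
        have "?d * real (Suc n) \<le> \<alpha> * (?h n * g r / f r) * real (Suc n)" using d by (intro mult_right_mono) auto
        also have "\<dots> = \<alpha> * (g r / f r)" using C(10)[of r] by (simp add: field_simps del: of_nat_Suc)
        also have "\<dots> \<le> \<alpha> * D" using D(2)[of r] C(10,14)[of r] \<alpha> by (intro mult_left_mono) (auto simp: divide_le_eq)
        finally have "?d * real (Suc n) \<le> \<alpha> * D" .
        moreover have "0 \<le> ?d * real (Suc n)" using d by auto
        ultimately have "\<bar>?d * real (Suc n)\<bar> \<le> \<alpha> * D" by (simp only: abs_of_nonneg)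
        then show ?thesis unfolding abs_mult[of "inverse (a r)"] using A(1) by (intro mult_mono A(2)) auto
      qed
      finally show "norm (X n r) \<le> A * (\<alpha> * D)" by simp
    qed
    have [measurable]: "X n \<in> borel_measurable borel" for n
      unfolding X_def by (intro borel_measurable_continuous_onI continuous_intros qcont fh fg)
    show "X n \<in> borel_measurable m" for n
      using fin_measuresD[OF m] by (simp cong: measurable_cong_sets)
    have "(\<lambda>r. \<alpha> * f r powr (\<alpha> - 1) * g r / (b r + a r * f r powr \<alpha>)) \<in> borel_measurable borel"
      using C nn by (intro borel_measurable_continuous_onI continuous_intros) (auto intro!: less_imp_neq[THEN not_sym])
    then show "(\<lambda>r. \<alpha> * f r powr (\<alpha> - 1) * g r / (b r + a r * f r powr \<alpha>)) \<in> borel_measurable m"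
      using fin_measuresD[OF m] by (simp cong: measurable_cong_sets)
  qed simp
  moreover have "integral\<^sup>L m (X n) = (laplace_exponent \<alpha> a b m (\<lambda>r. f r + ?h n * g r) - laplace_exponent \<alpha> a b m f) * real (Suc n)" for n
    using integrable_continuous_fin_measures[OF E m qcont[OF fh[of n]]] integrable_continuous_fin_measures[OF E m qcont[OF fg(1)]]
    unfolding X_def[abs_def] by (simp add: laplace_exponent_def pairing_def q_def[symmetric])
  ultimately show ?thesis by (simp add: pairing_def)
qed

lemma mult_exp_minus_bound: "x * exp (- x) \<le> 1" for x :: real
  using mult_exp_minus_le[of x] by (smt (verit) exp_gt_zero)

text \<open>The Laplace functional is differentiated at f in the direction g. Its difference
  quotients are dominated by D \<langle>\<eta>, f\<rangle> exp (- \<langle>\<eta>, f\<rangle>) \<le>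
  D, where g \<le> D f, so that no moment of \<eta> is called upon.\<close>

lemma has_bochner_integral_pairing_exp:
  fixes a b f g :: "'a::topological_space \<Rightarrow> real"
  assumes E: "compact (UNIV :: 'a set)" and \<alpha>: "0 < \<alpha>"
    and ab: "a \<in> C_pp" "b \<in> C_pp" and m: "m \<in> fin_measures" and fg: "f \<in> C_pp" "g \<in> C_pp"
    and Q: "prob_space Q" "sets Q = sets borel_weak"
    and Q_Laplace: "\<And>f. f \<in> B_plus \<Longrightarrow> (\<integral>\<eta>. exp (- pairing \<eta> f) \<partial>Q) = exp (- laplace_exponent \<alpha> a b m f)"
  shows "has_bochner_integral Q (\<lambda>\<eta>. pairing \<eta> g * exp (- pairing \<eta> f))
     (exp (- laplace_exponent \<alpha> a b m f) * pairing m (\<lambda>r. \<alpha> * f r powr (\<alpha> - 1) * g r / (b r + a r * f r powr \<alpha>)))"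
proof -
  interpret Q: prob_space Q by fact
  note C = C_ppD[OF fg(1)] C_ppD[OF fg(2)]
  let ?h = "\<lambda>n. inverse (real (Suc n))"
  have sp: "space Q = fin_measures" using space_borel_weak[OF Q(2)] .
  have [measurable]: "(\<lambda>\<eta>. pairing \<eta> u) \<in> borel_measurable Q" if "continuous_on UNIV u" for u
    using continuous_map_pairing[OF E that] Q(2) by (rule measurable_continuous_map_weak)
  note meas = this[OF C(1)] this[OF C(5)]
  note [measurable] = meas
  define X where "X n \<eta> = (exp (- pairing \<eta> f) - exp (- pairing \<eta> (\<lambda>r. f r + ?h n * g r))) * real (Suc n)" for n \<eta>
  have fh: "(\<lambda>r. f r + ?h n * g r) \<in> C_pp" for n
    using C by (intro C_ppI E continuous_intros) (auto intro!: add_pos_pos mult_pos_pos)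
  obtain D where D: "0 < D" "\<And>r. \<bar>g r\<bar> \<le> D * f r"
    using continuous_pairing_ratio_bound[OF E fg(1) C(5)] by blast
  have Xeq: "X n \<eta> = (exp (- (pairing \<eta> f + 0 * pairing \<eta> g)) - exp (- (pairing \<eta> f + ?h n * pairing \<eta> g))) * real (Suc n)"
    if "\<eta> \<in> fin_measures" for n \<eta>
    unfolding X_def using that C
    by (subst pairing_add[OF E]) (auto intro!: continuous_intros simp: pairing_cmult)
  have lim: "(\<lambda>n. X n \<eta>) \<longlonglongrightarrow> pairing \<eta> g * exp (- pairing \<eta> f)" if "\<eta> \<in> fin_measures" for \<eta>
  proof -
    have "((\<lambda>t. - exp (- (pairing \<eta> f + t * pairing \<eta> g))) has_real_derivative pairing \<eta> g * exp (- pairing \<eta> f)) (at 0)"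
      by (auto intro!: derivative_eq_intros)
    from DERIV_sequentially[OF this] show ?thesis
      by (simp add: Xeq[OF that] algebra_simps)
  qed
  have bound: "\<bar>X n \<eta>\<bar> \<le> D" if \<eta>: "\<eta> \<in> fin_measures" for n \<eta>
  proof -
    have p: "0 \<le> pairing \<eta> g" "0 \<le> pairing \<eta> f" using C by (auto intro!: pairing_nonneg)
    have gD: "pairing \<eta> g \<le> D * pairing \<eta> f"
      unfolding pairing_cmult[symmetric] using C D by (intro pairing_mono[OF E \<eta>] continuous_intros) (auto simp: abs_le_iff)
    have "X n \<eta> = exp (- pairing \<eta> f) * ((1 - exp (- (?h n * pairing \<eta> g))) * real (Suc n))"
      by (simp add: Xeq[OF \<eta>] algebra_simps flip: exp_add)
    moreover have "0 \<le> (1 - exp (- (?h n * pairing \<eta> g))) * real (Suc n)" using p by (auto intro!: mult_nonneg_nonneg)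
    moreover have "(1 - exp (- (?h n * pairing \<eta> g))) * real (Suc n) \<le> pairing \<eta> g"
    proof -
      have "(1 - exp (- (?h n * pairing \<eta> g))) * real (Suc n) \<le> ?h n * pairing \<eta> g * real (Suc n)"
        using exp_minus_ge[of "?h n * pairing \<eta> g"] by (intro mult_right_mono) auto
      also have "?h n * pairing \<eta> g * real (Suc n) = pairing \<eta> g" by (simp add: field_simps)
      finally show ?thesis .
    qed
    ultimately have "0 \<le> X n \<eta>" "X n \<eta> \<le> exp (- pairing \<eta> f) * pairing \<eta> g"
      by (simp_all only: mult_nonneg_nonneg exp_ge_zero mult_left_mono)
    moreover have "exp (- pairing \<eta> f) * pairing \<eta> g \<le> exp (- pairing \<eta> f) * (D * pairing \<eta> f)"
      using gD by (intro mult_left_mono) auto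
    moreover have "\<dots> \<le> D" using mult_exp_minus_bound[of "pairing \<eta> f"] D(1)
      by (metis mult.commute mult.left_commute mult.right_neutral mult_left_mono less_imp_le)
    ultimately show ?thesis by linarith
  qed
  have Xm: "X n \<in> borel_measurable Q" for n
    unfolding X_def using meas measurable_continuous_map_weak[OF continuous_map_pairing[OF E C_ppD(1)[OF fh[of n]]] Q(2)]
    by measurable
  have dom: "integrable Q (\<lambda>_. D)" by simp
  have AEb: "AE \<eta> in Q. norm (X n \<eta>) \<le> D" for n by (intro AE_I2) (use bound sp in auto)
  have AEl: "AE \<eta> in Q. (\<lambda>n. X n \<eta>) \<longlonglongrightarrow> pairing \<eta> g * exp (- pairing \<eta> f)" by (intro AE_I2) (use lim sp in auto)
  have gm: "(\<lambda>\<eta>. pairing \<eta> g * exp (- pairing \<eta> f)) \<in> borel_measurable Q" by measurable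
  have I: "integrable Q (\<lambda>\<eta>. pairing \<eta> g * exp (- pairing \<eta> f))"
    by (rule integrable_dominated_convergence[where s = X, OF gm Xm dom AEl AEb])
  have l1: "(\<lambda>n. integral\<^sup>L Q (X n)) \<longlonglongrightarrow> (\<integral>\<eta>. pairing \<eta> g * exp (- pairing \<eta> f) \<partial>Q)"
    by (rule integral_dominated_convergence[where s = X, OF gm Xm dom AEl AEb])
  have int: "integrable Q (\<lambda>\<eta>. exp (- pairing \<eta> u))" if "u \<in> C_pp" for u
  proof (rule Q.integrable_const_bound[where B = 1])
    show "(\<lambda>\<eta>. exp (- pairing \<eta> u)) \<in> borel_measurable Q"
      using measurable_continuous_map_weak[OF continuous_map_pairing[OF E C_ppD(1)[OF that]] Q(2)] by measurable
  qed (use C_ppD[OF that] in \<open>auto intro!: pairing_nonneg\<close>)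
  have "integral\<^sup>L Q (X n) = - ((exp (- laplace_exponent \<alpha> a b m (\<lambda>r. f r + ?h n * g r)) - exp (- laplace_exponent \<alpha> a b m f)) * real (Suc n))" for n
    unfolding X_def using int[OF fg(1)] int[OF fh[of n]] Q_Laplace[OF C_pp_subset_B_plus[OF E fg(1)]] Q_Laplace[OF C_pp_subset_B_plus[OF E fh[of n]]]
    by (simp add: algebra_simps)
  with l1 have l1': "(\<lambda>n. - ((exp (- laplace_exponent \<alpha> a b m (\<lambda>r. f r + ?h n * g r)) - exp (- laplace_exponent \<alpha> a b m f)) * real (Suc n)))
      \<longlonglongrightarrow> (\<integral>\<eta>. pairing \<eta> g * exp (- pairing \<eta> f) \<partial>Q)" by simp
  have "(\<integral>\<eta>. pairing \<eta> g * exp (- pairing \<eta> f) \<partial>Q) =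
     - (- pairing m (\<lambda>r. \<alpha> * f r powr (\<alpha> - 1) * g r / (b r + a r * f r powr \<alpha>)) * exp (- laplace_exponent \<alpha> a b m f))"
    by (rule LIMSEQ_unique[OF l1'])
       (intro tendsto_minus LIMSEQ_exp_difference_quotient laplace_exponent_difference_quotient E \<alpha> ab m fg)
  with I show ?thesis by (simp add: has_bochner_integral_iff mult.commute)
qed

section \<open>The inequality for combinations of exponentials\<close>

text \<open>The value that the formula for the operator gives on exp (- \<langle>\<eta>,
  f\<rangle>), with the z-integrals evaluated. It is introduced as a separate object because these
  exponentials have no compact support and thus lie outside \<open>F_class\<close>; the link with
  the generator is made by approximation.\<close>

definition exp_generator ::
    "real \<Rightarrow> ('a \<Rightarrow> real) \<Rightarrow> ('a \<Rightarrow> real) \<Rightarrow> 'a measure \<Rightarrow> ('a \<Rightarrow> real) \<Rightarrow> 'a measure \<Rightarrow> real" where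
  "exp_generator \<alpha> a b m f \<eta> = exp (- pairing \<eta> f) *
     (pairing \<eta> (\<lambda>r. a r * f r powr (\<alpha> + 1) + b r * f r) / \<alpha> - pairing m (\<lambda>r. f r powr \<alpha>))"

text \<open>At one point of E, the substitution l = t f with t^\<alpha> = a/b turns ln (1 +
  l^\<alpha>) into the integrand of the Laplace exponent, while the right-hand side becomes a/b
  times a form that no longer contains t. Dividing by a leaves 1/b, which is replaced by its bound
  \<open>S\<close>.\<close>

lemma scaled_one_dim_qform:
  fixes \<alpha> \<gamma> a b S :: real
  assumes L: "is_Lambda \<alpha> \<Lambda>" and \<alpha>: "0 < \<alpha>" "\<alpha> < 1" and \<gamma>: "0 < \<gamma>"
    and one_dim: "\<And>F. F \<in> D_exp_real \<Longrightarrow>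
      (\<integral>\<^sup>+z. ennreal ((F z - F 0)\<^sup>2) \<partial>\<Lambda>)
        \<le> ennreal (\<gamma> / 2) *
          ((\<integral>\<^sup>+z. ennreal z * (\<integral>\<^sup>+y. ennreal ((F (z + y) - F z)\<^sup>2) \<partial>n_B \<alpha>) \<partial>\<Lambda>)
           + (\<integral>\<^sup>+y. ennreal ((F y - F 0)\<^sup>2) \<partial>n_I \<alpha>))"
    and f: "\<And>i. i < n \<Longrightarrow> 0 < f i" and ab: "0 < a" "0 < b" and S: "inverse b \<le> S"
  shows "schur_multiplier n (\<lambda>i j. inverse a * (ln (1 + a * inverse b * f i powr \<alpha>) + ln (1 + a * inverse b * f j powr \<alpha>)
            - ln (1 + a * inverse b * (f i + f j) powr \<alpha>)))"
    and "psd n (\<lambda>i j. \<gamma> / 2 * S * (f i powr \<alpha> + f j powr \<alpha> - (f i + f j) powr \<alpha>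
       + (f i + f j) powr (\<alpha> - 1) * (a * ((f i + f j) powr (\<alpha> + 1) - f i powr (\<alpha> + 1) - f j powr (\<alpha> + 1)))
          / (b + a * (f i + f j) powr \<alpha>)) - inverse a * (ln (1 + a * inverse b * f i powr \<alpha>) + ln (1 + a * inverse b * f j powr \<alpha>)
            - ln (1 + a * inverse b * (f i + f j) powr \<alpha>)))"
proof -
  define K where "K = (\<lambda>i j. inverse a * (ln (1 + a * inverse b * f i powr \<alpha>) + ln (1 + a * inverse b * f j powr \<alpha>)
            - ln (1 + a * inverse b * (f i + f j) powr \<alpha>)))"
  define t where "t = (a / b) powr (1 / \<alpha>)"
  have t: "0 < t" using ab by (simp add: t_def)
  have t\<alpha>: "t powr \<alpha> = a * inverse b" using ab \<alpha> by (simp add: t_def powr_powr divide_inverse)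
  define l where "l i = t * f i" for i
  have l: "0 < l i" if "i < n" for i using t f that by (simp add: l_def)
  have l\<alpha>: "l i powr \<alpha> = a * inverse b * f i powr \<alpha>" if "i < n" for i
    using t f[OF that] by (simp add: l_def powr_mult t\<alpha>)
  have s\<alpha>: "(l i + l j) powr p = t powr p * (f i + f j) powr p" if "i < n" "j < n" for i j p
    using t f[OF that(1)] f[OF that(2)] by (simp add: l_def powr_mult flip: distrib_left)
  define KL where "KL = (\<lambda>i j. ln (1 + l i powr \<alpha>) + ln (1 + l j powr \<alpha>) - ln (1 + (l i + l j) powr \<alpha>))"
  define \<epsilon> where "\<epsilon> = (\<lambda>i j. f i powr \<alpha> + f j powr \<alpha> - (f i + f j) powr \<alpha>
       + (f i + f j) powr (\<alpha> - 1) * (a * ((f i + f j) powr (\<alpha> + 1) - f i powr (\<alpha> + 1) - f j powr (\<alpha> + 1)))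
          / (b + a * (f i + f j) powr \<alpha>))"
  have KL: "K i j = inverse a * KL i j" if "i < n" "j < n" for i j
    using that by (simp add: K_def KL_def l\<alpha> s\<alpha> t\<alpha>)
  have schur_KL: "schur_multiplier n KL"
    unfolding KL_def using l
    by (intro schur_multiplier_gram[where M = \<Lambda> and g = "\<lambda>i z. 1 - exp (- l i * z)"] has_bochner_integral_Lambda_gram[OF L])
       (auto intro: less_imp_le)
  have R: "l i powr \<alpha> + l j powr \<alpha> - (l i + l j) powr \<alpha>
        + (l i + l j) powr (\<alpha> - 1) * ((l i + l j) powr (\<alpha> + 1) - l i powr (\<alpha> + 1) - l j powr (\<alpha> + 1))
          / (1 + (l i + l j) powr \<alpha>) = a * inverse b * \<epsilon> i j" if ij: "i < n" "j < n" for i j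
  proof -
    define u where "u = (f i + f j) powr \<alpha>"
    define w where "w = (f i + f j) powr (\<alpha> - 1)"
    define v where "v = (f i + f j) powr (\<alpha> + 1) - f i powr (\<alpha> + 1) - f j powr (\<alpha> + 1)"
    have u: "0 < b + a * u" using ab by (auto simp: u_def intro!: add_pos_nonneg)
    have 1: "(l i + l j) powr (\<alpha> + 1) - l i powr (\<alpha> + 1) - l j powr (\<alpha> + 1) = t powr (\<alpha> + 1) * v"
      using s\<alpha>[OF ij] t f[OF ij(1)] f[OF ij(2)] by (simp add: l_def powr_mult v_def right_diff_distrib)
    \<comment> \<open>The powers of t combine to (a/b)^2. As 1 + (a/b) u = (b + a u) / b, one factor
      1/b is absorbed by the denominator and a/b times the entry of \<epsilon> remains.\<close>
    have 2: "t powr (\<alpha> - 1) * t powr (\<alpha> + 1) = (a * inverse b)\<^sup>2"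
      using t by (simp add: t\<alpha>[symmetric] power2_eq_square flip: powr_add)
    have "(l i + l j) powr (\<alpha> - 1) * ((l i + l j) powr (\<alpha> + 1) - l i powr (\<alpha> + 1) - l j powr (\<alpha> + 1))
          / (1 + (l i + l j) powr \<alpha>) = (t powr (\<alpha> - 1) * t powr (\<alpha> + 1)) * (w * v) / (1 + a * inverse b * u)"
      unfolding 1 unfolding s\<alpha>[OF ij] t\<alpha> w_def u_def by (simp only: mult_ac)
    also have "\<dots> = a * inverse b * (w * (a * v) / (b + a * u))"
    proof -
      have "1 + a * inverse b * u = (b + a * u) * inverse b" using ab by (simp add: distrib_right)
      then show ?thesis unfolding 2 using ab u by (simp add: power2_eq_square)
    qed
    finally show ?thesis
      by (simp add: \<epsilon>_def l\<alpha>[OF ij(1)] l\<alpha>[OF ij(2)] s\<alpha>[OF ij] t\<alpha> u_def v_def w_def algebra_simps)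
  qed
  have main: "qform n c KL \<le> \<gamma> / 2 * (a * inverse b * qform n c \<epsilon>)" for c
  proof -
    have "qform n c KL \<le> \<gamma> / 2 * qform n c (\<lambda>i j. l i powr \<alpha> + l j powr \<alpha> - (l i + l j) powr \<alpha>
        + (l i + l j) powr (\<alpha> - 1) * ((l i + l j) powr (\<alpha> + 1) - l i powr (\<alpha> + 1) - l j powr (\<alpha> + 1))
          / (1 + (l i + l j) powr \<alpha>))"
      unfolding KL_def by (rule one_dim_qform[OF L \<alpha> \<gamma> one_dim l])
    also have "qform n c (\<lambda>i j. l i powr \<alpha> + l j powr \<alpha> - (l i + l j) powr \<alpha>
        + (l i + l j) powr (\<alpha> - 1) * ((l i + l j) powr (\<alpha> + 1) - l i powr (\<alpha> + 1) - l j powr (\<alpha> + 1))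
          / (1 + (l i + l j) powr \<alpha>)) = qform n c (\<lambda>i j. a * inverse b * \<epsilon> i j)"
      by (rule qform_cong) (rule R)
    finally show ?thesis by (simp only: qform_cmult)
  qed
  have KL_pos: "0 \<le> qform n c KL" for c
    using schur_KL psd_one[of n] by (auto simp: schur_multiplier_def psd_def)
  \<comment> \<open>The sign of \<epsilon> is inherited from that of \<open>KL\<close> through
    \<open>main\<close>. It is what permits the passage from 1/b to the larger \<open>S\<close>
    below.\<close>
  have \<epsilon>_pos: "0 \<le> qform n c \<epsilon>" for c
  proof -
    have "0 \<le> \<gamma> / 2 * (a * inverse b * qform n c \<epsilon>)" using main[of c] KL_pos[of c] by linarith
    moreover have "0 < \<gamma> / 2 * (a * inverse b)" using \<gamma> ab by simp
    ultimately show ?thesis by (simp only: mult.assoc[symmetric] zero_le_mult_iff) auto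
  qed
  show "schur_multiplier n (\<lambda>i j. inverse a * (ln (1 + a * inverse b * f i powr \<alpha>) + ln (1 + a * inverse b * f j powr \<alpha>)
            - ln (1 + a * inverse b * (f i + f j) powr \<alpha>)))"
    unfolding K_def[symmetric]
  proof -
    have "schur_multiplier n (\<lambda>i j. inverse a * KL i j)"
      using schur_KL ab by (intro schur_multiplier_cmult) auto
    moreover have "qform n d (\<lambda>i j. A i j * K i j) = qform n d (\<lambda>i j. A i j * (inverse a * KL i j))" for d A
      by (rule qform_cong) (simp only: KL)
    ultimately show "schur_multiplier n K" by (simp only: schur_multiplier_def psd_def)
  qed
  show "psd n (\<lambda>i j. \<gamma> / 2 * S * (f i powr \<alpha> + f j powr \<alpha> - (f i + f j) powr \<alpha>
       + (f i + f j) powr (\<alpha> - 1) * (a * ((f i + f j) powr (\<alpha> + 1) - f i powr (\<alpha> + 1) - f j powr (\<alpha> + 1)))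
          / (b + a * (f i + f j) powr \<alpha>)) - inverse a * (ln (1 + a * inverse b * f i powr \<alpha>) + ln (1 + a * inverse b * f j powr \<alpha>)
            - ln (1 + a * inverse b * (f i + f j) powr \<alpha>)))"
    unfolding psd_def
  proof
    fix d
    have "qform n d (\<lambda>i j. \<gamma> / 2 * S * \<epsilon> i j - K i j) = qform n d (\<lambda>i j. \<gamma> / 2 * S * \<epsilon> i j - inverse a * KL i j)"
      by (rule qform_cong) (simp only: KL)
    also have "\<dots> = \<gamma> / 2 * S * qform n d \<epsilon> - inverse a * qform n d KL"
      by (simp only: qform_diff qform_cmult)
    also have "0 \<le> \<dots>"
    proof -
      have "inverse a * qform n d KL \<le> inverse a * (\<gamma> / 2 * (a * inverse b * qform n d \<epsilon>))"
        using main ab by (intro mult_left_mono) auto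
      also have "\<dots> = \<gamma> / 2 * inverse b * qform n d \<epsilon>" using ab by simp
      also have "\<dots> \<le> \<gamma> / 2 * S * qform n d \<epsilon>"
        using S \<gamma> \<epsilon>_pos by (intro mult_right_mono mult_left_mono) auto
      finally show ?thesis by simp
    qed
    finally show "0 \<le> qform n d (\<lambda>i j. \<gamma> / 2 * S * (f i powr \<alpha> + f j powr \<alpha> - (f i + f j) powr \<alpha>
       + (f i + f j) powr (\<alpha> - 1) * (a * ((f i + f j) powr (\<alpha> + 1) - f i powr (\<alpha> + 1) - f j powr (\<alpha> + 1)))
          / (b + a * (f i + f j) powr \<alpha>)) - inverse a * (ln (1 + a * inverse b * f i powr \<alpha>) + ln (1 + a * inverse b * f j powr \<alpha>)
            - ln (1 + a * inverse b * (f i + f j) powr \<alpha>)))"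
      by (simp only: \<epsilon>_def K_def)
  qed
qed

lemma variance_le_exp_generator:
  fixes a b :: "'a::topological_space \<Rightarrow> real" and n :: nat
  assumes E: "compact (UNIV :: 'a set)"
    and ab: "a \<in> C_pp" "b \<in> C_pp" and m: "m \<in> fin_measures"
    and L: "is_Lambda \<alpha> \<Lambda>" and \<alpha>: "0 < \<alpha>" "\<alpha> < 1" and \<gamma>: "0 < \<gamma>"
    and one_dim: "\<And>F. F \<in> D_exp_real \<Longrightarrow>
      (\<integral>\<^sup>+z. ennreal ((F z - F 0)\<^sup>2) \<partial>\<Lambda>)
        \<le> ennreal (\<gamma> / 2) *
          ((\<integral>\<^sup>+z. ennreal z * (\<integral>\<^sup>+y. ennreal ((F (z + y) - F z)\<^sup>2) \<partial>n_B \<alpha>) \<partial>\<Lambda>)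
           + (\<integral>\<^sup>+y. ennreal ((F y - F 0)\<^sup>2) \<partial>n_I \<alpha>))"
    and Q: "prob_space Q" "sets Q = sets borel_weak"
    and Q_Laplace: "\<And>f. f \<in> B_plus \<Longrightarrow> (\<integral>\<eta>. exp (- pairing \<eta> f) \<partial>Q) = exp (- laplace_exponent \<alpha> a b m f)"
    and f: "\<And>i. i < n \<Longrightarrow> f i \<in> C_pp" and S: "AE r in m. inverse (b r) \<le> S"
  shows "prob_space.variance Q (\<lambda>\<eta>. \<Sum>i<n. c i * exp (- pairing \<eta> (f i)))
    \<le> \<gamma> * S * (\<integral>\<eta>. - (\<Sum>i<n. c i * exp_generator \<alpha> a b m (f i) \<eta>) * (\<Sum>i<n. c i * exp (- pairing \<eta> (f i))) \<partial>Q)"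
proof -
  interpret Q: prob_space Q by fact
  define \<Psi> where "\<Psi> \<eta> = (\<Sum>i<n. c i * exp (- pairing \<eta> (f i)))" for \<eta>
  define \<Theta> where "\<Theta> \<eta> = (\<Sum>i<n. c i * exp_generator \<alpha> a b m (f i) \<eta>)" for \<eta>
  note C = C_ppD[OF ab(1)] C_ppD[OF ab(2)]
  note Cf = C_ppD[OF f]
  have sp: "space Q = fin_measures" using space_borel_weak[OF Q(2)] .
  have s: "(\<lambda>r. f i r + f j r) \<in> C_pp" if "i < n" "j < n" for i j
    using Cf[OF that(1)] Cf[OF that(2)] by (intro C_ppI E continuous_intros) (auto intro: add_pos_pos)
  have nn: "0 < b r + a r * x powr \<alpha>" "0 < 1 + a r * inverse (b r) * x powr \<alpha>" for r x
    using C by (auto intro!: add_pos_nonneg mult_nonneg_nonneg)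
  define \<psi> where "\<psi> = laplace_exponent \<alpha> a b m"
  have lap: "has_bochner_integral Q (\<lambda>\<eta>. exp (- pairing \<eta> u)) (exp (- \<psi> u))" if "u \<in> C_pp" for u
  proof -
    have "integrable Q (\<lambda>\<eta>. exp (- pairing \<eta> u))"
    proof (rule Q.integrable_const_bound[where B = 1])
      show "(\<lambda>\<eta>. exp (- pairing \<eta> u)) \<in> borel_measurable Q"
        using measurable_continuous_map_weak[OF continuous_map_pairing[OF E C_ppD(1)[OF that]] Q(2)] by measurable
    qed (use C_ppD[OF that] in \<open>auto intro!: pairing_nonneg\<close>)
    then show ?thesis
      using Q_Laplace[OF C_pp_subset_B_plus[OF E that]] by (simp add: has_bochner_integral_iff \<psi>_def)
  qed
  define d where "d i = c i * exp (- \<psi> (f i))" for i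
  define K where "K r = (\<lambda>i j. inverse (a r) * (ln (1 + a r * inverse (b r) * f i r powr \<alpha>) + ln (1 + a r * inverse (b r) * f j r powr \<alpha>)
            - ln (1 + a r * inverse (b r) * (f i r + f j r) powr \<alpha>)))" for r
  define \<epsilon> where "\<epsilon> r = (\<lambda>i j. f i r powr \<alpha> + f j r powr \<alpha> - (f i r + f j r) powr \<alpha>
       + (f i r + f j r) powr (\<alpha> - 1) * (a r * ((f i r + f j r) powr (\<alpha> + 1) - f i r powr (\<alpha> + 1) - f j r powr (\<alpha> + 1)))
          / (b r + a r * (f i r + f j r) powr \<alpha>))" for r
  \<comment> \<open>Integrated over \<open>m\<close> and multiplied by exp (- \<psi> (f i + f j)),
    this is the mean of minus the generator on the i-th exponential times the j-th exponential. It
    is not symmetric; \<epsilon> is its sum with the transpose.\<close>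
  define \<epsilon>1 where "\<epsilon>1 r = (\<lambda>i j. f i r powr \<alpha> - (f i r + f j r) powr (\<alpha> - 1) * (a r * f i r powr (\<alpha> + 1) + b r * f i r)
          / (b r + a r * (f i r + f j r) powr \<alpha>))" for r
  define k where "k = (\<lambda>i j. \<integral>r. K r i j \<partial>m)"
  define e where "e = (\<lambda>i j. \<integral>r. \<epsilon> r i j \<partial>m)"
  define e1 where "e1 = (\<lambda>i j. \<integral>r. \<epsilon>1 r i j \<partial>m)"
  have pw: "0 < f i r" if "i < n" for i r using Cf(2)[OF that] .
  have int_ln: "integrable m (\<lambda>r. inverse (a r) * ln (1 + a r * inverse (b r) * u r powr \<alpha>))" if "u \<in> C_pp" for u
    using C C_ppD[OF that] nn
    by (intro integrable_continuous_fin_measures E m continuous_intros) (auto intro!: less_imp_neq[THEN not_sym])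
  have k: "has_bochner_integral m (\<lambda>r. K r i j) (k i j)" "k i j = \<psi> (f i) + \<psi> (f j) - \<psi> (\<lambda>r. f i r + f j r)" if "i < n" "j < n" for i j
    using int_ln[OF f[OF that(1)]] int_ln[OF f[OF that(2)]] int_ln[OF s[OF that]]
    by (simp_all add: k_def K_def \<psi>_def laplace_exponent_def pairing_def has_bochner_integral_iff right_diff_distrib distrib_left)
  have e: "has_bochner_integral m (\<lambda>r. \<epsilon> r i j) (e i j)" if "i < n" "j < n" for i j
  proof -
    have "integrable m (\<lambda>r. \<epsilon> r i j)"
      unfolding \<epsilon>_def using C Cf[OF that(1)] Cf[OF that(2)] C_ppD[OF s[OF that]] nn
      by (intro integrable_continuous_fin_measures E m continuous_intros) (auto intro!: less_imp_neq[THEN not_sym])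
    then show ?thesis by (simp add: e_def has_bochner_integral_iff)
  qed
  have e1: "has_bochner_integral m (\<lambda>r. \<epsilon>1 r i j) (e1 i j)" if "i < n" "j < n" for i j
  proof -
    have "integrable m (\<lambda>r. \<epsilon>1 r i j)"
      unfolding \<epsilon>1_def using C Cf[OF that(1)] Cf[OF that(2)] C_ppD[OF s[OF that]] nn
      by (intro integrable_continuous_fin_measures E m continuous_intros) (auto intro!: less_imp_neq[THEN not_sym])
    then show ?thesis by (simp add: e1_def has_bochner_integral_iff)
  qed
  have \<epsilon>1_sym: "\<epsilon>1 r i j + \<epsilon>1 r j i = \<epsilon> r i j" if ij: "i < n" "j < n" for r i j
  proof -
    define t where "t = f i r + f j r"
    have t: "0 < t" using pw[OF ij(1)] pw[OF ij(2)] by (auto simp: t_def intro: add_pos_pos)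
    have p: "t powr (\<alpha> - 1) * t = t powr \<alpha>" "t powr (\<alpha> - 1) * t powr (\<alpha> + 1) = t powr \<alpha> * t powr \<alpha>"
      using powr_mult_base[of t "\<alpha> - 1"] t by (simp_all add: mult.commute flip: powr_add)
    have N: "b r + a r * t powr \<alpha> \<noteq> 0" using nn(1)[of r t] by simp
    have "t powr \<alpha> = (t powr (\<alpha> - 1) * t * b r + a r * (t powr (\<alpha> - 1) * t powr (\<alpha> + 1))) / (b r + a r * t powr \<alpha>)"
      unfolding p using N by (simp add: field_simps)
    \<comment> \<open>The terms in b are eliminated by b t + a t^(\<alpha>+1) = t (b + a
      t^\<alpha>): the denominator cancels and t^\<alpha> = (f i + f j)^\<alpha> is left, the term
      by which \<epsilon> differs from the plain symmetrisation.\<close>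
    then have *: "t powr (\<alpha> - 1) * (b r * t + a r * t powr (\<alpha> + 1)) / (b r + a r * t powr \<alpha>) = t powr \<alpha>"
      by (simp add: algebra_simps)
    have "\<epsilon>1 r i j + \<epsilon>1 r j i = f i r powr \<alpha> + f j r powr \<alpha> - t powr (\<alpha> - 1) *
        (a r * f i r powr (\<alpha> + 1) + a r * f j r powr (\<alpha> + 1) + b r * t) / (b r + a r * t powr \<alpha>)"
      by (simp add: \<epsilon>1_def t_def add.commute[of "f j r"] add_divide_distrib[symmetric] algebra_simps)
    also have "\<dots> = \<epsilon> r i j + t powr \<alpha> - t powr (\<alpha> - 1) * (b r * t + a r * t powr (\<alpha> + 1)) / (b r + a r * t powr \<alpha>)"
      by (simp add: \<epsilon>_def t_def[symmetric] diff_divide_distrib[symmetric] add_divide_distrib[symmetric] algebra_simps)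
    finally show ?thesis unfolding * by simp
  qed
  have e1_sym: "e1 i j + e1 j i = e i j" if "i < n" "j < n" for i j
  proof -
    have "has_bochner_integral m (\<lambda>r. \<epsilon>1 r i j + \<epsilon>1 r j i) (e1 i j + e1 j i)"
      using that by (intro has_bochner_integral_add e1)
    then show ?thesis using e[OF that] \<epsilon>1_sym[OF that] by (simp add: has_bochner_integral_iff)
  qed
  \<comment> \<open>The mean of a product of exponentials is the product of the means times exp (k i
    j). The means can thus be moved into the coefficients, which is the reason for
    \<open>d\<close>.\<close>
  have Lij: "exp (- \<psi> (\<lambda>r. f i r + f j r)) = exp (- \<psi> (f i)) * exp (- \<psi> (f j)) * exp (k i j)" if "i < n" "j < n" for i j
    unfolding k(2)[OF that] by (simp flip: exp_add)
  have prod: "exp (- pairing \<eta> (f i)) * exp (- pairing \<eta> (f j)) = exp (- pairing \<eta> (\<lambda>r. f i r + f j r))"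
    if "\<eta> \<in> fin_measures" "i < n" "j < n" for \<eta> i j
    using Cf(1)[OF that(2)] Cf(1)[OF that(3)] that(1) by (simp add: pairing_add[OF E] flip: exp_add)
  have sq: "has_bochner_integral Q (\<lambda>\<eta>. (\<Psi> \<eta>)\<^sup>2) (qform n d (\<lambda>i j. exp (k i j)))"
  proof -
    have "has_bochner_integral Q (\<lambda>\<eta>. qform n c (\<lambda>i j. exp (- pairing \<eta> (\<lambda>r. f i r + f j r))))
       (qform n c (\<lambda>i j. exp (- \<psi> (\<lambda>r. f i r + f j r))))"
      by (intro has_bochner_integral_qform lap s)
    also have "?this \<longleftrightarrow> has_bochner_integral Q (\<lambda>\<eta>. (\<Psi> \<eta>)\<^sup>2) (qform n c (\<lambda>i j. exp (- \<psi> (\<lambda>r. f i r + f j r))))"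
    proof (rule has_bochner_integral_cong)
      fix \<eta> assume "\<eta> \<in> space Q"
      then have "\<eta> \<in> fin_measures" by (simp add: sp)
      then show "qform n c (\<lambda>i j. exp (- pairing \<eta> (\<lambda>r. f i r + f j r))) = (\<Psi> \<eta>)\<^sup>2"
        unfolding \<Psi>_def qform_square[symmetric] by (intro qform_cong) (simp only: prod)
    qed auto
    also have "qform n c (\<lambda>i j. exp (- \<psi> (\<lambda>r. f i r + f j r))) = qform n d (\<lambda>i j. exp (k i j))"
      unfolding d_def qform_scale[symmetric] by (intro qform_cong) (simp only: Lij)
    finally show ?thesis .
  qed
  have mean: "has_bochner_integral Q \<Psi> (\<Sum>i<n. d i)"
    unfolding \<Psi>_def d_def by (intro has_bochner_integral_sum has_bochner_integral_mult_right lap f) auto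
  have var: "prob_space.variance Q \<Psi> = qform n d (\<lambda>i j. exp (k i j) - 1)"
  proof -
    have "prob_space.variance Q \<Psi> = qform n d (\<lambda>i j. exp (k i j)) - (\<Sum>i<n. d i)\<^sup>2"
      using mean sq by (subst Q.variance_eq) (auto simp: has_bochner_integral_iff)
    also have "(\<Sum>i<n. d i)\<^sup>2 = qform n d (\<lambda>i j. 1)"
      using qform_square[of n d "\<lambda>_. 1"] by simp
    finally show ?thesis by (simp add: qform_diff)
  qed
  have en: "(\<integral>\<eta>. - \<Theta> \<eta> * \<Psi> \<eta> \<partial>Q) = 1 / 2 * qform n d (\<lambda>i j. exp (k i j) * e i j)"
  proof -
    define g where "g i = (\<lambda>r. a r * f i r powr (\<alpha> + 1) + b r * f i r)" for i
    define M where "M i j = exp (- \<psi> (\<lambda>r. f i r + f j r)) * e1 i j" for i j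
    have g: "g i \<in> C_pp" if "i < n" for i
      unfolding g_def using C Cf[OF that]
      by (intro C_ppI E continuous_intros) (auto intro!: add_pos_pos mult_pos_pos)
    have "has_bochner_integral Q (\<lambda>\<eta>. pairing m (\<lambda>r. f i r powr \<alpha>) * exp (- pairing \<eta> (\<lambda>r. f i r + f j r))
         - 1 / \<alpha> * (pairing \<eta> (g i) * exp (- pairing \<eta> (\<lambda>r. f i r + f j r)))) (M i j)" if ij: "i < n" "j < n" for i j
    proof -
      let ?s = "\<lambda>r. f i r + f j r"
      have "has_bochner_integral Q (\<lambda>\<eta>. pairing m (\<lambda>r. f i r powr \<alpha>) * exp (- pairing \<eta> ?s)
         - 1 / \<alpha> * (pairing \<eta> (g i) * exp (- pairing \<eta> ?s)))
         (pairing m (\<lambda>r. f i r powr \<alpha>) * exp (- \<psi> ?s) -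
           1 / \<alpha> * (exp (- \<psi> ?s) * pairing m (\<lambda>r. \<alpha> * ?s r powr (\<alpha> - 1) * g i r / (b r + a r * ?s r powr \<alpha>))))"
        unfolding \<psi>_def
        by (intro has_bochner_integral_diff has_bochner_integral_mult_right lap[unfolded \<psi>_def] s ij
              has_bochner_integral_pairing_exp E \<alpha> ab m g Q Q_Laplace)
      also have "pairing m (\<lambda>r. \<alpha> * ?s r powr (\<alpha> - 1) * g i r / (b r + a r * ?s r powr \<alpha>))
         = \<alpha> * pairing m (\<lambda>r. ?s r powr (\<alpha> - 1) * g i r / (b r + a r * ?s r powr \<alpha>))"
        unfolding pairing_cmult[symmetric] by (simp add: mult_ac)
      also have "pairing m (\<lambda>r. f i r powr \<alpha>) * exp (- \<psi> ?s) - 1 / \<alpha> * (exp (- \<psi> ?s) *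
          (\<alpha> * pairing m (\<lambda>r. ?s r powr (\<alpha> - 1) * g i r / (b r + a r * ?s r powr \<alpha>)))) =
          exp (- \<psi> ?s) * (pairing m (\<lambda>r. f i r powr \<alpha>) - pairing m (\<lambda>r. ?s r powr (\<alpha> - 1) * g i r / (b r + a r * ?s r powr \<alpha>)))"
        using \<alpha> by (simp add: algebra_simps)
      also have "pairing m (\<lambda>r. f i r powr \<alpha>) - pairing m (\<lambda>r. ?s r powr (\<alpha> - 1) * g i r / (b r + a r * ?s r powr \<alpha>)) = e1 i j"
        unfolding e1_def \<epsilon>1_def pairing_def g_def using C Cf[OF ij(1)] Cf[OF ij(2)] C_ppD[OF s[OF ij]] nn
        by (intro Bochner_Integration.integral_diff[symmetric] integrable_continuous_fin_measures E m continuous_intros)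
           (auto intro!: less_imp_neq[THEN not_sym])
      finally show ?thesis by (simp add: M_def)
    qed
    then have "has_bochner_integral Q (\<lambda>\<eta>. qform n c (\<lambda>i j. pairing m (\<lambda>r. f i r powr \<alpha>) * exp (- pairing \<eta> (\<lambda>r. f i r + f j r))
         - 1 / \<alpha> * (pairing \<eta> (g i) * exp (- pairing \<eta> (\<lambda>r. f i r + f j r))))) (qform n c M)"
      by (rule has_bochner_integral_qform)
    also have "?this \<longleftrightarrow> has_bochner_integral Q (\<lambda>\<eta>. - \<Theta> \<eta> * \<Psi> \<eta>) (qform n c M)"
    proof (rule has_bochner_integral_cong)
      fix \<eta> assume "\<eta> \<in> space Q"
      then have \<eta>: "\<eta> \<in> fin_measures" by (simp add: sp)
      have "- \<Theta> \<eta> * \<Psi> \<eta> = qform n c (\<lambda>i j. - exp_generator \<alpha> a b m (f i) \<eta> * exp (- pairing \<eta> (f j)))"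
        unfolding \<Theta>_def \<Psi>_def qform_def minus_mult_left[symmetric] sum_product sum_negf[symmetric]
        by (intro sum.cong) (auto simp: mult_ac)
      also have "\<dots> = qform n c (\<lambda>i j. pairing m (\<lambda>r. f i r powr \<alpha>) * exp (- pairing \<eta> (\<lambda>r. f i r + f j r))
         - 1 / \<alpha> * (pairing \<eta> (g i) * exp (- pairing \<eta> (\<lambda>r. f i r + f j r))))"
        by (intro qform_cong) (simp add: prod[OF \<eta>, symmetric] exp_generator_def g_def algebra_simps)
      finally show "qform n c (\<lambda>i j. pairing m (\<lambda>r. f i r powr \<alpha>) * exp (- pairing \<eta> (\<lambda>r. f i r + f j r))
         - 1 / \<alpha> * (pairing \<eta> (g i) * exp (- pairing \<eta> (\<lambda>r. f i r + f j r)))) = - \<Theta> \<eta> * \<Psi> \<eta>" by simp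
    qed auto
    finally have "(\<integral>\<eta>. - \<Theta> \<eta> * \<Psi> \<eta> \<partial>Q) = qform n c M" by (simp add: has_bochner_integral_iff)
    \<comment> \<open>Averaging with the transpose leaves the form unchanged. The factor 1/2
      produced here later turns \<gamma> / 2 into \<gamma>.\<close>
    also have "\<dots> = 1 / 2 * (qform n c M + qform n c (\<lambda>i j. M j i))" unfolding qform_sym[of n c M] by simp
    also have "qform n c M + qform n c (\<lambda>i j. M j i) = qform n d (\<lambda>i j. exp (k i j) * e i j)"
      unfolding d_def qform_scale[symmetric] qform_add[symmetric]
      by (intro qform_cong)
         (simp add: M_def add.commute[of "f _ _" "f _ _"] Lij[symmetric] e1_sym[symmetric] distrib_left mult.assoc[symmetric])
    finally show ?thesis .
  qed
  have r: "schur_multiplier n (K r)" for r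
    unfolding K_def by (rule scaled_one_dim_qform[OF L \<alpha> \<gamma> one_dim pw C(2) C(6) order_refl])
  have schur: "schur_multiplier n k"
    by (rule schur_multiplier_integral[where k = K, OF k(1) r])
  have psdM: "psd n (\<lambda>i j. \<gamma> / 2 * S * e i j - k i j)"
  proof (rule psd_integral)
    show "AE r in m. psd n (\<lambda>i j. \<gamma> / 2 * S * \<epsilon> r i j - K r i j)"
      using S by eventually_elim (unfold \<epsilon>_def K_def, rule scaled_one_dim_qform(2)[OF L \<alpha> \<gamma> one_dim pw C(2) C(6)])
  qed (intro has_bochner_integral_diff has_bochner_integral_mult_right e k(1))
  have "qform n d (\<lambda>i j. exp (k i j) - 1) \<le> qform n d (\<lambda>i j. exp (k i j) * k i j)"
  proof -
    have "0 \<le> qform n d (\<lambda>i j. exp (k i j) * k i j - exp (k i j) + 1)"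
      using psd_exp_poincare[OF schur] by (simp only: psd_def)
    also have "\<dots> = qform n d (\<lambda>i j. exp (k i j) * k i j) - qform n d (\<lambda>i j. exp (k i j) - 1)"
      unfolding qform_diff[symmetric] by (simp add: algebra_simps)
    finally show ?thesis by simp
  qed
  also have "\<dots> \<le> \<gamma> / 2 * S * qform n d (\<lambda>i j. exp (k i j) * e i j)"
  proof -
    have "0 \<le> qform n d (\<lambda>i j. (\<gamma> / 2 * S * e i j - k i j) * exp (k i j))"
      using psd_mult_exp[OF schur psdM] by (simp only: psd_def)
    also have "\<dots> = \<gamma> / 2 * S * qform n d (\<lambda>i j. exp (k i j) * e i j) - qform n d (\<lambda>i j. exp (k i j) * k i j)"
      unfolding qform_diff[symmetric] qform_cmult[symmetric] by (simp add: algebra_simps)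
    finally show ?thesis by simp
  qed
  also have "\<dots> = \<gamma> * S * (\<integral>\<eta>. - \<Theta> \<eta> * \<Psi> \<eta> \<partial>Q)" unfolding en by simp
  finally have "prob_space.variance Q \<Psi> \<le> \<gamma> * S * (\<integral>\<eta>. - \<Theta> \<eta> * \<Psi> \<eta> \<partial>Q)" unfolding var .
  then show ?thesis unfolding \<Psi>_def \<Theta>_def .
qed

section \<open>Increments of functions on the orthant\<close>

lemma mean_value_nonneg:
  fixes F :: "real \<Rightarrow> real"
  assumes F: "\<And>t. 0 \<le> t \<Longrightarrow> (F has_real_derivative F' t) (at t within {0..})"
    and st: "0 \<le> s" "0 \<le> t"
  obtains \<xi> where "min s t \<le> \<xi>" "\<xi> \<le> max s t" "F t - F s = (t - s) * F' \<xi>"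
proof -
  have mvt: "\<exists>\<xi>. x \<le> \<xi> \<and> \<xi> \<le> y \<and> F y - F x = (y - x) * F' \<xi>" if "0 \<le> x" "x < y" for x y
  proof -
    have "\<exists>\<xi>\<in>{x<..<y}. F y - F x = (y - x) * F' \<xi>"
    proof (rule mvt_simple[where f' = "\<lambda>\<xi> h. h * F' \<xi>", OF that(2)])
      fix u assume "x \<le> u" "u \<le> y"
      then have "(F has_derivative (*) (F' u)) (at u within {0..})"
        using F[of u] that by (simp add: has_field_derivative_def)
      then show "(F has_derivative (\<lambda>h. h * F' u)) (at u within {x..y})"
        using that unfolding mult.commute[of _ "F' u"] by (rule_tac has_derivative_subset) auto
    qed
    then show ?thesis by (meson greaterThanLessThan_iff less_imp_le)
  qed
  consider "s < t" | "s = t" | "t < s" by linarith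
  then show ?thesis
  proof cases
    case 1
    then show ?thesis using mvt[of s t] st that by (auto simp: min_def max_def)
  next
    case 2
    then show ?thesis using that[of s] by simp
  next
    case 3
    then obtain \<xi> where "t \<le> \<xi>" "\<xi> \<le> s" "F s - F t = (s - t) * F' \<xi>" using mvt[of t s] st by auto
    then show ?thesis using 3 that[of \<xi>] by (auto simp: algebra_simps)
  qed
qed

lemma orthant_upd: "x \<in> orthant n \<Longrightarrow> i < n \<Longrightarrow> 0 \<le> t \<Longrightarrow> x(i := t) \<in> orthant n"
  by (auto simp: orthant_def)

lemma orthant_add: "x \<in> orthant n \<Longrightarrow> v \<in> orthant n \<Longrightarrow> 0 \<le> z \<Longrightarrow> (\<lambda>i. x i + z * v i) \<in> orthant n"
  by (auto simp: orthant_def)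

definition partial_on_orthant :: "nat \<Rightarrow> ((nat \<Rightarrow> real) \<Rightarrow> real) \<Rightarrow> (nat \<Rightarrow> (nat \<Rightarrow> real) \<Rightarrow> real) \<Rightarrow> bool" where
  "partial_on_orthant n \<phi> g \<longleftrightarrow> (\<forall>i<n. \<forall>x\<in>orthant n.
     ((\<lambda>t. \<phi> (x(i := t))) has_real_derivative g i x) (at (x i) within {0..}))"

text \<open>The increment is telescoped along the coordinates, changing one coordinate at a time.\<close>

lemma orthant_mean_value:
  assumes \<phi>: "partial_on_orthant n \<phi> g" and y: "y \<in> orthant n" "y' \<in> orthant n"
  obtains \<xi> where "\<And>k. k < n \<Longrightarrow> \<xi> k \<in> orthant n"
    "\<And>k i. k < n \<Longrightarrow> min (y i) (y' i) \<le> \<xi> k i \<and> \<xi> k i \<le> max (y i) (y' i)"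
    "\<phi> y' - \<phi> y = (\<Sum>k<n. (y' k - y k) * g k (\<xi> k))"
proof -
  define mix where "mix k = (\<lambda>i. if i < k then y' i else y i)" for k :: nat
  have mix: "mix k \<in> orthant n" for k using y by (auto simp: mix_def orthant_def)
  have "\<exists>\<xi>. \<xi> \<in> orthant n \<and> (\<forall>i. min (y i) (y' i) \<le> \<xi> i \<and> \<xi> i \<le> max (y i) (y' i)) \<and>
      \<phi> (mix (Suc k)) - \<phi> (mix k) = (y' k - y k) * g k \<xi>" if k: "k < n" for k
  proof -
    have D: "((\<lambda>t. \<phi> ((mix k)(k := t))) has_real_derivative g k ((mix k)(k := t))) (at t within {0..})" if "0 \<le> t" for t
      using \<phi>[unfolded partial_on_orthant_def, rule_format, OF k orthant_upd[OF mix k that]] by simp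
    have nn: "0 \<le> y k" "0 \<le> y' k" using y k by (auto simp: orthant_def)
    obtain s where s: "min (y k) (y' k) \<le> s" "s \<le> max (y k) (y' k)"
      "\<phi> ((mix k)(k := y' k)) - \<phi> ((mix k)(k := y k)) = (y' k - y k) * g k ((mix k)(k := s))"
      by (rule mean_value_nonneg[OF D nn])
    have "(mix k)(k := y' k) = mix (Suc k)" "(mix k)(k := y k) = mix k" by (auto simp: mix_def fun_eq_iff)
    moreover have "0 \<le> s" using s(1) nn by linarith
    ultimately show ?thesis
      using s by (intro exI[of _ "(mix k)(k := s)"]) (auto simp: mix_def intro!: orthant_upd[OF mix k, unfolded mix_def])
  qed
  then obtain \<xi> where \<xi>: "\<And>k. k < n \<Longrightarrow> \<xi> k \<in> orthant n"
    "\<And>k i. k < n \<Longrightarrow> min (y i) (y' i) \<le> \<xi> k i \<and> \<xi> k i \<le> max (y i) (y' i)"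
    "\<And>k. k < n \<Longrightarrow> \<phi> (mix (Suc k)) - \<phi> (mix k) = (y' k - y k) * g k (\<xi> k)"
    by metis
  have "mix 0 = y" "mix n = y'" using y by (auto simp: mix_def orthant_def fun_eq_iff)
  then have "\<phi> y' - \<phi> y = (\<Sum>k<n. \<phi> (mix (Suc k)) - \<phi> (mix k))"
    using sum_lessThan_telescope[of "\<lambda>k. \<phi> (mix k)" n] by simp
  also have "\<dots> = (\<Sum>k<n. (y' k - y k) * g k (\<xi> k))" by (intro sum.cong) (auto simp: \<xi>(3))
  finally show ?thesis using that \<xi>(1,2) by blast
qed

lemma orthant_lipschitz:
  assumes \<phi>: "partial_on_orthant n \<phi> g" and B: "\<And>k x. k < n \<Longrightarrow> x \<in> orthant n \<Longrightarrow> \<bar>g k x\<bar> \<le> B"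
    and y: "y \<in> orthant n" "y' \<in> orthant n"
  shows "\<bar>\<phi> y' - \<phi> y\<bar> \<le> B * (\<Sum>k<n. \<bar>y' k - y k\<bar>)"
proof -
  obtain \<xi> where \<xi>: "\<And>k. k < n \<Longrightarrow> \<xi> k \<in> orthant n"
    "\<And>k i. k < n \<Longrightarrow> min (y i) (y' i) \<le> \<xi> k i \<and> \<xi> k i \<le> max (y i) (y' i)"
    "\<phi> y' - \<phi> y = (\<Sum>k<n. (y' k - y k) * g k (\<xi> k))"
    by (rule orthant_mean_value[OF \<phi> y]) blast
  have "\<bar>\<phi> y' - \<phi> y\<bar> \<le> (\<Sum>k<n. \<bar>(y' k - y k) * g k (\<xi> k)\<bar>)" unfolding \<xi>(3) by (rule sum_abs)
  also have "\<dots> \<le> (\<Sum>k<n. B * \<bar>y' k - y k\<bar>)"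
    using B \<xi>(1) by (intro sum_mono) (auto simp: abs_mult mult.commute[of B] intro!: mult_left_mono)
  finally show ?thesis by (simp add: sum_distrib_left)
qed

text \<open>The mean value theorem is applied twice: to \<phi>, then to each first derivative
  between \<open>x\<close> and the intermediate point. Because v lies in the orthant, that point
  differs from \<open>x\<close> by at most z v in each coordinate, whence a quadratic bound.\<close>

lemma orthant_taylor:
  assumes \<phi>: "partial_on_orthant n \<phi> g" and g: "\<And>k. k < n \<Longrightarrow> partial_on_orthant n (g k) (h k)"
    and B: "\<And>k j x. k < n \<Longrightarrow> j < n \<Longrightarrow> x \<in> orthant n \<Longrightarrow> \<bar>h k j x\<bar> \<le> B" "0 \<le> B"
    and x: "x \<in> orthant n" "v \<in> orthant n" "0 \<le> z"
  shows "\<bar>\<phi> (\<lambda>i. x i + z * v i) - \<phi> x - z * (\<Sum>k<n. v k * g k x)\<bar> \<le> B * (z * (\<Sum>k<n. v k))\<^sup>2"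
proof -
  let ?y = "\<lambda>i. x i + z * v i"
  have v: "0 \<le> v k" for k using x(2) by (cases "k < n") (auto simp: orthant_def)
  obtain \<xi> where \<xi>: "\<And>k. k < n \<Longrightarrow> \<xi> k \<in> orthant n"
    "\<And>k i. k < n \<Longrightarrow> min (x i) (?y i) \<le> \<xi> k i \<and> \<xi> k i \<le> max (x i) (?y i)"
    "\<phi> ?y - \<phi> x = (\<Sum>k<n. (?y k - x k) * g k (\<xi> k))"
    by (rule orthant_mean_value[OF \<phi> x(1) orthant_add[OF x]]) blast
  have diff: "\<bar>g k (\<xi> k) - g k x\<bar> \<le> B * (z * (\<Sum>j<n. v j))" if k: "k < n" for k
  proof -
    have "\<bar>g k (\<xi> k) - g k x\<bar> \<le> B * (\<Sum>j<n. \<bar>\<xi> k j - x j\<bar>)"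
      by (rule orthant_lipschitz[OF g[OF k] B(1)[OF k] x(1) \<xi>(1)[OF k]])
    also have "\<dots> \<le> B * (\<Sum>j<n. z * v j)"
    proof (intro mult_left_mono sum_mono B(2))
      fix j
      have "0 \<le> z * v j" using v x(3) by simp
      then show "\<bar>\<xi> k j - x j\<bar> \<le> z * v j" using \<xi>(2)[OF k, of j] by (auto simp: min_def max_def split: if_splits)
    qed
    finally show ?thesis by (simp add: sum_distrib_left)
  qed
  have "\<phi> ?y - \<phi> x - z * (\<Sum>k<n. v k * g k x) = (\<Sum>k<n. z * v k * (g k (\<xi> k) - g k x))"
    unfolding \<xi>(3) by (simp add: sum_distrib_left right_diff_distrib sum_subtractf mult.assoc)
  also have "\<bar>\<dots>\<bar> \<le> (\<Sum>k<n. \<bar>z * v k * (g k (\<xi> k) - g k x)\<bar>)" by (rule sum_abs)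
  also have "\<dots> \<le> (\<Sum>k<n. z * v k * (B * (z * (\<Sum>j<n. v j))))"
    using v x(3) diff by (intro sum_mono) (auto simp: abs_mult intro!: mult_left_mono)
  also have "\<dots> = B * (z * (\<Sum>k<n. v k))\<^sup>2"
    by (simp add: sum_distrib_right[symmetric] sum_distrib_left[symmetric] power2_eq_square mult_ac)
  finally show ?thesis .
qed

section \<open>Supports and boundedness on the orthant\<close>

lemma closed_orthant: "closed (orthant n)"
proof -
  have "closed {x :: nat \<Rightarrow> real. 0 \<le> x i}" "closed {x :: nat \<Rightarrow> real. x i = 0}" for i
    by (intro closed_Collect_le closed_Collect_eq continuous_intros continuous_on_product_coordinates)+
  then have "closed ((\<Inter>i\<in>{..<n}. {x :: nat \<Rightarrow> real. 0 \<le> x i}) \<inter> (\<Inter>i\<in>{n..}. {x. x i = 0}))"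
    by (intro closed_Int closed_INT) auto
  also have "(\<Inter>i\<in>{..<n}. {x :: nat \<Rightarrow> real. 0 \<le> x i}) \<inter> (\<Inter>i\<in>{n..}. {x. x i = 0}) = orthant n"
    by (auto simp: orthant_def)
  finally show ?thesis .
qed

text \<open>Outside a closed set the function vanishes near the point along the coordinate line. On
  the boundary of the orthant only the right half of that line is available, so uniqueness of the
  derivative is taken from the right in all cases.\<close>

lemma partial_zero_off_support:
  assumes F: "\<And>x. x \<in> orthant n - S \<Longrightarrow> F x = 0" and S: "closed S"
    and G: "partial_on_orthant n F G" and x: "x \<in> orthant n - S" and i: "i < n"
  shows "G i x = 0"
proof -
  have "continuous_on UNIV (\<lambda>t::real. x(i := t))"
  proof (rule continuous_on_coordinatewise_then_product)
    show "continuous_on UNIV (\<lambda>t. (x(i := t)) j)" for j by (cases "j = i") auto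
  qed
  then have "open ((\<lambda>t. x(i := t)) -` (- S))" using S by (intro open_vimage) auto
  moreover have "x i \<in> (\<lambda>t. x(i := t)) -` (- S)" using x by auto
  ultimately obtain d where d: "0 < d" "\<And>t. dist t (x i) < d \<Longrightarrow> x(i := t) \<notin> S"
    by (auto simp: open_dist)
  have xi: "x i \<in> {0..}" using x i by (auto simp: orthant_def)
  have "((\<lambda>t. F (x(i := t))) has_real_derivative G i x) (at (x i) within {0..})"
    using G x i by (auto simp: partial_on_orthant_def)
  moreover have "((\<lambda>t. F (x(i := t))) has_real_derivative 0) (at (x i) within {0..})"
    by (rule has_field_derivative_transform_within[OF DERIV_const[of 0] d(1) xi])
       (use d(2) F x i orthant_upd in auto)
  moreover have "{x i<..} \<subseteq> {0..}" using xi by auto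
  ultimately have "((\<lambda>t. F (x(i := t))) has_real_derivative G i x) (at_right (x i))"
    "((\<lambda>t. F (x(i := t))) has_real_derivative 0) (at_right (x i))"
    by (blast intro: DERIV_subset)+
  then show ?thesis
    unfolding has_field_derivative_iff by (rule tendsto_unique[OF trivial_limit_at_right_real])
qed

lemma continuous_bounded_off_support:
  assumes G: "continuous_on (orthant n) G" and S: "compact S" and z: "\<And>x. x \<in> orthant n - S \<Longrightarrow> G x = (0::real)"
  obtains B where "0 \<le> B" "\<And>x. x \<in> orthant n \<Longrightarrow> \<bar>G x\<bar> \<le> B"
proof -
  have "compact (G ` (orthant n \<inter> S))"
    using G S by (intro compact_continuous_image closed_Int_compact closed_orthant) (auto intro: continuous_on_subset)
  then obtain B where B: "0 < B" "\<forall>y\<in>G ` (orthant n \<inter> S). norm y \<le> B"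
    using compact_imp_bounded bounded_pos by blast
  show ?thesis
  proof (rule that[of B])
    fix x assume "x \<in> orthant n"
    then show "\<bar>G x\<bar> \<le> B" using B z[of x] by (cases "x \<in> S") auto
  qed (use B in simp)
qed

text \<open>Continuity in \<open>(z, r)\<close> alone would not do: as \<open>'a\<close> need not have a countable base as far as its type
  class tells, the product of the Borel algebras may be smaller than the Borel algebra of the product.
  Hence \<open>z\<close> is discretised.\<close>

lemma measurable_caratheodory:
  fixes k :: "real \<Rightarrow> 'a \<Rightarrow> real"
  assumes cont: "\<And>r. continuous_on UNIV (\<lambda>z. k z r)"
    and meas: "\<And>z. k z \<in> borel_measurable N" and M: "sets M = sets borel"
  shows "(\<lambda>(z, r). k z r) \<in> borel_measurable (M \<Otimes>\<^sub>M N)"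
proof -
  have [measurable_cong]: "sets M = sets borel" by fact
  define s where "s i z = of_int \<lfloor>z * real (Suc i)\<rfloor> / real (Suc i)" for i z
  have s: "(\<lambda>i. s i z) \<longlonglongrightarrow> z" for z
  proof (rule tendsto_sandwich[where f = "\<lambda>i. z - inverse (real (Suc i))" and h = "\<lambda>_. z"])
    show "(\<lambda>i. z - inverse (real (Suc i))) \<longlonglongrightarrow> z"
      using tendsto_diff[OF tendsto_const LIMSEQ_inverse_real_of_nat, of z] by simp
    have b: "z - inverse (real (Suc i)) \<le> s i z \<and> s i z \<le> z" for i
    proof -
      have "z * real (Suc i) - 1 \<le> of_int \<lfloor>z * real (Suc i)\<rfloor>" "of_int \<lfloor>z * real (Suc i)\<rfloor> \<le> z * real (Suc i)"
        by linarith+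
      then have "(z * real (Suc i) - 1) / real (Suc i) \<le> s i z" "s i z \<le> z * real (Suc i) / real (Suc i)"
        unfolding s_def by (intro divide_right_mono; simp)+
      then show ?thesis by (simp add: diff_divide_distrib inverse_eq_divide del: of_nat_Suc)
    qed
    show "eventually (\<lambda>i. z - inverse (real (Suc i)) \<le> s i z) sequentially"
      "eventually (\<lambda>i. s i z \<le> z) sequentially" using b by auto
  qed simp
  have lim: "(\<lambda>i. (\<lambda>(z, r). k (s i z) r) x) \<longlonglongrightarrow> (\<lambda>(z, r). k z r) x" for x
  proof -
    obtain z r where x: "x = (z, r)" by force
    have "isCont (\<lambda>z. k z r) z" using cont[of r] by (simp add: continuous_on_eq_continuous_at)
    then show ?thesis unfolding x using isCont_tendsto_compose[of z "\<lambda>z. k z r" "\<lambda>i. s i z" sequentially] s[of z] by simp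
  qed
  have "(\<lambda>(z, r). k (s i z) r) \<in> borel_measurable (M \<Otimes>\<^sub>M N)" for i
  proof -
    have "(\<lambda>x. (\<lambda>j x. k (of_int j / real (Suc i)) (snd x)) \<lfloor>fst x * real (Suc i)\<rfloor> x) \<in> borel_measurable (M \<Otimes>\<^sub>M N)"
    proof (rule measurable_compose_countable[where f = "\<lambda>j x. k (of_int j / real (Suc i)) (snd x)"
          and g = "\<lambda>x. \<lfloor>fst x * real (Suc i)\<rfloor>"])
      show "(\<lambda>x. k (of_int j / real (Suc i)) (snd x)) \<in> borel_measurable (M \<Otimes>\<^sub>M N)" for j :: int
        using meas by (rule measurable_compose[OF measurable_snd])
      show "(\<lambda>x. \<lfloor>fst x * real (Suc i)\<rfloor>) \<in> measurable (M \<Otimes>\<^sub>M N) (count_space UNIV)"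
        by measurable
    qed
    then show ?thesis by (simp add: s_def split_beta')
  qed
  then show ?thesis
    by (rule borel_measurable_LIMSEQ_real[where u = "\<lambda>i. \<lambda>(z, r). k (s i z) r", OF lim])
qed

text \<open>\<open>L_op\<close> integrates over r first and z last, whereas explicit evaluation and
  continuity in \<eta> need the z-integral inside. The majorant depends on z alone and \<eta> is
  finite, so \<open>w\<close> times the total mass is an integrable bound for Fubini.\<close>

lemma jump_integral_interchange:
  fixes k :: "real \<Rightarrow> 'a::topological_space \<Rightarrow> real"
  assumes M: "sigma_finite_measure M" "sets M = sets borel" "AE z in M. 0 < z"
    and w: "integrable M w" and \<eta>: "\<eta> \<in> fin_measures"
    and cont: "\<And>r. continuous_on UNIV (\<lambda>z. k z r)" and meas: "\<And>z. k z \<in> borel_measurable borel"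
    and bound: "\<And>z r. 0 < z \<Longrightarrow> \<bar>k z r\<bar> \<le> w z"
  shows "(\<integral>z. (\<integral>r. k z r \<partial>\<eta>) \<partial>M) = (\<integral>r. (\<integral>z. k z r \<partial>M) \<partial>\<eta>)"
    and "integrable \<eta> (\<lambda>r. \<integral>z. k z r \<partial>M)"
    and "integrable M (\<lambda>z. k z r)"
proof -
  interpret M: sigma_finite_measure M by fact
  interpret \<eta>: finite_measure \<eta> using \<eta> by (rule fin_measuresD)
  interpret pair_sigma_finite M \<eta> ..
  note [measurable_cong] = M(2) fin_measuresD(1)[OF \<eta>]
  have m[measurable]: "(\<lambda>(z, r). k z r) \<in> borel_measurable (M \<Otimes>\<^sub>M \<eta>)"
    using meas fin_measuresD(1)[OF \<eta>] by (intro measurable_caratheodory cont M(2)) (simp cong: measurable_cong_sets)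
  have [measurable]: "(\<lambda>z. k z r) \<in> borel_measurable M" for r
    using borel_measurable_continuous_onI[OF cont] M(2) by (simp cong: measurable_cong_sets)
  have [measurable]: "k z \<in> borel_measurable \<eta>" for z
    using meas fin_measuresD(1)[OF \<eta>] by (simp cong: measurable_cong_sets)
  show "integrable M (\<lambda>z. k z r)" for r
    using M(3) bound by (intro Bochner_Integration.integrable_bound[OF w]) (auto elim!: eventually_mono intro: order_trans[OF bound abs_ge_self])
  have int\<eta>: "integrable \<eta> (k z)" if "0 < z" for z
    by (rule \<eta>.integrable_const_bound[where B = "w z"]) (use bound that in auto)
  have pair: "integrable (M \<Otimes>\<^sub>M \<eta>) (\<lambda>(z, r). k z r)"
  proof (rule Fubini_integrable[OF m])
    show "AE z in M. integrable \<eta> (\<lambda>r. (\<lambda>(z, r). k z r) (z, r))"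
      using M(3) by eventually_elim (use int\<eta> in simp)
    show "integrable M (\<lambda>z. \<integral>r. norm ((\<lambda>(z, r). k z r) (z, r)) \<partial>\<eta>)"
    proof (rule Bochner_Integration.integrable_bound)
      show "integrable M (\<lambda>z. w z * measure \<eta> (space \<eta>))" using w by simp
      show "AE z in M. norm (\<integral>r. norm ((\<lambda>(z, r). k z r) (z, r)) \<partial>\<eta>) \<le> norm (w z * measure \<eta> (space \<eta>))"
        using M(3)
      proof eventually_elim
        case (elim z)
        have "0 \<le> w z" using bound[OF elim] abs_ge_zero order_trans by blast
        have "(\<integral>r. \<bar>k z r\<bar> \<partial>\<eta>) \<le> (\<integral>r. w z \<partial>\<eta>)"
          using int\<eta>[OF elim] bound[OF elim] by (intro integral_mono) auto
        then show ?case using \<open>0 \<le> w z\<close> by (simp add: mult.commute)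
      qed
    qed measurable
  qed
  show "(\<integral>z. (\<integral>r. k z r \<partial>\<eta>) \<partial>M) = (\<integral>r. (\<integral>z. k z r \<partial>M) \<partial>\<eta>)"
    using Fubini_integral[OF pair] by simp
  show "integrable \<eta> (\<lambda>r. \<integral>z. k z r \<partial>M)" using integrable_snd[OF pair] by simp
qed

text \<open>In a first countable space continuity can be tested on sequences, which is what
  dominated convergence handles. The parameter will be a point of the orthant, alone or paired with
  a point of the metric space E.\<close>

lemma continuous_on_integral_dominated:
  fixes k :: "'c::{first_countable_topology, t2_space} \<Rightarrow> 'b \<Rightarrow> real"
  assumes w: "integrable M w" and cont: "AE z in M. continuous_on P (\<lambda>p. k p z)"
    and meas: "\<And>p. p \<in> P \<Longrightarrow> k p \<in> borel_measurable M"
    and bound: "AE z in M. \<forall>p\<in>P. \<bar>k p z\<bar> \<le> w z"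
  shows "continuous_on P (\<lambda>p. \<integral>z. k p z \<partial>M)"
proof (rule continuous_on_sequentiallyI)
  fix u a assume u: "\<forall>n. u n \<in> P" "a \<in> P" "u \<longlonglongrightarrow> a"
  show "(\<lambda>n. \<integral>z. k (u n) z \<partial>M) \<longlonglongrightarrow> (\<integral>z. k a z \<partial>M)"
  proof (rule integral_dominated_convergence[where w = w])
    show "AE z in M. (\<lambda>n. k (u n) z) \<longlonglongrightarrow> k a z"
      using cont by eventually_elim (use u in \<open>auto simp: continuous_on_sequentially comp_def\<close>)
    show "AE z in M. norm (k (u n) z) \<le> w z" for n
      using bound by eventually_elim (use u in auto)
  qed (use u meas w in auto)
qed

section \<open>The operator on cylinder functions\<close>

text \<open>The data extracted from a cylinder function \<open>\<phi>(\<langle>\<eta>, f\<^sub>1\<rangle>, \<dots>)\<close>: a first order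
  and a second order increment bound are all that is needed about \<open>\<phi>\<close>.\<close>

definition taylor_bounded ::
    "nat \<Rightarrow> ((nat \<Rightarrow> real) \<Rightarrow> real) \<Rightarrow> (nat \<Rightarrow> (nat \<Rightarrow> real) \<Rightarrow> real) \<Rightarrow> real \<Rightarrow> bool" where
  "taylor_bounded n \<phi> g B \<longleftrightarrow> 0 \<le> B \<and> continuous_on (orthant n) \<phi> \<and> (\<forall>k<n. continuous_on (orthant n) (g k)) \<and>
     (\<forall>x\<in>orthant n. \<bar>\<phi> x\<bar> \<le> B \<and> (\<forall>k<n. \<bar>g k x\<bar> \<le> B) \<and> (\<forall>v\<in>orthant n. \<forall>z\<ge>0.
       \<bar>\<phi> (\<lambda>i. x i + z * v i) - \<phi> x\<bar> \<le> B * (z * (\<Sum>k<n. v k)) \<and>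
       \<bar>\<phi> (\<lambda>i. x i + z * v i) - \<phi> x - z * (\<Sum>k<n. v k * g k x)\<bar> \<le> B * (z * (\<Sum>k<n. v k))\<^sup>2))"

definition coords :: "nat \<Rightarrow> (nat \<Rightarrow> 'a \<Rightarrow> real) \<Rightarrow> 'a \<Rightarrow> nat \<Rightarrow> real" where
  "coords n f r = (\<lambda>i. if i < n then f i r else 0)"

definition pairings :: "nat \<Rightarrow> (nat \<Rightarrow> 'a \<Rightarrow> real) \<Rightarrow> 'a measure \<Rightarrow> nat \<Rightarrow> real" where
  "pairings n f \<eta> = (\<lambda>i. if i < n then pairing \<eta> (f i) else 0)"

text \<open>The cutoff \<open>max 0 z\<close> mirrors \<open>add_atom\<close>, so the first term is
  correct and continuous for every real z. The linear term stays uncut, since \<open>n_B\<close>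
  lives on z > 0.\<close>

definition jump_B :: "nat \<Rightarrow> ((nat \<Rightarrow> real) \<Rightarrow> real) \<Rightarrow> (nat \<Rightarrow> (nat \<Rightarrow> real) \<Rightarrow> real) \<Rightarrow>
    (nat \<Rightarrow> real) \<Rightarrow> (nat \<Rightarrow> real) \<Rightarrow> real \<Rightarrow> real" where
  "jump_B n \<phi> g x v z = \<phi> (\<lambda>i. x i + max 0 z * v i) - \<phi> x - z * (\<Sum>k<n. v k * g k x)"

definition jump_I :: "((nat \<Rightarrow> real) \<Rightarrow> real) \<Rightarrow> (nat \<Rightarrow> real) \<Rightarrow> (nat \<Rightarrow> real) \<Rightarrow> real \<Rightarrow> real" where
  "jump_I \<phi> x v z = \<phi> (\<lambda>i. x i + max 0 z * v i) - \<phi> x"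

text \<open>First and second derivatives vanish off the support of \<phi>, which is compact, and are
  continuous, hence bounded. Second derivatives survive only through the constant \<open>B\<close>;
  the support \<open>S\<close> is kept in order to locate where the operator vanishes.\<close>

lemma F_class_data:
  assumes "\<Phi> \<in> F_class"
  obtains n \<phi> f g B S where "1 \<le> n" "\<And>i. i < n \<Longrightarrow> f i \<in> C_pp" "\<Phi> = (\<lambda>\<eta>. \<phi> (pairings n f \<eta>))"
    "taylor_bounded n \<phi> g B" "compact S"
    "\<And>x. x \<in> orthant n - S \<Longrightarrow> \<phi> x = 0" "\<And>k x. k < n \<Longrightarrow> x \<in> orthant n - S \<Longrightarrow> g k x = 0"
proof -
  obtain n \<phi> f where F: "1 \<le> n" "Ck_orthant 2 n \<phi>" "compact (closure {x \<in> orthant n. \<phi> x \<noteq> 0})" "\<forall>i<n. f i \<in> C_pp"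
     "\<Phi> = (\<lambda>\<eta>. \<phi> (\<lambda>i. if i < n then pairing \<eta> (f i) else 0))"
    using assms unfolding F_class_def by blast
  define S where "S = closure {x \<in> orthant n. \<phi> x \<noteq> 0}"
  have S: "compact S" "closed S" using F(3) by (auto simp: S_def)
  have \<phi>0: "\<phi> x = 0" if "x \<in> orthant n - S" for x
    using that closure_subset[of "{x \<in> orthant n. \<phi> x \<noteq> 0}"] by (auto simp: S_def)
  obtain g where g: "continuous_on (orthant n) \<phi>" "\<And>i. i < n \<Longrightarrow> Ck_orthant 1 n (g i)" "partial_on_orthant n \<phi> g"
  proof -
    have "Ck_orthant (Suc 1) n \<phi>" using F(2) by (simp only: numeral_2_eq_2 One_nat_def)
    then show ?thesis using that unfolding Ck_orthant.simps(2) partial_on_orthant_def by blast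
  qed
  have "\<forall>i. \<exists>h. i < n \<longrightarrow> continuous_on (orthant n) (g i) \<and> partial_on_orthant n (g i) h \<and> (\<forall>j<n. continuous_on (orthant n) (h j))"
  proof
    fix i
    show "\<exists>h. i < n \<longrightarrow> continuous_on (orthant n) (g i) \<and> partial_on_orthant n (g i) h \<and> (\<forall>j<n. continuous_on (orthant n) (h j))"
      using g(2)[of i] unfolding partial_on_orthant_def One_nat_def Ck_orthant.simps by blast
  qed
  then obtain h where h: "\<And>i. i < n \<Longrightarrow> continuous_on (orthant n) (g i)"
    "\<And>i. i < n \<Longrightarrow> partial_on_orthant n (g i) (h i)" "\<And>i j. i < n \<Longrightarrow> j < n \<Longrightarrow> continuous_on (orthant n) (h i j)"
    by metis
  have g0: "g i x = 0" if "i < n" "x \<in> orthant n - S" for i x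
    using partial_zero_off_support[OF \<phi>0 S(2) g(3)] that by blast
  have h0: "h i j x = 0" if "i < n" "j < n" "x \<in> orthant n - S" for i j x
    using partial_zero_off_support[OF g0 S(2) h(2)] that by blast
  obtain B0 where B0: "0 \<le> B0" "\<And>x. x \<in> orthant n \<Longrightarrow> \<bar>\<phi> x\<bar> \<le> B0"
    using continuous_bounded_off_support[OF g(1) S(1) \<phi>0] by blast
  have "\<forall>i. \<exists>B. i < n \<longrightarrow> 0 \<le> B \<and> (\<forall>x\<in>orthant n. \<bar>g i x\<bar> \<le> B)"
    using continuous_bounded_off_support[OF h(1) S(1) g0] by metis
  then obtain B1 where B1: "\<And>i. i < n \<Longrightarrow> 0 \<le> B1 i" "\<And>i x. i < n \<Longrightarrow> x \<in> orthant n \<Longrightarrow> \<bar>g i x\<bar> \<le> B1 i" by metis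
  have "\<forall>i j. \<exists>B. i < n \<and> j < n \<longrightarrow> 0 \<le> B \<and> (\<forall>x\<in>orthant n. \<bar>h i j x\<bar> \<le> B)"
    using continuous_bounded_off_support[OF h(3) S(1) h0] by metis
  then obtain B2 where B2: "\<And>i j. i < n \<Longrightarrow> j < n \<Longrightarrow> 0 \<le> B2 i j"
    "\<And>i j x. i < n \<Longrightarrow> j < n \<Longrightarrow> x \<in> orthant n \<Longrightarrow> \<bar>h i j x\<bar> \<le> B2 i j" by metis
  define B where "B = B0 + (\<Sum>i<n. B1 i) + (\<Sum>i<n. \<Sum>j<n. B2 i j)"
  have s1: "0 \<le> (\<Sum>i<n. B1 i)" "0 \<le> (\<Sum>i<n. \<Sum>j<n. B2 i j)" using B1 B2 by (auto intro!: sum_nonneg)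
  have b1: "B1 i \<le> (\<Sum>i<n. B1 i)" if "i < n" for i
    using that B1 by (intro member_le_sum) auto
  have b2: "B2 i j \<le> (\<Sum>i<n. \<Sum>j<n. B2 i j)" if "i < n" "j < n" for i j
  proof -
    have "B2 i j \<le> (\<Sum>j<n. B2 i j)" using that B2 by (intro member_le_sum) auto
    also have "\<dots> \<le> (\<Sum>i<n. \<Sum>j<n. B2 i j)"
      using that B2 by (intro member_le_sum[where f = "\<lambda>i. \<Sum>j<n. B2 i j"]) (auto intro!: sum_nonneg)
    finally show ?thesis .
  qed
  have B: "0 \<le> B" "\<And>x. x \<in> orthant n \<Longrightarrow> \<bar>\<phi> x\<bar> \<le> B"
    "\<And>i x. i < n \<Longrightarrow> x \<in> orthant n \<Longrightarrow> \<bar>g i x\<bar> \<le> B"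
    "\<And>i j x. i < n \<Longrightarrow> j < n \<Longrightarrow> x \<in> orthant n \<Longrightarrow> \<bar>h i j x\<bar> \<le> B"
  proof -
    show "0 \<le> B" using B0(1) s1 by (simp add: B_def)
    show "\<bar>\<phi> x\<bar> \<le> B" if "x \<in> orthant n" for x using B0(2)[OF that] s1 by (simp add: B_def)
    show "\<bar>g i x\<bar> \<le> B" if "i < n" "x \<in> orthant n" for i x
      using B1(2)[OF that] b1[OF that(1)] B0(1) s1(2) unfolding B_def by linarith
    show "\<bar>h i j x\<bar> \<le> B" if "i < n" "j < n" "x \<in> orthant n" for i j x
      using B2(2)[OF that] b2[OF that(1,2)] B0(1) s1(1) unfolding B_def by linarith
  qed
  have "taylor_bounded n \<phi> g B"
    unfolding taylor_bounded_def
  proof (intro conjI ballI allI impI)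
    fix x v z assume x: "x \<in> orthant n" "v \<in> orthant n" "0 \<le> (z::real)"
    have nn: "0 \<le> z * v k" if "k < n" for k using x that by (auto simp: orthant_def)
    have "\<bar>\<phi> (\<lambda>i. x i + z * v i) - \<phi> x\<bar> \<le> B * (\<Sum>k<n. \<bar>(x k + z * v k) - x k\<bar>)"
      by (rule orthant_lipschitz[OF g(3) B(3) x(1) orthant_add[OF x]])
    also have "(\<Sum>k<n. \<bar>(x k + z * v k) - x k\<bar>) = z * (\<Sum>k<n. v k)"
      unfolding sum_distrib_left using nn by (intro sum.cong) auto
    finally show "\<bar>\<phi> (\<lambda>i. x i + z * v i) - \<phi> x\<bar> \<le> B * (z * (\<Sum>k<n. v k))" .
    show "\<bar>\<phi> (\<lambda>i. x i + z * v i) - \<phi> x - z * (\<Sum>k<n. v k * g k x)\<bar> \<le> B * (z * (\<Sum>k<n. v k))\<^sup>2"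
      by (rule orthant_taylor[OF g(3) h(2) B(4,1) x])
  qed (use B g h in auto)
  show ?thesis
    by (rule that[OF F(1) _ _ \<open>taylor_bounded n \<phi> g B\<close> S(1) \<phi>0 g0, where f = f]) (use F(4,5) in \<open>auto simp: pairings_def\<close>)
qed

lemma taylor_boundedD:
  assumes "taylor_bounded n \<phi> g B"
  shows "0 \<le> B" "continuous_on (orthant n) \<phi>" "\<And>k. k < n \<Longrightarrow> continuous_on (orthant n) (g k)"
    "\<And>x. x \<in> orthant n \<Longrightarrow> \<bar>\<phi> x\<bar> \<le> B" "\<And>x k. x \<in> orthant n \<Longrightarrow> k < n \<Longrightarrow> \<bar>g k x\<bar> \<le> B"
    "\<And>x v z. x \<in> orthant n \<Longrightarrow> v \<in> orthant n \<Longrightarrow> 0 \<le> z \<Longrightarrow> \<bar>\<phi> (\<lambda>i. x i + z * v i) - \<phi> x\<bar> \<le> B * (z * (\<Sum>k<n. v k))"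
    "\<And>x v z. x \<in> orthant n \<Longrightarrow> v \<in> orthant n \<Longrightarrow> 0 \<le> z \<Longrightarrow>
       \<bar>\<phi> (\<lambda>i. x i + z * v i) - \<phi> x - z * (\<Sum>k<n. v k * g k x)\<bar> \<le> B * (z * (\<Sum>k<n. v k))\<^sup>2"
  using assms unfolding taylor_bounded_def by blast+

text \<open>Two regimes produce the integrable weights: Taylor bounds for z \<le> 1; for z > 1,
  boundedness of \<phi> in the immigration jump and linear growth in the compensated one. Both
  constants are linear in \<open>B\<close>, which will later turn a small \<open>B\<close> into a
  small error of the operator.\<close>

lemma jump_bounds:
  assumes T: "taylor_bounded n \<phi> g B" and x: "x \<in> orthant n" "v \<in> orthant n" and V: "(\<Sum>k<n. v k) \<le> V" and z: "0 < z"
  shows "\<bar>jump_I \<phi> x v z\<bar> \<le> (2 * B + B * V) * min 1 z"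
    and "\<bar>jump_B n \<phi> g x v z\<bar> \<le> (2 * B * V + B * V\<^sup>2) * (z * min 1 z)"
proof -
  note D = taylor_boundedD[OF T]
  have v: "0 \<le> v k" if "k < n" for k using x(2) that by (auto simp: orthant_def)
  define s where "s = (\<Sum>k<n. v k)"
  have s: "0 \<le> s" "s \<le> V" using v V by (auto simp: s_def intro: sum_nonneg)
  have y: "(\<lambda>i. x i + z * v i) \<in> orthant n" using x z by (intro orthant_add) auto
  have I1: "\<bar>jump_I \<phi> x v z\<bar> \<le> 2 * B" using D(4)[OF y] D(4)[OF x(1)] z by (auto simp: jump_I_def)
  have "\<bar>jump_I \<phi> x v z\<bar> \<le> B * (z * s)" using D(6)[OF x, of z] z by (simp add: jump_I_def s_def)
  also have "\<dots> \<le> B * (z * V)" using D(1) s z by (intro mult_left_mono) auto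
  finally have I2: "\<bar>jump_I \<phi> x v z\<bar> \<le> B * V * z" by (simp add: mult_ac)
  have BV: "0 \<le> B * V" "0 \<le> B * z" using D(1) s z by auto
  show "\<bar>jump_I \<phi> x v z\<bar> \<le> (2 * B + B * V) * min 1 z"
  proof (cases "z \<le> 1")
    case True
    then show ?thesis using I2 BV by (simp add: min_def distrib_right)
  qed (use I1 BV in \<open>auto simp: min_def\<close>)
  have "\<bar>\<Sum>k<n. v k * g k x\<bar> \<le> (\<Sum>k<n. v k * B)"
    using v D(5)[OF x(1)] by (intro order_trans[OF sum_abs] sum_mono) (auto simp: abs_mult intro!: mult_left_mono)
  also have "\<dots> = s * B" by (simp add: s_def sum_distrib_right)
  also have "\<dots> \<le> V * B" using s D(1) by (intro mult_right_mono) auto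
  finally have "z * \<bar>\<Sum>k<n. v k * g k x\<bar> \<le> z * (V * B)" using z by (intro mult_left_mono) auto
  moreover have "jump_B n \<phi> g x v z = jump_I \<phi> x v z - z * (\<Sum>k<n. v k * g k x)" by (simp add: jump_B_def jump_I_def)
  ultimately have B1: "\<bar>jump_B n \<phi> g x v z\<bar> \<le> 2 * B * V * z"
  proof -
    assume *: "z * \<bar>\<Sum>k<n. v k * g k x\<bar> \<le> z * (V * B)" and J: "jump_B n \<phi> g x v z = jump_I \<phi> x v z - z * (\<Sum>k<n. v k * g k x)"
    have "\<bar>jump_B n \<phi> g x v z\<bar> \<le> \<bar>jump_I \<phi> x v z\<bar> + \<bar>z * (\<Sum>k<n. v k * g k x)\<bar>"
      unfolding J by (rule abs_triangle_ineq4)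
    also have "\<bar>z * (\<Sum>k<n. v k * g k x)\<bar> = z * \<bar>\<Sum>k<n. v k * g k x\<bar>" using z by (simp add: abs_mult)
    finally have "\<bar>jump_B n \<phi> g x v z\<bar> \<le> B * V * z + z * (V * B)" using * I2 by linarith
    then show ?thesis by (simp add: mult_ac)
  qed
  have "\<bar>jump_B n \<phi> g x v z\<bar> \<le> B * (z * s)\<^sup>2" using D(7)[OF x, of z] z by (simp add: jump_B_def s_def)
  also have "\<dots> \<le> B * (z * V)\<^sup>2" using D(1) s z by (intro mult_left_mono power_mono) auto
  finally have B2: "\<bar>jump_B n \<phi> g x v z\<bar> \<le> B * V\<^sup>2 * z\<^sup>2" by (simp add: power_mult_distrib mult_ac)
  have nn: "0 \<le> 2 * B * V * (z * min 1 z)" "0 \<le> B * V\<^sup>2 * (z * min 1 z)" using D(1) s z by auto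
  show "\<bar>jump_B n \<phi> g x v z\<bar> \<le> (2 * B * V + B * V\<^sup>2) * (z * min 1 z)"
    unfolding distrib_right
  proof (cases "z \<le> 1")
    case True
    then show "\<bar>jump_B n \<phi> g x v z\<bar> \<le> 2 * B * V * (z * min 1 z) + B * V\<^sup>2 * (z * min 1 z)"
      using B2 nn(1) by (simp add: min_def power2_eq_square)
  next
    case False
    then show "\<bar>jump_B n \<phi> g x v z\<bar> \<le> 2 * B * V * (z * min 1 z) + B * V\<^sup>2 * (z * min 1 z)"
      using B1 nn(2) by (simp add: min_def)
  qed
qed

section \<open>Cylinder functions and the insertion of an atom\<close>

lemma continuous_on_shift:
  assumes "continuous_on (orthant n) \<phi>"
    and "continuous_on T X" "continuous_on T Z" "continuous_on T V"
    and "\<And>t. t \<in> T \<Longrightarrow> X t \<in> orthant n" "\<And>t. t \<in> T \<Longrightarrow> V t \<in> orthant n"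
  shows "continuous_on T (\<lambda>t. \<phi> (\<lambda>i. X t i + max 0 (Z t) * V t i))"
proof (rule continuous_on_compose2[OF assms(1)])
  show "continuous_on T (\<lambda>t i. X t i + max 0 (Z t) * V t i)"
  proof (rule continuous_on_coordinatewise_then_product)
    show "continuous_on T (\<lambda>t. X t i + max 0 (Z t) * V t i)" for i
      by (intro continuous_on_add continuous_on_mult continuous_on_max continuous_on_const assms(3)
          continuous_on_product_then_coordinatewise[OF assms(2)] continuous_on_product_then_coordinatewise[OF assms(4)])
  qed
qed (use assms(5,6) in \<open>auto intro!: orthant_add\<close>)

lemma coords_orthant: "(\<And>i. i < n \<Longrightarrow> f i \<in> C_pp) \<Longrightarrow> coords n f r \<in> orthant n"
  using C_ppD(3) by (fastforce simp: coords_def orthant_def)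

lemma continuous_on_coords: "(\<And>i. i < n \<Longrightarrow> f i \<in> C_pp) \<Longrightarrow> continuous_on S (coords n f)"
proof (rule continuous_on_coordinatewise_then_product)
  fix i assume "\<And>i. i < n \<Longrightarrow> f i \<in> C_pp"
  then show "continuous_on S (\<lambda>r. coords n f r i)"
    using C_ppD(1)[of "f i"] by (cases "i < n") (auto simp: coords_def intro: continuous_on_subset)
qed

lemma pairings_orthant: "(\<And>i. i < n \<Longrightarrow> f i \<in> C_pp) \<Longrightarrow> pairings n f \<eta> \<in> orthant n"
  using C_ppD(3) by (fastforce simp: pairings_def orthant_def intro: pairing_nonneg)

lemma continuous_map_pairings:
  fixes f :: "nat \<Rightarrow> 'a::topological_space \<Rightarrow> real"
  assumes E: "compact (UNIV :: 'a set)" and f: "\<And>i. i < n \<Longrightarrow> f i \<in> C_pp"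
  shows "continuous_map weak_topology (top_of_set (orthant n)) (pairings n f)"
proof -
  have "continuous_map weak_topology (product_topology (\<lambda>i. euclidean) UNIV) (pairings n f)"
  proof (rule continuous_map_coordinatewise_then_product)
    fix i :: nat
    show "continuous_map weak_topology euclidean (\<lambda>\<eta>. pairings n f \<eta> i)"
      using continuous_map_pairing[OF E C_ppD(1)[OF f]] by (cases "i < n") (auto simp: pairings_def)
  qed simp
  then show ?thesis
    using pairings_orthant[OF f] by (auto simp: euclidean_product_topology continuous_map_in_subtopology)
qed

lemma pairings_add_atom:
  fixes f :: "nat \<Rightarrow> 'a::topological_space \<Rightarrow> real"
  assumes E: "compact (UNIV :: 'a set)" and f: "\<And>i. i < n \<Longrightarrow> f i \<in> C_pp" and \<eta>: "\<eta> \<in> fin_measures"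
  shows "pairings n f (add_atom \<eta> z r) = (\<lambda>i. pairings n f \<eta> i + max 0 z * coords n f r i)"
  using pairing_add_atom[OF E \<eta> C_ppD(1)[OF f]] by (auto simp: pairings_def coords_def fun_eq_iff)

lemma fderiv_cylinder:
  fixes f :: "nat \<Rightarrow> 'a::topological_space \<Rightarrow> real"
  assumes E: "compact (UNIV :: 'a set)" and f: "\<And>i. i < n \<Longrightarrow> f i \<in> C_pp" and \<eta>: "\<eta> \<in> fin_measures"
    and T: "taylor_bounded n \<phi> g B"
  shows "fderiv (\<lambda>\<eta>. \<phi> (pairings n f \<eta>)) \<eta> r = (\<Sum>k<n. coords n f r k * g k (pairings n f \<eta>))" (is "_ = ?D")
proof -
  note D = taylor_boundedD[OF T]
  let ?q = "\<lambda>\<epsilon>. (\<phi> (pairings n f (add_atom \<eta> \<epsilon> r)) - \<phi> (pairings n f \<eta>)) / \<epsilon>"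
  define s where "s = (\<Sum>k<n. coords n f r k)"
  have "((\<lambda>\<epsilon>. ?q \<epsilon> - ?D) \<longlongrightarrow> 0) (at_right 0)"
  proof (rule tendsto_rabs_zero_cancel, rule tendsto_sandwich[where f = "\<lambda>_. 0" and h = "\<lambda>\<epsilon>. B * s\<^sup>2 * \<epsilon>"])
    show "\<forall>\<^sub>F \<epsilon> in at_right 0. \<bar>?q \<epsilon> - ?D\<bar> \<le> B * s\<^sup>2 * \<epsilon>"
      using eventually_at_right_less[of "0::real"]
    proof eventually_elim
      case (elim \<epsilon>)
      have "\<bar>\<phi> (pairings n f (add_atom \<eta> \<epsilon> r)) - \<phi> (pairings n f \<eta>) - \<epsilon> * ?D\<bar> \<le> B * (\<epsilon> * s)\<^sup>2"
        using D(7)[OF pairings_orthant[OF f] coords_orthant[OF f], where z = \<epsilon>] elim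
        by (simp add: pairings_add_atom[OF E f \<eta>] s_def)
      then have "\<bar>\<phi> (pairings n f (add_atom \<eta> \<epsilon> r)) - \<phi> (pairings n f \<eta>) - \<epsilon> * ?D\<bar> / \<epsilon> \<le> B * (\<epsilon> * s)\<^sup>2 / \<epsilon>"
        using elim by (intro divide_right_mono) auto
      also have "B * (\<epsilon> * s)\<^sup>2 / \<epsilon> = B * s\<^sup>2 * \<epsilon>" using elim by (simp add: power2_eq_square)
      also have "\<bar>\<phi> (pairings n f (add_atom \<eta> \<epsilon> r)) - \<phi> (pairings n f \<eta>) - \<epsilon> * ?D\<bar> / \<epsilon> =
          \<bar>(\<phi> (pairings n f (add_atom \<eta> \<epsilon> r)) - \<phi> (pairings n f \<eta>) - \<epsilon> * ?D) / \<epsilon>\<bar>"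
        using elim by (simp add: abs_divide)
      also have "(\<phi> (pairings n f (add_atom \<eta> \<epsilon> r)) - \<phi> (pairings n f \<eta>) - \<epsilon> * ?D) / \<epsilon> = ?q \<epsilon> - ?D"
        using elim by (simp add: diff_divide_distrib)
      finally show ?case .
    qed
    show "((\<lambda>\<epsilon>. B * s\<^sup>2 * \<epsilon>) \<longlongrightarrow> 0) (at_right 0)" by (auto intro!: tendsto_eq_intros)
  qed auto
  then have "(?q \<longlongrightarrow> ?D) (at_right 0)" by (simp add: LIM_zero_iff)
  then show ?thesis unfolding fderiv_def by (intro tendsto_Lim) auto
qed

definition integral_B where "integral_B \<alpha> n \<phi> g x v = (\<integral>z. jump_B n \<phi> g x v z \<partial>n_B \<alpha>)"
definition integral_I where "integral_I \<alpha> \<phi> x v = (\<integral>z. jump_I \<phi> x v z \<partial>n_I \<alpha>)"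

lemma coords_sum_bound:
  fixes f :: "nat \<Rightarrow> 'a::topological_space \<Rightarrow> real"
  assumes E: "compact (UNIV :: 'a set)" and f: "\<And>i. i < n \<Longrightarrow> f i \<in> C_pp"
  obtains V where "0 < V" "\<And>r. (\<Sum>k<n. coords n f r k) \<le> V"
proof -
  have "continuous_on UNIV (\<lambda>r. \<Sum>k<n. f k r)" using C_ppD(1)[OF f] by (intro continuous_intros) auto
  from compact_UNIV_bounded[OF E this] obtain V where "0 < V" "\<And>r. \<bar>\<Sum>k<n. f k r\<bar> \<le> V" by blast
  then show ?thesis using that[of V] by (auto simp: coords_def abs_le_iff)
qed

text \<open>With the z-integration carried out first, the integrands over E depend on \<eta> only
  through the finitely many numbers \<open>pairings n f \<eta>\<close>. This is the form from which
  continuity and explicit comparison are obtained.\<close>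

lemma L_op_cylinder:
  fixes f :: "nat \<Rightarrow> 'a::topological_space \<Rightarrow> real"
  assumes E: "compact (UNIV :: 'a set)" and \<alpha>: "0 < \<alpha>" "\<alpha> < 1" and a: "continuous_on UNIV a"
    and m: "m \<in> fin_measures" and f: "\<And>i. i < n \<Longrightarrow> f i \<in> C_pp" and \<eta>: "\<eta> \<in> fin_measures"
    and T: "taylor_bounded n \<phi> g B"
  shows "L_op \<alpha> a b m (\<lambda>\<eta>. \<phi> (pairings n f \<eta>)) \<eta> =
     pairing \<eta> (\<lambda>r. a r * integral_B \<alpha> n \<phi> g (pairings n f \<eta>) (coords n f r))
     - 1 / \<alpha> * pairing \<eta> (\<lambda>r. b r * (\<Sum>k<n. coords n f r k * g k (pairings n f \<eta>)))
     + pairing m (\<lambda>r. integral_I \<alpha> \<phi> (pairings n f \<eta>) (coords n f r))"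
    and "integrable (n_B \<alpha>) (jump_B n \<phi> g (pairings n f \<eta>) (coords n f r))"
    and "integrable (n_I \<alpha>) (jump_I \<phi> (pairings n f \<eta>) (coords n f r))"
    and "integrable \<eta> (\<lambda>r. a r * integral_B \<alpha> n \<phi> g (pairings n f \<eta>) (coords n f r))"
    and "integrable m (\<lambda>r. integral_I \<alpha> \<phi> (pairings n f \<eta>) (coords n f r))"
proof -
  note D = taylor_boundedD[OF T]
  let ?x = "pairings n f \<eta>"
  have x: "?x \<in> orthant n" by (rule pairings_orthant) (rule f)
  have v: "coords n f r \<in> orthant n" for r by (rule coords_orthant) (rule f)
  have fd: "fderiv (\<lambda>\<eta>. \<phi> (pairings n f \<eta>)) \<eta> r = (\<Sum>k<n. coords n f r k * g k ?x)" for r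
    by (rule fderiv_cylinder[OF E f \<eta> T])
  obtain V where V: "0 < V" "\<And>r. (\<Sum>k<n. coords n f r k) \<le> V" using coords_sum_bound[of n f, OF E f] by blast
  obtain A where A: "0 < A" "\<And>r. \<bar>a r\<bar> \<le> A" using compact_UNIV_bounded[OF E a] by blast
  have cz: "continuous_on UNIV (\<lambda>z. \<phi> (\<lambda>i. ?x i + max 0 z * coords n f r i))" for r
    by (rule continuous_on_shift[OF D(2) continuous_on_const continuous_on_id continuous_on_const x v])
  have cr: "continuous_on UNIV (\<lambda>r. \<phi> (\<lambda>i. ?x i + max 0 z * coords n f r i))" for z
    by (rule continuous_on_shift[OF D(2) continuous_on_const continuous_on_const continuous_on_coords[OF f] x v])
  have crs: "continuous_on UNIV (\<lambda>r. \<Sum>k<n. coords n f r k * g k ?x)"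
    by (intro continuous_on_sum continuous_on_mult continuous_on_const continuous_on_product_then_coordinatewise[OF continuous_on_coords[OF f]])
  have kI: "continuous_on UNIV (\<lambda>z. jump_I \<phi> ?x (coords n f r) z)"
    "(\<lambda>r. jump_I \<phi> ?x (coords n f r) z) \<in> borel_measurable borel" for r z
    unfolding jump_I_def by (intro continuous_intros borel_measurable_continuous_onI cz cr)+
  have kB: "continuous_on UNIV (\<lambda>z. jump_B n \<phi> g ?x (coords n f r) z)"
    "(\<lambda>r. jump_B n \<phi> g ?x (coords n f r) z) \<in> borel_measurable borel" for r z
    unfolding jump_B_def by (intro continuous_intros borel_measurable_continuous_onI cz cr crs)+
  have am: "a \<in> borel_measurable borel" by (rule borel_measurable_continuous_onI) fact
  have wB: "integrable (n_B \<alpha>) (\<lambda>z. C * (z * min 1 z))" for C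
    using integrable_n_B_min[OF \<alpha>] by simp
  have wI: "integrable (n_I \<alpha>) (\<lambda>z. C * min 1 z)" for C
    using integrable_n_I_min[OF \<alpha>] by simp
  note iI = jump_integral_interchange[where k = "\<lambda>z r. jump_I \<phi> ?x (coords n f r) z", OF sigma_finite_n_I sets_n_I AE_n_I_pos wI m kI jump_bounds(1)[OF T x v V(2)]]
  note iB = jump_integral_interchange[where k = "\<lambda>z r. jump_B n \<phi> g ?x (coords n f r) z", OF sigma_finite_n_B sets_n_B AE_n_B_pos wB \<eta> kB jump_bounds(2)[OF T x v V(2)]]
  define C where "C = A * (2 * B * V + B * V\<^sup>2)"
  have bd: "\<bar>a r * jump_B n \<phi> g ?x (coords n f r) z\<bar> \<le> C * (z * min 1 z)" if "0 < z" for z r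
    using mult_mono[OF A(2)[of r] jump_bounds(2)[OF T x v V(2) that]] A(1) by (simp add: abs_mult C_def mult.assoc)
  have kaB: "continuous_on UNIV (\<lambda>z. a r * jump_B n \<phi> g ?x (coords n f r) z)"
    "(\<lambda>r. a r * jump_B n \<phi> g ?x (coords n f r) z) \<in> borel_measurable borel" for r z
    using kB am by (auto intro!: continuous_intros)
  note iaB = jump_integral_interchange[where k = "\<lambda>z r. a r * jump_B n \<phi> g ?x (coords n f r) z", OF sigma_finite_n_B sets_n_B AE_n_B_pos wB \<eta> kaB bd]
  show "integrable (n_B \<alpha>) (jump_B n \<phi> g ?x (coords n f r))" "integrable (n_I \<alpha>) (jump_I \<phi> ?x (coords n f r))"
    "integrable m (\<lambda>r. integral_I \<alpha> \<phi> ?x (coords n f r))"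
    "integrable \<eta> (\<lambda>r. a r * integral_B \<alpha> n \<phi> g ?x (coords n f r))"
    using iB(3) iI(3) iI(2) iaB(2) by (simp_all add: integral_I_def integral_B_def)
  have eqB: "a r * (\<phi> (pairings n f (add_atom \<eta> z r)) - \<phi> ?x - z * fderiv (\<lambda>\<eta>. \<phi> (pairings n f \<eta>)) \<eta> r)
      = a r * jump_B n \<phi> g ?x (coords n f r) z" for z r
    by (simp add: fd pairings_add_atom[OF E f \<eta>] jump_B_def)
  have eqI: "\<phi> (pairings n f (add_atom \<eta> z r)) - \<phi> ?x = jump_I \<phi> ?x (coords n f r) z" for z r
    by (simp add: pairings_add_atom[OF E f \<eta>] jump_I_def)
  show "L_op \<alpha> a b m (\<lambda>\<eta>. \<phi> (pairings n f \<eta>)) \<eta> =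
     pairing \<eta> (\<lambda>r. a r * integral_B \<alpha> n \<phi> g ?x (coords n f r))
     - 1 / \<alpha> * pairing \<eta> (\<lambda>r. b r * (\<Sum>k<n. coords n f r k * g k ?x))
     + pairing m (\<lambda>r. integral_I \<alpha> \<phi> ?x (coords n f r))"
    unfolding L_op_def eqB unfolding eqI fd
    using iaB(1) iI(1) by (simp add: pairing_def integral_B_def integral_I_def)
qed

text \<open>The z-integrals are shown to be jointly continuous on the orthant times E. For the two
  terms integrated against \<eta> this is the input of \<open>continuous_map_pairing_param\<close>;
  the immigration term involves the fixed \<open>m\<close> and is a continuous function on the
  orthant composed with \<open>pairings\<close>.\<close>

lemma continuous_map_L_op_cylinder:
  fixes f :: "nat \<Rightarrow> 'a::metric_space \<Rightarrow> real"
  assumes E: "compact (UNIV :: 'a set)" and \<alpha>: "0 < \<alpha>" "\<alpha> < 1" and a: "continuous_on UNIV a" and b: "continuous_on UNIV b"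
    and m: "m \<in> fin_measures" and f: "\<And>i. i < n \<Longrightarrow> f i \<in> C_pp"
    and T: "taylor_bounded n \<phi> g B"
  shows "continuous_map weak_topology euclideanreal (L_op \<alpha> a b m (\<lambda>\<eta>. \<phi> (pairings n f \<eta>)))"
proof -
  note D = taylor_boundedD[OF T]
  have v: "coords n f r \<in> orthant n" for r by (rule coords_orthant) (rule f)
  obtain V where V: "0 < V" "\<And>r. (\<Sum>k<n. coords n f r k) \<le> V" using coords_sum_bound[of n f, OF E f] by blast
  have cV: "continuous_on T (\<lambda>p :: (nat \<Rightarrow> real) \<times> 'a. coords n f (snd p))" for T
    by (rule continuous_on_compose2[OF continuous_on_coords[of n f UNIV, OF f]]) (auto intro: continuous_on_snd continuous_on_id)
  have cF: "continuous_on T (\<lambda>p :: (nat \<Rightarrow> real) \<times> 'a. fst p)" for T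
    by (rule continuous_on_fst[OF continuous_on_id])
  have cs: "continuous_on (orthant n \<times> UNIV) (\<lambda>p. \<phi> (\<lambda>i. fst p i + max 0 z * coords n f (snd p) i))" for z
    by (rule continuous_on_shift[OF D(2) cF continuous_on_const cV]) (use v in auto)
  have c0: "continuous_on (orthant n \<times> UNIV) (\<lambda>p :: (nat \<Rightarrow> real) \<times> 'a. \<phi> (fst p))"
    by (rule continuous_on_compose2[OF D(2) cF]) auto
  have cg: "continuous_on (orthant n \<times> UNIV) (\<lambda>p. \<Sum>k<n. coords n f (snd p) k * g k (fst p))"
    by (intro continuous_on_sum continuous_on_mult continuous_on_product_then_coordinatewise[OF cV]
        continuous_on_compose2[OF D(3) cF]) auto
  have cz: "continuous_on UNIV (\<lambda>z. \<phi> (\<lambda>i. x i + max 0 z * coords n f r i))" if "x \<in> orthant n" for x r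
    by (rule continuous_on_shift[OF D(2) continuous_on_const continuous_on_id continuous_on_const that v])
  have jBm: "jump_B n \<phi> g x (coords n f r) \<in> borel_measurable (n_B \<alpha>)" if "x \<in> orthant n" for x r
    unfolding jump_B_def using cz[OF that]
    by (subst measurable_cong_sets[OF sets_n_B refl], intro borel_measurable_continuous_onI continuous_intros)
  have jIm: "jump_I \<phi> x (coords n f r) \<in> borel_measurable (n_I \<alpha>)" if "x \<in> orthant n" for x r
    unfolding jump_I_def using cz[OF that]
    by (subst measurable_cong_sets[OF sets_n_I refl], intro borel_measurable_continuous_onI continuous_intros)
  have cB: "continuous_on (orthant n \<times> UNIV) (\<lambda>p. integral_B \<alpha> n \<phi> g (fst p) (coords n f (snd p)))"
    unfolding integral_B_def
  proof (rule continuous_on_integral_dominated)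
    show "integrable (n_B \<alpha>) (\<lambda>z. (2 * B * V + B * V\<^sup>2) * (z * min 1 z))" using integrable_n_B_min[OF \<alpha>] by simp
    show "AE z in n_B \<alpha>. continuous_on (orthant n \<times> UNIV) (\<lambda>p. jump_B n \<phi> g (fst p) (coords n f (snd p)) z)"
      unfolding jump_B_def by (intro AE_I2 continuous_intros cs c0 cg)
    show "AE z in n_B \<alpha>. \<forall>p\<in>orthant n \<times> UNIV. \<bar>jump_B n \<phi> g (fst p) (coords n f (snd p)) z\<bar> \<le> (2 * B * V + B * V\<^sup>2) * (z * min 1 z)"
      using AE_n_B_pos by eventually_elim (use jump_bounds(2)[OF T _ v V(2)] in auto)
  qed (use jBm in auto)
  have cI: "continuous_on (orthant n \<times> UNIV) (\<lambda>p. integral_I \<alpha> \<phi> (fst p) (coords n f (snd p)))"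
    unfolding integral_I_def
  proof (rule continuous_on_integral_dominated)
    show "integrable (n_I \<alpha>) (\<lambda>z. (2 * B + B * V) * min 1 z)" using integrable_n_I_min[OF \<alpha>] by simp
    show "AE z in n_I \<alpha>. continuous_on (orthant n \<times> UNIV) (\<lambda>p. jump_I \<phi> (fst p) (coords n f (snd p)) z)"
      unfolding jump_I_def by (intro AE_I2 continuous_intros cs c0)
    show "AE z in n_I \<alpha>. \<forall>p\<in>orthant n \<times> UNIV. \<bar>jump_I \<phi> (fst p) (coords n f (snd p)) z\<bar> \<le> (2 * B + B * V) * min 1 z"
      using AE_n_I_pos by eventually_elim (use jump_bounds(1)[OF T _ v V(2)] in auto)
  qed (use jIm in auto)
  \<comment> \<open>A bound for the immigration integrand uniform in x and r; being constant, it is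
    integrable against the finite measure \<open>m\<close>.\<close>
  define W where "W = (\<integral>z. (2 * B + B * V) * min 1 z \<partial>n_I \<alpha>)"
  have bI: "\<bar>integral_I \<alpha> \<phi> x (coords n f r)\<bar> \<le> W" if "x \<in> orthant n" for x r
    unfolding integral_I_def W_def
  proof -
    have w: "integrable (n_I \<alpha>) (\<lambda>z. (2 * B + B * V) * min 1 z)" using integrable_n_I_min[OF \<alpha>] by simp
    have le: "AE z in n_I \<alpha>. \<bar>jump_I \<phi> x (coords n f r) z\<bar> \<le> (2 * B + B * V) * min 1 z"
      using AE_n_I_pos by eventually_elim (rule jump_bounds(1)[OF T that v V(2)])
    have "integrable (n_I \<alpha>) (jump_I \<phi> x (coords n f r))"
      by (rule Bochner_Integration.integrable_bound[OF w jIm[OF that]]) (use le in \<open>auto elim!: eventually_mono\<close>)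
    then show "\<bar>integral\<^sup>L (n_I \<alpha>) (jump_I \<phi> x (coords n f r))\<bar> \<le> (\<integral>z. (2 * B + B * V) * min 1 z \<partial>n_I \<alpha>)"
      using w le by (intro order_trans[OF integral_abs_bound] integral_mono_AE) auto
  qed
  have cm: "continuous_on (orthant n) (\<lambda>x. pairing m (\<lambda>r. integral_I \<alpha> \<phi> x (coords n f r)))"
    unfolding pairing_def
  proof (rule continuous_on_integral_dominated)
    interpret finite_measure m using m by (rule fin_measuresD)
    show "integrable m (\<lambda>_. W)" by simp
    show "AE r in m. continuous_on (orthant n) (\<lambda>x. integral_I \<alpha> \<phi> x (coords n f r))"
    proof (intro AE_I2)
      fix r
      have "continuous_on (orthant n) (\<lambda>x. integral_I \<alpha> \<phi> (fst (x, r)) (coords n f (snd (x, r))))"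
        by (rule continuous_on_compose2[OF cI continuous_on_Pair[OF continuous_on_id continuous_on_const]]) auto
      then show "continuous_on (orthant n) (\<lambda>x. integral_I \<alpha> \<phi> x (coords n f r))" by simp
    qed
    show "(\<lambda>r. integral_I \<alpha> \<phi> x (coords n f r)) \<in> borel_measurable m" if "x \<in> orthant n" for x
    proof -
      have "continuous_on UNIV (\<lambda>r. integral_I \<alpha> \<phi> (fst (x, r)) (coords n f (snd (x, r))))"
        by (rule continuous_on_compose2[OF cI continuous_on_Pair[OF continuous_on_const continuous_on_id]]) (use that in auto)
      then show ?thesis using fin_measuresD(1)[OF m] borel_measurable_continuous_onI by (simp cong: measurable_cong_sets)
    qed
  qed (use bI in auto)
  note X = continuous_map_pairings[of n f, OF E f]
  have "continuous_map weak_topology euclideanreal (\<lambda>\<eta>. pairing \<eta> (\<lambda>r. a r * integral_B \<alpha> n \<phi> g (pairings n f \<eta>) (coords n f r))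
     - 1 / \<alpha> * pairing \<eta> (\<lambda>r. b r * (\<Sum>k<n. coords n f r k * g k (pairings n f \<eta>)))
     + pairing m (\<lambda>r. integral_I \<alpha> \<phi> (pairings n f \<eta>) (coords n f r)))"
  proof (intro continuous_map_add continuous_map_diff continuous_map_real_mult)
    show "continuous_map weak_topology euclideanreal (\<lambda>\<eta>. pairing \<eta> (\<lambda>r. a r * integral_B \<alpha> n \<phi> g (pairings n f \<eta>) (coords n f r)))"
    proof (rule continuous_map_pairing_param[OF E X, where H = "\<lambda>x r. a r * integral_B \<alpha> n \<phi> g x (coords n f r)"])
      show "continuous_on (orthant n \<times> UNIV) (\<lambda>(x, r). a r * integral_B \<alpha> n \<phi> g x (coords n f r))"
        unfolding split_beta by (intro continuous_on_mult cB continuous_on_compose2[OF a continuous_on_snd[OF continuous_on_id]]) auto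
    qed
    show "continuous_map weak_topology euclideanreal (\<lambda>\<eta>. pairing \<eta> (\<lambda>r. b r * (\<Sum>k<n. coords n f r k * g k (pairings n f \<eta>))))"
    proof (rule continuous_map_pairing_param[OF E X, where H = "\<lambda>x r. b r * (\<Sum>k<n. coords n f r k * g k x)"])
      show "continuous_on (orthant n \<times> UNIV) (\<lambda>(x, r). b r * (\<Sum>k<n. coords n f r k * g k x))"
        unfolding split_beta by (intro continuous_on_mult cg continuous_on_compose2[OF b continuous_on_snd[OF continuous_on_id]]) auto
    qed
    have "continuous_map (top_of_set (orthant n)) euclideanreal (\<lambda>x. pairing m (\<lambda>r. integral_I \<alpha> \<phi> x (coords n f r)))"
      using cm by simp
    from continuous_map_compose[OF X this]
    show "continuous_map weak_topology euclideanreal (\<lambda>\<eta>. pairing m (\<lambda>r. integral_I \<alpha> \<phi> (pairings n f \<eta>) (coords n f r)))"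
      by (simp add: comp_def)
  qed simp
  then show ?thesis
    by (rule continuous_map_eq) (simp add: L_op_cylinder(1)[OF E \<alpha> a m f _ T])
qed

lemma C_inf_compact_support:
  assumes "continuous_map weak_topology euclideanreal \<Phi>" "compactin weak_topology K"
    and "\<And>\<eta>. \<eta> \<in> fin_measures - K \<Longrightarrow> \<Phi> \<eta> = 0"
  shows "\<Phi> \<in> C_inf"
  unfolding C_inf_def mem_Collect_eq
proof (intro conjI allI impI exI[of _ K] ballI)
  show "\<bar>\<Phi> \<eta>\<bar> < \<epsilon>" if "0 < \<epsilon>" "\<eta> \<in> fin_measures - K" for \<epsilon> \<eta>
    using that assms(3)[OF that(2)] by simp
qed (use assms in auto)

text \<open>An added atom can only increase \<langle>\<eta>, f 0\<rangle>. Once this coordinate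
  exceeds the bound \<open>R\<close> of the support, the function vanishes together with all its
  jumps, so even the nonlocal operator keeps the support inside one compact set.\<close>

lemma L_op_F_class_C_inf:
  fixes a b :: "'a::metric_space \<Rightarrow> real"
  assumes E: "compact (UNIV :: 'a set)" and \<alpha>: "0 < \<alpha>" "\<alpha> < 1" and a: "continuous_on UNIV a" and b: "continuous_on UNIV b"
    and m: "m \<in> fin_measures" and exp: "\<And>f :: 'a \<Rightarrow> real. f \<in> C_pp \<Longrightarrow> (\<lambda>\<eta>. exp (- pairing \<eta> f)) \<in> C_inf"
    and \<Phi>: "\<Phi> \<in> F_class"
  shows "\<Phi> \<in> C_inf" "L_op \<alpha> a b m \<Phi> \<in> C_inf"
proof -
  obtain n \<phi> f g B S where F: "1 \<le> n" "\<And>i. i < n \<Longrightarrow> f i \<in> C_pp" "\<Phi> = (\<lambda>\<eta>. \<phi> (pairings n f \<eta>))"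
    "taylor_bounded n \<phi> g B" "compact S"
    "\<And>x. x \<in> orthant n - S \<Longrightarrow> \<phi> x = 0" "\<And>k x. k < n \<Longrightarrow> x \<in> orthant n - S \<Longrightarrow> g k x = 0"
    by (rule F_class_data[OF \<Phi>]) blast
  have "compact ((\<lambda>x. x 0) ` S)"
    using F(5) by (intro compact_continuous_image continuous_on_subset[OF continuous_on_product_coordinates]) auto
  then obtain R where R: "\<forall>y\<in>(\<lambda>x. x 0) ` S. norm y \<le> R" using compact_imp_bounded bounded_iff by blast
  have off: "x \<in> orthant n - S" if "x \<in> orthant n" "R < x 0" for x
  proof -
    have "x \<notin> S"
    proof
      assume "x \<in> S"
      then have "norm (x 0) \<le> R" using R by blast
      then show False using that(2) by simp
    qed
    then show ?thesis using that(1) by blast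
  qed
  \<comment> \<open>At the level exp (- R), smallness of exp (- \<langle>\<eta>, f 0\<rangle>)
    outside \<open>K\<close> means precisely that \<langle>\<eta>, f 0\<rangle> exceeds
    \<open>R\<close>. The index 0 is available because n \<ge> 1.\<close>
  obtain K where K: "compactin weak_topology K" "\<And>\<eta>. \<eta> \<in> fin_measures - K \<Longrightarrow> \<bar>exp (- pairing \<eta> (f 0))\<bar> < exp (- R)"
  proof -
    have "f 0 \<in> C_pp" using F(1) by (intro F(2)) simp
    from exp[OF this] have "\<forall>\<epsilon>>0. \<exists>K. compactin weak_topology K \<and> (\<forall>\<eta>\<in>fin_measures - K. \<bar>exp (- pairing \<eta> (f 0))\<bar> < \<epsilon>)"
      unfolding C_inf_def mem_Collect_eq by (rule conjunct2)
    from this[rule_format, OF exp_gt_zero[of "- R"]] show ?thesis using that by blast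
  qed
  have vanish: "\<Phi> \<eta> = 0 \<and> L_op \<alpha> a b m \<Phi> \<eta> = 0" if "\<eta> \<in> fin_measures - K" for \<eta>
  proof -
    have \<eta>: "\<eta> \<in> fin_measures" "R < pairing \<eta> (f 0)" using K(2)[OF that] that by auto
    let ?x = "pairings n f \<eta>"
    have x: "?x \<in> orthant n" by (rule pairings_orthant) (rule F(2))
    have v: "coords n f r \<in> orthant n" for r by (rule coords_orthant) (rule F(2))
    have x0: "?x 0 = pairing \<eta> (f 0)" using F(1) by (simp add: pairings_def)
    have \<phi>x: "\<phi> ?x = 0" using F(6)[OF off[OF x]] x0 \<eta> by simp
    have gx: "g k ?x = 0" if "k < n" for k using F(7)[OF that off[OF x]] x0 \<eta> by simp
    have \<phi>y: "\<phi> (\<lambda>i. ?x i + max 0 z * coords n f r i) = 0" for z r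
    proof -
      have "0 \<le> max 0 z * coords n f r 0" using v[of r] F(1) by (auto simp: orthant_def)
      then have "R < ?x 0 + max 0 z * coords n f r 0" using x0 \<eta> by linarith
      then show ?thesis by (intro F(6) off orthant_add x v) (simp_all only: max.cobounded1)
    qed
    have "jump_B n \<phi> g ?x (coords n f r) z = 0" "jump_I \<phi> ?x (coords n f r) z = 0" for r z
      using \<phi>x gx \<phi>y by (simp_all add: jump_B_def jump_I_def)
    then have "integral_B \<alpha> n \<phi> g ?x (coords n f r) = 0" "integral_I \<alpha> \<phi> ?x (coords n f r) = 0" for r
      by (simp_all add: integral_B_def integral_I_def)
    then show ?thesis
      using \<phi>x gx unfolding F(3) by (simp add: L_op_cylinder(1)[OF E \<alpha> a m F(2) \<eta>(1) F(4)] pairing_def)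
  qed
  have "continuous_map weak_topology euclideanreal \<Phi>"
    unfolding F(3) using continuous_map_compose[OF continuous_map_pairings[of n f, OF E F(2)], of euclideanreal \<phi>] taylor_boundedD(2)[OF F(4)]
    by (simp add: comp_def)
  then show "\<Phi> \<in> C_inf"
    using K(1) vanish by (intro C_inf_compact_support) blast+
  have "continuous_map weak_topology euclideanreal (L_op \<alpha> a b m \<Phi>)"
    unfolding F(3) by (rule continuous_map_L_op_cylinder[OF E \<alpha> a b m F(2) F(4)])
  then show "L_op \<alpha> a b m \<Phi> \<in> C_inf"
    using K(1) vanish by (intro C_inf_compact_support) blast+
qed

section \<open>Approximation of exponentials\<close>

text \<open>To be applied to a cutoff of the exponential and also to its difference from the
  exponential; in the second case \<open>B\<close> is the size of the error.\<close>

lemma taylor_bounded_one: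
  fixes F F' F'' :: "real \<Rightarrow> real"
  assumes F: "\<And>t. 0 \<le> t \<Longrightarrow> (F has_real_derivative F' t) (at t within {0..})"
    and F': "\<And>t. 0 \<le> t \<Longrightarrow> (F' has_real_derivative F'' t) (at t within {0..})"
    and B: "\<And>t. 0 \<le> t \<Longrightarrow> \<bar>F t\<bar> \<le> B" "\<And>t. 0 \<le> t \<Longrightarrow> \<bar>F' t\<bar> \<le> B" "\<And>t. 0 \<le> t \<Longrightarrow> \<bar>F'' t\<bar> \<le> B"
  shows "taylor_bounded 1 (\<lambda>x. F (x 0)) (\<lambda>k x. F' (x 0)) B"
proof -
  have B0: "0 \<le> B" using B(1)[of 0] by simp
  have cont: "continuous_on {0..} F" "continuous_on {0..} F'"
    using F F' by (auto intro!: DERIV_continuous_on)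
  have comp: "continuous_on (orthant 1) (\<lambda>x. u (x 0))" if "continuous_on {0..} u" for u :: "real \<Rightarrow> real"
    by (rule continuous_on_compose2[OF that]) (auto simp: orthant_def intro: continuous_on_subset[OF continuous_on_product_coordinates])
  have first: "\<bar>G (x + u) - G x\<bar> \<le> B * u"
    if G: "\<And>t. 0 \<le> t \<Longrightarrow> (G has_real_derivative G' t) (at t within {0..})" "\<And>t. 0 \<le> t \<Longrightarrow> \<bar>G' t\<bar> \<le> B"
      and x: "0 \<le> x" "0 \<le> u" for G G' x u
  proof -
    obtain \<xi> where \<xi>: "min x (x + u) \<le> \<xi>" "G (x + u) - G x = (x + u - x) * G' \<xi>"
      by (rule mean_value_nonneg[OF G(1), of x "x + u"]) (use x in auto)
    have "\<bar>G' \<xi>\<bar> \<le> B" using \<xi>(1) x by (intro G(2)) auto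
    then show ?thesis unfolding \<xi>(2) using x by (simp add: abs_mult mult.commute[of B] mult_left_mono)
  qed
  have second: "\<bar>F (x + u) - F x - u * F' x\<bar> \<le> B * u\<^sup>2" if x: "0 \<le> x" "0 \<le> u" for x u
  proof -
    obtain \<xi> where \<xi>: "min x (x + u) \<le> \<xi>" "\<xi> \<le> max x (x + u)" "F (x + u) - F x = (x + u - x) * F' \<xi>"
      by (rule mean_value_nonneg[OF F, of x "x + u"]) (use x in auto)
    have "\<bar>F' (x + (\<xi> - x)) - F' x\<bar> \<le> B * (\<xi> - x)"
      using \<xi> x by (intro first[OF F' B(3)]) auto
    also have "\<dots> \<le> B * u" using \<xi> x B0 by (intro mult_left_mono) auto
    finally have "u * \<bar>F' \<xi> - F' x\<bar> \<le> u * (B * u)" using x by (intro mult_left_mono) auto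
    moreover have "F (x + u) - F x - u * F' x = u * (F' \<xi> - F' x)" unfolding \<xi>(3) by (simp add: algebra_simps)
    ultimately show ?thesis using x by (simp add: abs_mult power2_eq_square mult_ac)
  qed
  show ?thesis
    unfolding taylor_bounded_def
  proof (intro conjI ballI allI impI)
    fix x v z assume x: "x \<in> orthant 1" "v \<in> orthant 1" "0 \<le> (z::real)"
    then have p: "0 \<le> x 0" "0 \<le> z * v 0" by (auto simp: orthant_def)
    show "\<bar>F (x 0 + z * v 0) - F (x 0)\<bar> \<le> B * (z * (\<Sum>k<1. v k))"
      using first[OF F B(2) p] by simp
    show "\<bar>F (x 0 + z * v 0) - F (x 0) - z * (\<Sum>k<1. v k * F' (x 0))\<bar> \<le> B * (z * (\<Sum>k<1. v k))\<^sup>2"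
      using second[OF p] by (simp add: mult_ac)
  qed (use B0 B comp cont in \<open>auto simp: orthant_def\<close>)
qed

text \<open>At the corner x = N the outer function is flat to first order, so the kink of
  \<open>max\<close> is not felt and the derivative is 0. Away from the corner the composition is
  smooth or locally constant.\<close>

lemma DERIV_truncated:
  fixes G G' :: "real \<Rightarrow> real" and N x :: real
  assumes G: "\<And>s. (G has_real_derivative G' s) (at s)" and 0: "G 0 = 0" "G' 0 = 0"
  shows "((\<lambda>x. G (max 0 (N - x))) has_real_derivative - G' (max 0 (N - x))) (at x)"
proof -
  consider "x < N" | "x > N" | "x = N" by linarith
  then show ?thesis
  proof cases
    case 1
    have "((\<lambda>x. G (N - x)) has_real_derivative G' (N - x) * (0 - 1)) (at x)"
      by (rule DERIV_chain2[OF G]) (auto intro!: derivative_eq_intros)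
    then have "((\<lambda>x. G (max 0 (N - x))) has_real_derivative G' (N - x) * (0 - 1)) (at x)"
      by (rule has_field_derivative_transform_within_open[where S = "{..<N}"]) (use 1 in auto)
    then show ?thesis using 1 by (simp add: max_def)
  next
    case 2
    have "((\<lambda>x. 0) has_real_derivative 0) (at x)" by simp
    then have "((\<lambda>x. G (max 0 (N - x))) has_real_derivative 0) (at x)"
      by (rule has_field_derivative_transform_within_open[where S = "{N<..}"]) (use 2 0 in auto)
    then show ?thesis using 2 0 by (simp add: max_def)
  next
    case 3
    have "(G has_derivative (\<lambda>h. 0)) (at 0)"
      using G[of 0] 0 by (simp add: has_field_derivative_def lambda_zero)
    then have d: "\<exists>d>0. \<forall>y. \<bar>y\<bar> < d \<longrightarrow> \<bar>G y\<bar> \<le> e * \<bar>y\<bar>" if "0 < e" for e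
      using that 0 unfolding has_derivative_at_alt by simp
    have "((\<lambda>x. G (max 0 (N - x))) has_derivative (\<lambda>h. 0)) (at x)"
      unfolding has_derivative_at_alt
    proof (intro conjI allI impI)
      fix e :: real assume "0 < e"
      then obtain d where d: "0 < d" "\<And>y. \<bar>y\<bar> < d \<Longrightarrow> \<bar>G y\<bar> \<le> e * \<bar>y\<bar>" using d by blast
      have "\<bar>G (max 0 (N - y))\<bar> \<le> e * \<bar>y - x\<bar>" if "\<bar>y - x\<bar> < d" for y
      proof -
        have m: "\<bar>max 0 (N - y)\<bar> \<le> \<bar>y - x\<bar>" using 3 by (auto simp: max_def)
        have "\<bar>G (max 0 (N - y))\<bar> \<le> e * \<bar>max 0 (N - y)\<bar>" using m that by (intro d(2)) linarith
        also have "\<dots> \<le> e * \<bar>y - x\<bar>" using m \<open>0 < e\<close> by (intro mult_left_mono) auto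
        finally show ?thesis .
      qed
      then show "\<exists>d>0. \<forall>y. norm (y - x) < d \<longrightarrow> norm (G (max 0 (N - y)) - G (max 0 (N - x)) - 0) \<le> e * norm (y - x)"
        using d(1) 3 0 by (intro exI[of _ d]) (auto simp: max_def split: if_splits)
    qed simp
    then show ?thesis using 3 0 by (simp add: has_field_derivative_def lambda_zero)
  qed
qed

text \<open>\<open>trunc_exp 0 N\<close> is a compactly supported \<open>C\<^sup>2\<close> approximation of \<open>x \<mapsto> exp (- x)\<close>, obtained by integrating
  twice the truncation \<open>max 0 (exp (- x) - exp (- N))\<close> of its second derivative; \<open>trunc_exp 1 N\<close> and
  \<open>trunc_exp 2 N\<close> are, up to sign, its derivatives.\<close>

definition trunc_exp :: "nat \<Rightarrow> real \<Rightarrow> real \<Rightarrow> real" where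
  "trunc_exp k N x = exp (- N) * (let s = max 0 (N - x) in exp s - 1 - (if k \<le> 1 then s else 0) - (if k = 0 then s\<^sup>2 / 2 else 0))"

lemma trunc_exp_DERIV:
  "(trunc_exp 0 N has_real_derivative - trunc_exp 1 N x) (at x)"
  "(trunc_exp 1 N has_real_derivative - trunc_exp 2 N x) (at x)"
proof -
  have "((\<lambda>x. (\<lambda>s. exp (- N) * (exp s - 1 - s - s\<^sup>2 / 2)) (max 0 (N - x))) has_real_derivative
     - (\<lambda>s. exp (- N) * (exp s - 1 - s)) (max 0 (N - x))) (at x)"
    by (rule DERIV_truncated) (auto intro!: derivative_eq_intros)
  then show "(trunc_exp 0 N has_real_derivative - trunc_exp 1 N x) (at x)"
    unfolding trunc_exp_def[abs_def] Let_def by simp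
  have "((\<lambda>x. (\<lambda>s. exp (- N) * (exp s - 1 - s)) (max 0 (N - x))) has_real_derivative
     - (\<lambda>s. exp (- N) * (exp s - 1)) (max 0 (N - x))) (at x)"
    by (rule DERIV_truncated) (auto intro!: derivative_eq_intros)
  then show "(trunc_exp 1 N has_real_derivative - trunc_exp 2 N x) (at x)"
    unfolding trunc_exp_def[abs_def] Let_def by simp
qed

lemma continuous_trunc_exp: "continuous_on S (trunc_exp k N)"
  unfolding trunc_exp_def[abs_def] Let_def
  by (cases "k = 0"; cases "k \<le> 1") (auto intro!: continuous_intros)

text \<open>The factor exp (- N) (1 + N + N^2/2) bounds the terms subtracted in the cutoff; the
  additional 1 + N pays for the weight 1 / (1 + x) on the interval from 0 to N.\<close>

definition trunc_err :: "real \<Rightarrow> real" where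
  "trunc_err N = (1 + N) * (1 + N + N\<^sup>2 / 2) * exp (- N)"

text \<open>The gain 1 / (1 + x) will absorb the linear growth of the operator in \<eta>. Up to N it
  costs only the ratio (1 + N) / (1 + x) \<ge> 1; beyond N the cutoff is 0 and the tail of the
  exponential is estimated by itself. One bound serves the cutoff and both of its
  derivatives.\<close>

lemma trunc_exp_error:
  assumes "0 \<le> N" "0 \<le> x"
  shows "\<bar>trunc_exp k N x - exp (- x)\<bar> \<le> trunc_err N / (1 + x)"
proof (cases "x \<le> N")
  case True
  define s where "s = N - x"
  have s: "0 \<le> s" "s \<le> N" using True assms by (auto simp: s_def)
  have "exp (- N) * exp s = exp (- x)" by (simp add: s_def flip: exp_add)
  then have "exp (- x) - trunc_exp k N x = exp (- N) * (1 + (if k \<le> 1 then s else 0) + (if k = 0 then s\<^sup>2 / 2 else 0))"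
    using s True by (simp add: trunc_exp_def Let_def s_def[symmetric] algebra_simps)
  moreover have q: "s\<^sup>2 / 2 \<le> N\<^sup>2 / 2" "0 \<le> N\<^sup>2 / 2" using power_mono[OF s(2,1), of 2] by simp_all
  moreover have "0 \<le> 1 + (if k \<le> 1 then s else 0) + (if k = 0 then s\<^sup>2 / 2 else 0)"
    using s by auto
  moreover have "1 + (if k \<le> 1 then s else 0) + (if k = 0 then s\<^sup>2 / 2 else 0) \<le> 1 + N + N\<^sup>2 / 2"
  proof -
    have "(if k \<le> 1 then s else 0) \<le> N" "(if k = 0 then s\<^sup>2 / 2 else 0) \<le> N\<^sup>2 / 2" using s q by auto
    then show ?thesis by linarith
  qed
  ultimately have "\<bar>exp (- x) - trunc_exp k N x\<bar> \<le> exp (- N) * (1 + N + N\<^sup>2 / 2)"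
    by (simp only: abs_mult abs_exp_cancel abs_of_nonneg) (simp add: mult_left_mono)
  also have "\<dots> \<le> exp (- N) * (1 + N + N\<^sup>2 / 2) * ((1 + N) / (1 + x))"
    using mult_left_mono[of 1 "(1 + N) / (1 + x)" "exp (- N) * (1 + N + N\<^sup>2 / 2)"] assms True by simp
  finally show ?thesis by (simp add: trunc_err_def abs_minus_commute mult_ac)
next
  case False
  then have "trunc_exp k N x = 0" by (simp add: trunc_exp_def max_def)
  moreover have "exp (- x) \<le> trunc_err N / (1 + x)"
  proof -
    \<comment> \<open>The right-hand side exceeds the left by N (x - N).\<close>
    have "1 + x \<le> (1 + N) * (1 + (x - N))" using False assms by (simp add: algebra_simps mult_mono mult_right_mono)
    also have "\<dots> \<le> (1 + N) * exp (x - N)"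
      using assms by (intro mult_left_mono exp_ge_add_one_self) auto
    finally have "(1 + x) * exp (- x) \<le> (1 + N) * exp (x - N) * exp (- x)" by (intro mult_right_mono) auto
    also have "\<dots> = (1 + N) * exp (- N)" by (simp add: mult.assoc flip: exp_add)
    also have "\<dots> \<le> trunc_err N" using assms by (simp add: trunc_err_def mult_le_cancel_left1 add_pos_nonneg)
    finally show ?thesis using assms by (simp add: field_simps)
  qed
  ultimately show ?thesis by simp
qed

lemma trunc_err_tendsto: "(\<lambda>n. trunc_err (real n)) \<longlonglongrightarrow> 0"
proof (rule tendsto_sandwich[where f = "\<lambda>_. 0" and h = "\<lambda>n. exp 1 * (real (Suc n) ^ 3 / exp (real (Suc n)))"])
  have "(\<lambda>n. real (Suc n) ^ 3 / exp (real (Suc n))) \<longlonglongrightarrow> 0"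
    by (rule filterlim_compose[OF tendsto_power_div_exp_0 filterlim_compose[OF filterlim_real_sequentially filterlim_Suc]])
  then show "(\<lambda>n. exp 1 * (real (Suc n) ^ 3 / exp (real (Suc n)))) \<longlonglongrightarrow> 0"
    using tendsto_mult_right_zero by blast
  have "trunc_err (real n) \<le> exp 1 * (real (Suc n) ^ 3 / exp (real (Suc n)))" for n
  proof -
    have "1 + real n + (real n)\<^sup>2 / 2 \<le> (1 + real n)\<^sup>2" by (simp add: power2_eq_square algebra_simps)
    then have "trunc_err (real n) \<le> (1 + real n) * (1 + real n)\<^sup>2 * exp (- real n)"
      unfolding trunc_err_def by (intro mult_right_mono mult_left_mono) auto
    also have "\<dots> = exp 1 * (real (Suc n) ^ 3 / exp (real (Suc n)))"
      by (simp add: power3_eq_cube power2_eq_square exp_add exp_minus field_simps)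
    finally show ?thesis .
  qed
  then show "\<forall>\<^sub>F n in sequentially. trunc_err (real n) \<le> exp 1 * (real (Suc n) ^ 3 / exp (real (Suc n)))" by simp
  show "\<forall>\<^sub>F n in sequentially. 0 \<le> trunc_err (real n)" by (simp add: trunc_err_def)
qed simp

lemma trunc_exp_F_class:
  assumes "f \<in> C_pp"
  shows "(\<lambda>\<eta>. trunc_exp 0 N (pairing \<eta> f)) \<in> F_class"
proof -
  have proj: "continuous_on (orthant 1) (\<lambda>x. x 0)" by (rule continuous_on_subset[OF continuous_on_product_coordinates]) simp
  have cont: "continuous_on (orthant 1) (\<lambda>x. c * trunc_exp k N (x 0))" for k c
    by (intro continuous_on_mult continuous_on_const continuous_on_compose2[OF continuous_trunc_exp proj, of UNIV]) simp
  \<comment> \<open>The factor \<open>c\<close> carries the sign that alternates from one derivative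
    to the next, so that a single statement covers both orders.\<close>
  have D: "((\<lambda>t. c * trunc_exp k N ((x(0 := t)) 0)) has_real_derivative (- c) * trunc_exp (Suc k) N (x 0)) (at (x 0) within {0..})"
    if "k \<le> 1" for k c and x :: "nat \<Rightarrow> real"
    using that trunc_exp_DERIV[of N "x 0"] DERIV_cmult[of "trunc_exp k N" "- trunc_exp (Suc k) N (x 0)" "x 0" UNIV c]
    by (auto simp: le_Suc_eq numeral_2_eq_2 intro: has_field_derivative_at_within)
  have "Ck_orthant (Suc (Suc 0)) 1 (\<lambda>x. 1 * trunc_exp 0 N (x 0))"
    unfolding Ck_orthant.simps
    using D[of 0 1] D[of 1 "-1"]
    by (intro conjI cont exI[of _ "\<lambda>_ x. (- 1) * trunc_exp 1 N (x 0)"] exI[of _ "\<lambda>_ x. (- (- 1)) * trunc_exp 2 N (x 0)"] allI impI ballI)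
       (auto simp: numeral_2_eq_2)
  then have Ck: "Ck_orthant 2 1 (\<lambda>x. trunc_exp 0 N (x 0))" by (simp only: numeral_2_eq_2 mult_1)
  \<comment> \<open>The one-dimensional orthant is a half line inside the sequences; the support is
    enclosed in the image of a segment. No sign is assumed for N, hence
    \<open>max 0 N\<close>.\<close>
  have "continuous_on {0..max 0 N} (\<lambda>t i. if i = (0::nat) then t else 0 :: real)"
  proof (rule continuous_on_coordinatewise_then_product)
    show "continuous_on {0..max 0 N} (\<lambda>t. if i = 0 then t else 0)" for i :: nat by (cases "i = 0") auto
  qed
  then have K: "compact ((\<lambda>t i. if i = (0::nat) then t else 0) ` {0..max 0 N})"
    by (intro compact_continuous_image) auto
  have "{x \<in> orthant 1. trunc_exp 0 N (x 0) \<noteq> 0} \<subseteq> (\<lambda>t i. if i = 0 then t else 0) ` {0..max 0 N}"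
  proof
    fix x assume x: "x \<in> {x \<in> orthant 1. trunc_exp 0 N (x 0) \<noteq> 0}"
    then have "x 0 \<le> N" by (auto simp: trunc_exp_def max_def split: if_splits)
    moreover have "0 \<le> x 0" "\<And>i. 0 < i \<Longrightarrow> x i = 0" using x by (auto simp: orthant_def)
    ultimately show "x \<in> (\<lambda>t i. if i = 0 then t else 0) ` {0..max 0 N}"
      by (intro image_eqI[of _ _ "x 0"]) auto
  qed
  then have "closure {x \<in> orthant 1. trunc_exp 0 N (x 0) \<noteq> 0} \<subseteq> (\<lambda>t i. if i = 0 then t else 0) ` {0..max 0 N}"
    using K by (intro closure_minimal) (auto intro: compact_imp_closed)
  then have "compact (closure {x \<in> orthant 1. trunc_exp 0 N (x 0) \<noteq> 0})"
    using compact_Int_closed[OF K closed_closure, of "{x \<in> orthant 1. trunc_exp 0 N (x 0) \<noteq> 0}"] by (simp add: inf_absorb2)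
  then show ?thesis
    unfolding F_class_def mem_Collect_eq using Ck assms
    by (intro exI[of _ 1] exI[of _ "\<lambda>x. trunc_exp 0 N (x 0)"] exI[of _ "\<lambda>_. f"]) auto
qed

text \<open>Subtracting the explicit value on the exponential leaves integrals of the jumps of
  cutoff minus exponential. Their size is \<beta> = \<delta> / (1 + x) with x = \<langle>\<eta>,
  f\<rangle> and \<delta> the truncation error, and integration against \<eta> multiplies this by at
  most a constant times x. The outcome is a bound uniform in \<eta>.\<close>

lemma L_op_trunc_exp:
  fixes f :: "'a::metric_space \<Rightarrow> real"
  assumes E: "compact (UNIV :: 'a set)" and \<alpha>: "0 < \<alpha>" "\<alpha> < 1" and a: "a \<in> C_pp" and b: "b \<in> C_pp"
    and m: "m \<in> fin_measures" and f: "f \<in> C_pp"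
  obtains K where "0 \<le> K" "\<And>N \<eta>. 0 \<le> N \<Longrightarrow> \<eta> \<in> fin_measures \<Longrightarrow>
     \<bar>L_op \<alpha> a b m (\<lambda>\<eta>. trunc_exp 0 N (pairing \<eta> f)) \<eta> - exp_generator \<alpha> a b m f \<eta>\<bar> \<le> K * trunc_err N"
proof -
  note Ca = C_ppD[OF a] and Cb = C_ppD[OF b] and Cf = C_ppD[OF f]
  obtain V where V: "0 < V" "\<And>r. \<bar>f r\<bar> \<le> V" using compact_UNIV_bounded[OF E Cf(1)] by blast
  obtain D1 where D1: "0 < D1" "\<And>r. \<bar>a r\<bar> \<le> D1 * f r" using continuous_pairing_ratio_bound[OF E f Ca(1)] by blast
  have bf: "continuous_on UNIV (\<lambda>r. b r * f r)" using Cb Cf by (intro continuous_intros) auto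
  obtain D2 where D2: "0 < D2" "\<And>r. \<bar>b r * f r\<bar> \<le> D2 * f r" using continuous_pairing_ratio_bound[OF E f bf] by blast
  define WB where "WB = (\<integral>z. z * min 1 z \<partial>n_B \<alpha>)"
  define WI where "WI = (\<integral>z. min 1 z \<partial>n_I \<alpha>)"
  have WB: "0 \<le> WB" unfolding WB_def using AE_n_B_pos[of \<alpha>] by (intro integral_nonneg_AE) (auto elim!: eventually_mono)
  have WI: "0 \<le> WI" unfolding WI_def using AE_n_I_pos[of \<alpha>] by (intro integral_nonneg_AE) (auto elim!: eventually_mono)
  define CB where "CB = (2 * V + V\<^sup>2) * WB"
  define CI where "CI = (2 + V) * WI"
  have CBI: "0 \<le> CB" "0 \<le> CI" using WB WI V by (auto simp: CB_def CI_def)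
  define M where "M = pairing m (\<lambda>_. 1)"
  have M: "0 \<le> M" by (simp add: M_def pairing_nonneg)
  \<comment> \<open>One summand for each part of the operator: \<open>D1\<close> and
    \<open>D2\<close> compare a and b f with f, so branching and drift contribute multiples of x
    \<beta> \<le> \<delta>; immigration contributes a multiple of \<beta> through the total mass
    \<open>M\<close>.\<close>
  define K where "K = D1 * CB + D2 / \<alpha> + M * CI"
  have K: "0 \<le> K" using D1 D2 CBI M \<alpha> by (auto simp: K_def)
  show ?thesis
  proof (rule that[OF K])
    fix N :: real and \<eta> :: "'a measure" assume N: "0 \<le> N" and \<eta>: "\<eta> \<in> fin_measures"
    define x where "x = pairing \<eta> f"
    have x: "0 \<le> x" using Cf by (simp add: x_def pairing_nonneg)
    define \<delta> where "\<delta> = trunc_err N"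
    define \<beta> where "\<beta> = \<delta> / (1 + x)"
    have \<delta>: "0 \<le> \<delta>" using N by (simp add: \<delta>_def trunc_err_def)
    have \<beta>: "0 \<le> \<beta>" "\<beta> \<le> \<delta>" "x * \<beta> \<le> \<delta>" using \<delta> x by (auto simp: \<beta>_def divide_simps distrib_left mult.commute[of x] mult_left_mono mult_le_cancel_left1)
    have err: "\<bar>trunc_exp k N (x + t) - exp (- (x + t))\<bar> \<le> \<beta>" if "0 \<le> t" for k t
    proof -
      have "\<bar>trunc_exp k N (x + t) - exp (- (x + t))\<bar> \<le> \<delta> / (1 + (x + t))"
        unfolding \<delta>_def using N x that by (intro trunc_exp_error) auto
      also have "\<dots> \<le> \<beta>" unfolding \<beta>_def using \<delta> x that by (intro divide_left_mono) auto
      finally show ?thesis .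
    qed
    \<comment> \<open>The base point x is built into the error function. It is then small, of order
      \<beta>, on the whole half line, and the jump bounds can be applied at the origin with the
      constant \<beta> that depends on \<eta>.\<close>
    define F where "F t = trunc_exp 0 N (x + t) - exp (- (x + t))" for t
    define F' where "F' t = - (trunc_exp 1 N (x + t) - exp (- (x + t)))" for t
    define F'' where "F'' t = trunc_exp 2 N (x + t) - exp (- (x + t))" for t
    have shift: "((\<lambda>t. trunc_exp k N (x + t)) has_real_derivative - trunc_exp (Suc k) N (x + t)) (at t)" if "k \<le> 1" for k t
      using that trunc_exp_DERIV[of N "x + t"] by (auto simp: le_Suc_eq numeral_2_eq_2 DERIV_shift add.commute[of x])
    have Fd: "(F has_real_derivative F' t) (at t)" "(F' has_real_derivative F'' t) (at t)" for t
      unfolding F_def[abs_def] F'_def[abs_def] F''_def[abs_def]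
      using shift[of 0 t] shift[of 1 t]
      by (auto intro!: derivative_eq_intros simp: numeral_2_eq_2)
    have tb: "taylor_bounded 1 (\<lambda>x. F (x 0)) (\<lambda>k x. F' (x 0)) \<beta>"
    proof (rule taylor_bounded_one[where F'' = F''])
      show "(F has_real_derivative F' t) (at t within {0..})" "(F' has_real_derivative F'' t) (at t within {0..})" for t
        by (rule has_field_derivative_at_within, rule Fd)+
    qed (use err in \<open>auto simp: F_def F'_def F''_def abs_minus_commute\<close>)
    have bnd: "\<bar>trunc_exp k N t\<bar> \<le> trunc_err N + 1" if "0 \<le> t" for k t
    proof -
      have "\<bar>trunc_exp k N t - exp (- t)\<bar> \<le> trunc_err N / (1 + t)" by (rule trunc_exp_error[OF N that])
      also have "\<dots> \<le> trunc_err N" using \<delta> that by (simp add: \<delta>_def divide_le_eq mult_le_cancel_left1)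
      finally show ?thesis using that exp_gt_zero[of "-t"] exp_le_one_iff[of "-t"] by linarith
    qed
    \<comment> \<open>The cutoff itself is not small; this crude constant serves to make the
      representation in \<open>L_op_cylinder\<close> and its integrability statements
      applicable.\<close>
    have TB: "taylor_bounded 1 (\<lambda>x. trunc_exp 0 N (x 0)) (\<lambda>k x. - trunc_exp 1 N (x 0)) (trunc_err N + 1)"
    proof (rule taylor_bounded_one[where F'' = "trunc_exp 2 N"])
      show "(trunc_exp 0 N has_real_derivative - trunc_exp 1 N t) (at t within {0..})" for t
        by (rule has_field_derivative_at_within[OF trunc_exp_DERIV(1)])
      show "((\<lambda>t. - trunc_exp 1 N t) has_real_derivative trunc_exp 2 N t) (at t within {0..})" for t
        using DERIV_minus[OF trunc_exp_DERIV(2)[of N t]] by (auto intro: has_field_derivative_at_within)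
    qed (use bnd in auto)
    let ?x = "pairings 1 (\<lambda>_. f) \<eta>" and ?v = "coords 1 (\<lambda>_. f)"
    have X: "pairings 1 (\<lambda>_. f) \<xi> 0 = pairing \<xi> f" and x0: "?x 0 = x" and v0: "?v r 0 = f r" for \<xi> r
      by (simp_all add: pairings_def coords_def x_def)
    have s1: "(\<Sum>k<1. g k) = g 0" for g :: "nat \<Rightarrow> real" by simp
    note L = L_op_cylinder[OF E \<alpha> Ca(1) m _ \<eta> TB, of "\<lambda>_. f"]
    let ?hB = "\<lambda>r. integral_B \<alpha> 1 (\<lambda>x. trunc_exp 0 N (x 0)) (\<lambda>k x. - trunc_exp 1 N (x 0)) ?x (?v r)"
    let ?hI = "\<lambda>r. integral_I \<alpha> (\<lambda>x. trunc_exp 0 N (x 0)) ?x (?v r)"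
    have Leq: "L_op \<alpha> a b m (\<lambda>\<eta>. trunc_exp 0 N (pairing \<eta> f)) \<eta> =
        pairing \<eta> (\<lambda>r. a r * ?hB r) + 1 / \<alpha> * (trunc_exp 1 N x * pairing \<eta> (\<lambda>r. b r * f r)) + pairing m ?hI"
    proof -
      have "pairing \<eta> (\<lambda>r. b r * (f r * trunc_exp 1 N x)) = trunc_exp 1 N x * pairing \<eta> (\<lambda>r. b r * f r)"
        unfolding pairing_cmult[symmetric] by (simp add: mult_ac)
      moreover have "pairing \<eta> (\<lambda>r. - (b r * (f r * trunc_exp 1 N x))) = - pairing \<eta> (\<lambda>r. b r * (f r * trunc_exp 1 N x))"
        by (simp add: pairing_def)
      ultimately show ?thesis using L(1)[of b] f by (simp add: X v0 s1 x_def[symmetric] del: One_nat_def)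
    qed
    have ediff: "exp (- (x + t)) = exp (- x) * exp (- t)" "exp (- x - t) = exp (- x) * exp (- t)" for t
      by (simp_all flip: exp_add)
    have zero: "(\<lambda>_. 0) \<in> orthant 1" "?v r \<in> orthant 1" for r using Cf(3) by (auto simp: orthant_def coords_def)
    have vV: "(\<Sum>k<1. ?v r k) \<le> V" for r using V(2)[of r] by (auto simp: v0 s1 abs_le_iff simp del: One_nat_def)
    have hB: "\<bar>?hB r - exp (- x) * (f r powr (\<alpha> + 1) / \<alpha>)\<bar> \<le> CB * \<beta>" for r
    proof -
      have e: "has_bochner_integral (n_B \<alpha>) (\<lambda>z. exp (- x) * (exp (- f r * z) - 1 + f r * z)) (exp (- x) * (f r powr (\<alpha> + 1) / \<alpha>))"
        using Cf by (intro has_bochner_integral_mult_right has_bochner_integral_n_B \<alpha>) auto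
      have i: "integrable (n_B \<alpha>) (jump_B 1 (\<lambda>x. trunc_exp 0 N (x 0)) (\<lambda>k x. - trunc_exp 1 N (x 0)) ?x (?v r))"
        using L(2) f by blast
      have "AE z in n_B \<alpha>. \<bar>jump_B 1 (\<lambda>x. trunc_exp 0 N (x 0)) (\<lambda>k x. - trunc_exp 1 N (x 0)) ?x (?v r) z
          - exp (- x) * (exp (- f r * z) - 1 + f r * z)\<bar> \<le> (2 * \<beta> * V + \<beta> * V\<^sup>2) * (z * min 1 z)"
        using AE_n_B_pos
      proof eventually_elim
        case (elim z)
        have "jump_B 1 (\<lambda>x. trunc_exp 0 N (x 0)) (\<lambda>k x. - trunc_exp 1 N (x 0)) ?x (?v r) z
          - exp (- x) * (exp (- f r * z) - 1 + f r * z) = jump_B 1 (\<lambda>x. F (x 0)) (\<lambda>k x. F' (x 0)) (\<lambda>_. 0) (?v r) z"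
          using elim by (simp add: jump_B_def x0 v0 s1 F_def F'_def ediff algebra_simps del: One_nat_def)
        then show ?case using jump_bounds(2)[OF tb zero vV elim] by simp
      qed
      then have "\<bar>\<integral>z. jump_B 1 (\<lambda>x. trunc_exp 0 N (x 0)) (\<lambda>k x. - trunc_exp 1 N (x 0)) ?x (?v r) z
          - exp (- x) * (exp (- f r * z) - 1 + f r * z) \<partial>n_B \<alpha>\<bar> \<le> (\<integral>z. (2 * \<beta> * V + \<beta> * V\<^sup>2) * (z * min 1 z) \<partial>n_B \<alpha>)"
        using i e integrable_n_B_min[OF \<alpha>]
        by (intro order_trans[OF integral_abs_bound] integral_mono_AE) (auto simp: has_bochner_integral_iff)
      also have "\<dots> = CB * \<beta>"
        unfolding CB_def WB_def Bochner_Integration.integral_mult_right_zero by (simp add: algebra_simps)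
      finally show ?thesis using i e by (simp add: integral_B_def has_bochner_integral_iff)
    qed
    have hI: "\<bar>?hI r + exp (- x) * f r powr \<alpha>\<bar> \<le> CI * \<beta>" for r
    proof -
      have e: "has_bochner_integral (n_I \<alpha>) (\<lambda>z. exp (- x) * (1 - exp (- f r * z))) (exp (- x) * f r powr \<alpha>)"
        using Cf by (intro has_bochner_integral_mult_right has_bochner_integral_n_I \<alpha>) auto
      have i: "integrable (n_I \<alpha>) (jump_I (\<lambda>x. trunc_exp 0 N (x 0)) ?x (?v r))"
        using L(3) f by blast
      have "AE z in n_I \<alpha>. \<bar>jump_I (\<lambda>x. trunc_exp 0 N (x 0)) ?x (?v r) z
          + exp (- x) * (1 - exp (- f r * z))\<bar> \<le> (2 * \<beta> + \<beta> * V) * min 1 z"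
        using AE_n_I_pos
      proof eventually_elim
        case (elim z)
        have "jump_I (\<lambda>x. trunc_exp 0 N (x 0)) ?x (?v r) z
          + exp (- x) * (1 - exp (- f r * z)) = jump_I (\<lambda>x. F (x 0)) (\<lambda>_. 0) (?v r) z"
          using elim by (simp add: jump_I_def x0 v0 F_def ediff algebra_simps del: One_nat_def)
        then show ?case using jump_bounds(1)[OF tb zero vV elim] by simp
      qed
      then have "\<bar>\<integral>z. jump_I (\<lambda>x. trunc_exp 0 N (x 0)) ?x (?v r) z
          + exp (- x) * (1 - exp (- f r * z)) \<partial>n_I \<alpha>\<bar> \<le> (\<integral>z. (2 * \<beta> + \<beta> * V) * min 1 z \<partial>n_I \<alpha>)"
        using i e integrable_n_I_min[OF \<alpha>]
        by (intro order_trans[OF integral_abs_bound] integral_mono_AE) (auto simp: has_bochner_integral_iff)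
      also have "\<dots> = CI * \<beta>"
        unfolding CI_def WI_def Bochner_Integration.integral_mult_right_zero by (simp add: algebra_simps)
      finally show ?thesis using i e by (simp add: integral_I_def has_bochner_integral_iff)
    qed
    have ca: "continuous_on UNIV (\<lambda>r. a r * (exp (- x) * (f r powr (\<alpha> + 1) / \<alpha>)))" "continuous_on UNIV (\<lambda>r. exp (- x) * f r powr \<alpha>)"
      using Ca Cf \<alpha> by (auto intro!: continuous_intros)
    have iB: "integrable \<eta> (\<lambda>r. a r * ?hB r)" "integrable m ?hI" using L(4,5) f by blast+
    have ia: "integrable \<eta> (\<lambda>r. a r * (exp (- x) * (f r powr (\<alpha> + 1) / \<alpha>)))" "integrable m (\<lambda>r. exp (- x) * f r powr \<alpha>)"
      by (rule integrable_continuous_fin_measures[OF E \<eta> ca(1)], rule integrable_continuous_fin_measures[OF E m ca(2)])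
    have T1: "\<bar>pairing \<eta> (\<lambda>r. a r * ?hB r) - pairing \<eta> (\<lambda>r. a r * (exp (- x) * (f r powr (\<alpha> + 1) / \<alpha>)))\<bar> \<le> D1 * CB * \<delta>"
    proof -
      have "\<bar>pairing \<eta> (\<lambda>r. a r * ?hB r) - pairing \<eta> (\<lambda>r. a r * (exp (- x) * (f r powr (\<alpha> + 1) / \<alpha>)))\<bar>
        = \<bar>\<integral>r. a r * ?hB r - a r * (exp (- x) * (f r powr (\<alpha> + 1) / \<alpha>)) \<partial>\<eta>\<bar>"
        using iB(1) ia(1) by (simp add: pairing_def)
      also have "\<dots> \<le> (\<integral>r. D1 * CB * \<beta> * f r \<partial>\<eta>)"
      proof (intro order_trans[OF integral_abs_bound] integral_mono)
        fix r
        have "\<bar>a r * ?hB r - a r * (exp (- x) * (f r powr (\<alpha> + 1) / \<alpha>))\<bar> = \<bar>a r\<bar> * \<bar>?hB r - exp (- x) * (f r powr (\<alpha> + 1) / \<alpha>)\<bar>"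
          by (simp only: right_diff_distrib[symmetric] abs_mult)
        also have "\<dots> \<le> (D1 * f r) * (CB * \<beta>)" by (intro mult_mono D1(2) hB) (use D1(1) Cf(3) in auto)
        finally show "\<bar>a r * ?hB r - a r * (exp (- x) * (f r powr (\<alpha> + 1) / \<alpha>))\<bar> \<le> D1 * CB * \<beta> * f r" by (simp add: mult_ac)
      qed (use iB(1) ia(1) integrable_continuous_fin_measures[OF E \<eta> Cf(1)] in auto)
      also have "\<dots> = D1 * CB * (x * \<beta>)" by (simp add: x_def pairing_def)
      also have "\<dots> \<le> D1 * CB * \<delta>" using \<beta> D1 CBI by (intro mult_left_mono) auto
      finally show ?thesis .
    qed
    have T2: "\<bar>1 / \<alpha> * (trunc_exp 1 N x * pairing \<eta> (\<lambda>r. b r * f r)) - 1 / \<alpha> * (exp (- x) * pairing \<eta> (\<lambda>r. b r * f r))\<bar> \<le> D2 / \<alpha> * \<delta>"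
    proof -
      have p: "0 \<le> pairing \<eta> (\<lambda>r. b r * f r)" using Cb Cf by (intro pairing_nonneg) auto
      have "pairing \<eta> (\<lambda>r. b r * f r) \<le> pairing \<eta> (\<lambda>r. D2 * f r)"
        using D2 Cf by (intro pairing_mono E \<eta> bf continuous_intros) (auto simp: abs_le_iff)
      then have p2: "pairing \<eta> (\<lambda>r. b r * f r) \<le> D2 * x" by (simp add: pairing_cmult x_def)
      have "\<bar>1 / \<alpha> * (trunc_exp 1 N x * pairing \<eta> (\<lambda>r. b r * f r)) - 1 / \<alpha> * (exp (- x) * pairing \<eta> (\<lambda>r. b r * f r))\<bar>
         = 1 / \<alpha> * (\<bar>trunc_exp 1 N x - exp (- x)\<bar> * pairing \<eta> (\<lambda>r. b r * f r))"
        using p \<alpha> by (simp only: right_diff_distrib[symmetric] left_diff_distrib[symmetric] abs_mult abs_of_nonneg) simp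
      also have "\<dots> \<le> 1 / \<alpha> * (\<beta> * (D2 * x))"
        using err[of 0 1] p p2 \<alpha> \<beta>(1) by (intro mult_left_mono mult_mono) auto
      also have "\<dots> = D2 / \<alpha> * (x * \<beta>)" by simp
      also have "\<dots> \<le> D2 / \<alpha> * \<delta>" using \<beta> D2 \<alpha> by (intro mult_left_mono) auto
      finally show ?thesis .
    qed
    have T3: "\<bar>pairing m ?hI - - (exp (- x) * pairing m (\<lambda>r. f r powr \<alpha>))\<bar> \<le> M * CI * \<delta>"
    proof -
      interpret m: finite_measure m using m by (rule fin_measuresD)
      have "\<bar>pairing m ?hI - - (exp (- x) * pairing m (\<lambda>r. f r powr \<alpha>))\<bar> = \<bar>\<integral>r. ?hI r + exp (- x) * f r powr \<alpha> \<partial>m\<bar>"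
        using iB(2) ia(2) by (simp add: pairing_def)
      also have "\<dots> \<le> (\<integral>r. CI * \<beta> \<partial>m)"
        using iB(2) ia(2) hI by (intro order_trans[OF integral_abs_bound] integral_mono) auto
      also have "\<dots> = M * CI * \<beta>" by (simp add: M_def pairing_def)
      also have "\<dots> \<le> M * CI * \<delta>" using \<beta> M CBI by (intro mult_left_mono) auto
      finally show ?thesis .
    qed
    have G: "exp_generator \<alpha> a b m f \<eta> = pairing \<eta> (\<lambda>r. a r * (exp (- x) * (f r powr (\<alpha> + 1) / \<alpha>)))
       + 1 / \<alpha> * (exp (- x) * pairing \<eta> (\<lambda>r. b r * f r)) + - (exp (- x) * pairing m (\<lambda>r. f r powr \<alpha>))"
    proof -
      have "pairing \<eta> (\<lambda>r. a r * (exp (- x) * (f r powr (\<alpha> + 1) / \<alpha>))) = exp (- x) / \<alpha> * pairing \<eta> (\<lambda>r. a r * f r powr (\<alpha> + 1))"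
        unfolding pairing_cmult[symmetric] by (simp add: mult_ac)
      moreover have "pairing \<eta> (\<lambda>r. a r * f r powr (\<alpha> + 1) + b r * f r) = pairing \<eta> (\<lambda>r. a r * f r powr (\<alpha> + 1)) + pairing \<eta> (\<lambda>r. b r * f r)"
        by (rule pairing_add[OF E \<eta> _ bf]) (use Ca Cf in \<open>auto intro!: continuous_intros\<close>)
      ultimately show ?thesis
        by (simp add: exp_generator_def x_def[symmetric] algebra_simps add_divide_distrib)
    qed
    show "\<bar>L_op \<alpha> a b m (\<lambda>\<eta>. trunc_exp 0 N (pairing \<eta> f)) \<eta> - exp_generator \<alpha> a b m f \<eta>\<bar> \<le> K * trunc_err N"
      using T1 T2 T3 unfolding Leq G K_def \<delta>_def[symmetric] distrib_right by linarith
  qed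
qed

section \<open>Passage to the closures\<close>

lemma integrable_mult_L2:
  assumes "f \<in> L2_space Q" "g \<in> L2_space Q"
  shows "integrable Q (\<lambda>x. f x * g x)"
proof (rule Bochner_Integration.integrable_bound)
  show "integrable Q (\<lambda>x. (f x)\<^sup>2 + (g x)\<^sup>2)" using assms by (simp add: L2_space_def)
  show "(\<lambda>x. f x * g x) \<in> borel_measurable Q" using assms unfolding L2_space_def by (intro borel_measurable_times) auto
  have "\<bar>f x * g x\<bar> \<le> (f x)\<^sup>2 + (g x)\<^sup>2" for x
  proof -
    have "2 * (\<bar>f x\<bar> * \<bar>g x\<bar>) \<le> (f x)\<^sup>2 + (g x)\<^sup>2"
      using sum_squares_bound[of "\<bar>f x\<bar>" "\<bar>g x\<bar>"] by (simp only: mult.assoc power2_abs)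
    moreover have "0 \<le> \<bar>f x\<bar> * \<bar>g x\<bar>" by simp
    ultimately show ?thesis unfolding abs_mult by linarith
  qed
  then show "AE x in Q. norm (f x * g x) \<le> norm ((f x)\<^sup>2 + (g x)\<^sup>2)" by simp
qed

lemma L2_diff: "f \<in> L2_space Q \<Longrightarrow> g \<in> L2_space Q \<Longrightarrow> (\<lambda>x. f x - g x) \<in> L2_space Q"
  using integrable_mult_L2[of f Q g]
  by (auto simp: L2_space_def power2_diff mult.assoc)

lemma L2_Cauchy_Schwarz:
  assumes "f \<in> L2_space Q" "g \<in> L2_space Q"
  shows "(\<integral>x. f x * g x \<partial>Q)\<^sup>2 \<le> (\<integral>x. (f x)\<^sup>2 \<partial>Q) * (\<integral>x. (g x)\<^sup>2 \<partial>Q)"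
proof -
  define A where "A = (\<integral>x. (f x)\<^sup>2 \<partial>Q)"
  define B where "B = (\<integral>x. (g x)\<^sup>2 \<partial>Q)"
  define C where "C = (\<integral>x. f x * g x \<partial>Q)"
  have I: "integrable Q (\<lambda>x. (f x)\<^sup>2)" "integrable Q (\<lambda>x. (g x)\<^sup>2)" "integrable Q (\<lambda>x. f x * g x)"
    using assms integrable_mult_L2[OF assms] by (auto simp: L2_space_def)
  have quad: "0 \<le> s\<^sup>2 * A + 2 * s * t * C + t\<^sup>2 * B" for s t
  proof -
    have "0 \<le> (\<integral>x. (s * f x + t * g x)\<^sup>2 \<partial>Q)" by simp
    also have "(\<lambda>x. (s * f x + t * g x)\<^sup>2) = (\<lambda>x. s\<^sup>2 * (f x)\<^sup>2 + 2 * s * t * (f x * g x) + t\<^sup>2 * (g x)\<^sup>2)"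
      by (auto simp: power2_eq_square algebra_simps)
    also have "(\<integral>x. s\<^sup>2 * (f x)\<^sup>2 + 2 * s * t * (f x * g x) + t\<^sup>2 * (g x)\<^sup>2 \<partial>Q) = s\<^sup>2 * A + 2 * s * t * C + t\<^sup>2 * B"
      using I by (simp add: A_def B_def C_def)
    finally show ?thesis .
  qed
  have AB: "0 \<le> A" "0 \<le> B" by (simp_all add: A_def B_def)
  show ?thesis
  proof (cases "B = 0")
    case True
    show ?thesis
    proof (rule ccontr)
      assume "\<not> ?thesis"
      then have C: "C \<noteq> 0" by (auto simp: A_def B_def C_def)
      \<comment> \<open>With B = 0 the quadratic expression is affine in t; the chosen t makes it
        equal to -1.\<close>
      have "0 \<le> A + 2 * (- (A + 1) / (2 * C)) * C" using quad[of 1 "- (A + 1) / (2 * C)"] True by simp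
      then show False using C by (simp add: field_simps)
    qed
  next
    case False
    \<comment> \<open>The choice s = B, t = - C is, up to scaling, the minimiser of the quadratic
      expression.\<close>
    have "0 \<le> B\<^sup>2 * A + 2 * B * (- C) * C + (- C)\<^sup>2 * B" by (rule quad)
    also have "\<dots> = B * (A * B - C\<^sup>2)" by (simp add: power2_eq_square algebra_simps)
    finally have "C\<^sup>2 \<le> A * B" using False AB by (simp add: zero_le_mult_iff)
    then show ?thesis by (simp add: A_def B_def C_def)
  qed
qed

lemma L2_inner_tendsto:
  assumes u: "\<And>n. u n \<in> L2_space Q" "f \<in> L2_space Q" "(\<lambda>n. \<integral>x. (u n x - f x)\<^sup>2 \<partial>Q) \<longlonglongrightarrow> 0"
    and v: "\<And>n. v n \<in> L2_space Q" "g \<in> L2_space Q" "(\<lambda>n. \<integral>x. (v n x - g x)\<^sup>2 \<partial>Q) \<longlonglongrightarrow> 0"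
  shows "(\<lambda>n. \<integral>x. u n x * v n x \<partial>Q) \<longlonglongrightarrow> (\<integral>x. f x * g x \<partial>Q)"
proof -
  have small: "(\<lambda>n. \<integral>x. p n x * q n x \<partial>Q) \<longlonglongrightarrow> 0"
    if "\<And>n. p n \<in> L2_space Q" "\<And>n. q n \<in> L2_space Q" "(\<lambda>n. \<integral>x. (p n x)\<^sup>2 \<partial>Q) \<longlonglongrightarrow> 0" "(\<lambda>n. \<integral>x. (q n x)\<^sup>2 \<partial>Q) \<longlonglongrightarrow> l"
    for p q :: "nat \<Rightarrow> 'a \<Rightarrow> real" and l
  proof -
    have "(\<lambda>n. (\<integral>x. p n x * q n x \<partial>Q)\<^sup>2) \<longlonglongrightarrow> 0"
    proof (rule tendsto_sandwich[where f = "\<lambda>_. 0" and h = "\<lambda>n. (\<integral>x. (p n x)\<^sup>2 \<partial>Q) * (\<integral>x. (q n x)\<^sup>2 \<partial>Q)"])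
      show "(\<lambda>n. (\<integral>x. (p n x)\<^sup>2 \<partial>Q) * (\<integral>x. (q n x)\<^sup>2 \<partial>Q)) \<longlonglongrightarrow> 0"
        using tendsto_mult[OF that(3,4)] by simp
    qed (use L2_Cauchy_Schwarz[OF that(1,2)] in auto)
    from tendsto_real_sqrt[OF this] show ?thesis by (simp add: tendsto_rabs_zero_iff)
  qed
  note du = L2_diff[OF u(1,2)] and dv = L2_diff[OF v(1,2)]
  have 1: "(\<lambda>n. \<integral>x. (u n x - f x) * (v n x - g x) \<partial>Q) \<longlonglongrightarrow> 0" by (rule small[OF du dv u(3) v(3)])
  have 2: "(\<lambda>n. \<integral>x. (u n x - f x) * g x \<partial>Q) \<longlonglongrightarrow> 0" by (rule small[OF du v(2) u(3) tendsto_const])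
  have 3: "(\<lambda>n. \<integral>x. (v n x - g x) * f x \<partial>Q) \<longlonglongrightarrow> 0" by (rule small[OF dv u(2) v(3) tendsto_const])
  have "(\<integral>x. u n x * v n x \<partial>Q) = (\<integral>x. (u n x - f x) * (v n x - g x) \<partial>Q) + (\<integral>x. (u n x - f x) * g x \<partial>Q)
     + (\<integral>x. (v n x - g x) * f x \<partial>Q) + (\<integral>x. f x * g x \<partial>Q)" for n
  proof -
    have "u n x * v n x = (u n x - f x) * (v n x - g x) + (u n x - f x) * g x + (v n x - g x) * f x + f x * g x" for x
      by (simp add: algebra_simps)
    then show ?thesis
      using integrable_mult_L2[OF du[of n] dv[of n]] integrable_mult_L2[OF du[of n] v(2)] integrable_mult_L2[OF dv[of n] u(2)]
        integrable_mult_L2[OF u(2) v(2)]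
      by (simp only: Bochner_Integration.integral_add Bochner_Integration.integrable_add)
  qed
  moreover have "(\<lambda>n. (\<integral>x. (u n x - f x) * (v n x - g x) \<partial>Q) + (\<integral>x. (u n x - f x) * g x \<partial>Q)
     + (\<integral>x. (v n x - g x) * f x \<partial>Q) + (\<integral>x. f x * g x \<partial>Q)) \<longlonglongrightarrow> 0 + 0 + 0 + (\<integral>x. f x * g x \<partial>Q)"
    by (intro tendsto_add 1 2 3 tendsto_const)
  ultimately show ?thesis by simp
qed

text \<open>A relation between a function and a candidate for its image, not a property of an
  operator. In this form the inequality can be carried through closures of graphs.\<close>

definition poincare_pair :: "'b measure \<Rightarrow> real \<Rightarrow> ('b \<Rightarrow> real) \<Rightarrow> ('b \<Rightarrow> real) \<Rightarrow> bool" where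
  "poincare_pair Q \<kappa> f g \<longleftrightarrow> prob_space.variance Q f \<le> \<kappa> * (\<integral>x. - g x * f x \<partial>Q)"

text \<open>Both sides are continuous for mean-square convergence: the variance is an inner product
  minus the square of the inner product with the constant 1, which is square integrable under a
  probability measure.\<close>

lemma poincare_pair_closed:
  assumes Q: "prob_space Q"
    and u: "\<And>n. u n \<in> L2_space Q" "f \<in> L2_space Q" "(\<lambda>n. \<integral>x. (u n x - f x)\<^sup>2 \<partial>Q) \<longlonglongrightarrow> 0"
    and v: "\<And>n. v n \<in> L2_space Q" "g \<in> L2_space Q" "(\<lambda>n. \<integral>x. (v n x - g x)\<^sup>2 \<partial>Q) \<longlonglongrightarrow> 0"
    and P: "\<And>n. poincare_pair Q \<kappa> (u n) (v n)"
  shows "poincare_pair Q \<kappa> f g"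
proof -
  interpret Q: prob_space Q by fact
  have one: "(\<lambda>_. 1) \<in> L2_space Q" by (simp add: L2_space_def)
  have int: "integrable Q h" "integrable Q (\<lambda>x. (h x)\<^sup>2)" if "h \<in> L2_space Q" for h
    using integrable_mult_L2[OF that one] that by (auto simp: L2_space_def)
  have var: "Q.variance h = (\<integral>x. h x * h x \<partial>Q) - (\<integral>x. h x * 1 \<partial>Q)\<^sup>2" if "h \<in> L2_space Q" for h
    using Q.variance_eq[OF int[OF that]] by (simp add: power2_eq_square)
  have "(\<lambda>n. Q.variance (u n)) \<longlonglongrightarrow> Q.variance f"
    unfolding var[OF u(1)] var[OF u(2)]
    by (intro tendsto_diff tendsto_power L2_inner_tendsto u one) simp
  moreover have "(\<lambda>n. \<kappa> * (\<integral>x. - v n x * u n x \<partial>Q)) \<longlonglongrightarrow> \<kappa> * (\<integral>x. - g x * f x \<partial>Q)"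
    unfolding mult_minus_left Bochner_Integration.integral_minus
    by (intro tendsto_mult tendsto_minus tendsto_const L2_inner_tendsto u v)
  ultimately show ?thesis
    unfolding poincare_pair_def by (rule LIMSEQ_le) (use P in \<open>auto simp: poincare_pair_def\<close>)
qed

section \<open>From uniform limits to mean-square limits\<close>

lemma C_inf_L2:
  assumes Q: "prob_space Q" "sets Q = sets borel_weak" and \<Phi>: "\<Phi> \<in> C_inf"
  shows "\<Phi> \<in> L2_space Q"
proof -
  interpret Q: prob_space Q by fact
  obtain B where B: "0 < B" "\<And>\<eta>. \<eta> \<in> fin_measures \<Longrightarrow> \<bar>\<Phi> \<eta>\<bar> \<le> B" using C_inf_bounded[OF \<Phi>] by blast
  have [measurable]: "\<Phi> \<in> borel_measurable Q"
    using \<Phi> Q(2) by (intro measurable_continuous_map_weak) (auto simp: C_inf_def)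
  have "integrable Q (\<lambda>\<eta>. (\<Phi> \<eta>)\<^sup>2)"
  proof (rule Q.integrable_const_bound[where B = "B\<^sup>2"])
    show "AE \<eta> in Q. norm ((\<Phi> \<eta>)\<^sup>2) \<le> B\<^sup>2"
    proof (intro AE_I2)
      fix \<eta> assume "\<eta> \<in> space Q"
      then have "\<bar>\<Phi> \<eta>\<bar> \<le> B" using B(2) by (simp add: space_borel_weak[OF Q(2)])
      from power_mono[OF this abs_ge_zero, of 2] show "norm ((\<Phi> \<eta>)\<^sup>2) \<le> B\<^sup>2" by simp
    qed
  qed simp
  then show ?thesis by (simp add: L2_space_def)
qed

lemma uniform_limit_L2:
  assumes Q: "prob_space Q" "sets Q = sets borel_weak" and u: "\<And>n. u n \<in> C_inf" and \<Phi>: "\<Phi> \<in> C_inf"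
    and lim: "uniform_limit fin_measures u \<Phi> sequentially"
  shows "(\<lambda>n. \<integral>\<eta>. (u n \<eta> - \<Phi> \<eta>)\<^sup>2 \<partial>Q) \<longlonglongrightarrow> 0"
proof (rule LIMSEQ_I)
  interpret Q: prob_space Q by fact
  have sp: "space Q = fin_measures" using space_borel_weak[OF Q(2)] .
  fix r :: real assume r: "0 < r"
  have "\<forall>\<^sub>F n in sequentially. \<forall>\<eta>\<in>fin_measures. dist (u n \<eta>) (\<Phi> \<eta>) < sqrt (r / 2)"
    using lim r by (intro uniform_limitD) auto
  then obtain M where M: "\<And>n \<eta>. M \<le> n \<Longrightarrow> \<eta> \<in> fin_measures \<Longrightarrow> \<bar>u n \<eta> - \<Phi> \<eta>\<bar> < sqrt (r / 2)"
    by (auto simp: eventually_sequentially dist_real_def)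
  show "\<exists>M. \<forall>n\<ge>M. norm ((\<integral>\<eta>. (u n \<eta> - \<Phi> \<eta>)\<^sup>2 \<partial>Q) - 0) < r"
  proof (intro exI[of _ M] allI impI)
    fix n assume n: "M \<le> n"
    have "(\<integral>\<eta>. (u n \<eta> - \<Phi> \<eta>)\<^sup>2 \<partial>Q) \<le> (\<integral>\<eta>. r / 2 \<partial>Q)"
    proof (rule integral_mono)
      show "integrable Q (\<lambda>\<eta>. (u n \<eta> - \<Phi> \<eta>)\<^sup>2)"
        using L2_diff[OF C_inf_L2[OF Q u[of n]] C_inf_L2[OF Q \<Phi>]] by (simp add: L2_space_def)
      fix \<eta> assume "\<eta> \<in> space Q"
      then have "\<bar>u n \<eta> - \<Phi> \<eta>\<bar> \<le> sqrt (r / 2)" using M[OF n] sp less_imp_le by blast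
      from power_mono[OF this abs_ge_zero, of 2] show "(u n \<eta> - \<Phi> \<eta>)\<^sup>2 \<le> r / 2" using r by simp
    qed simp
    also have "\<dots> = r / 2" by (simp add: Q.prob_space)
    finally show "norm ((\<integral>\<eta>. (u n \<eta> - \<Phi> \<eta>)\<^sup>2 \<partial>Q) - 0) < r" using r by simp
  qed
qed

lemma poincare_pair_closure_C_inf:
  assumes Q: "prob_space Q" "sets Q = sets borel_weak"
    and R: "\<And>\<Phi> \<Theta>. (\<Phi>, \<Theta>) \<in> R \<Longrightarrow> \<Phi> \<in> C_inf \<and> \<Theta> \<in> C_inf \<and> poincare_pair Q \<kappa> \<Phi> \<Theta>"
    and "(\<Phi>, \<Theta>) \<in> closure_C_inf R"
  shows "poincare_pair Q \<kappa> \<Phi> \<Theta>"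
proof -
  obtain u v where uv: "\<Phi> \<in> C_inf" "\<Theta> \<in> C_inf" "\<And>n. (u n, v n) \<in> R"
    "uniform_limit fin_measures u \<Phi> sequentially" "uniform_limit fin_measures v \<Theta> sequentially"
    using assms(4) unfolding closure_C_inf_def by blast
  show ?thesis
    by (rule poincare_pair_closed[OF Q(1), of u \<Phi> v \<Theta>])
       (use R[OF uv(3)] uv C_inf_L2[OF Q] uniform_limit_L2[OF Q] in auto)
qed

section \<open>The generator as a linear relation\<close>

lemma C_inf_lincomb:
  assumes "\<Phi> \<in> C_inf" "\<Theta> \<in> C_inf"
  shows "(\<lambda>\<eta>. \<Phi> \<eta> + c * \<Theta> \<eta>) \<in> C_inf"
  unfolding C_inf_def mem_Collect_eq
proof (intro conjI allI impI)
  show "continuous_map weak_topology euclideanreal (\<lambda>\<eta>. \<Phi> \<eta> + c * \<Theta> \<eta>)"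
    using assms by (intro continuous_map_add continuous_map_real_mult) (auto simp: C_inf_def)
  fix \<epsilon> :: real assume \<epsilon>: "0 < \<epsilon>"
  \<comment> \<open>Using \<bar>c\<bar> + 1 in place of \<bar>c\<bar> avoids a separate case c =
    0.\<close>
  then have "0 < \<epsilon> / 2" "0 < \<epsilon> / (2 * (\<bar>c\<bar> + 1))" by (auto intro!: divide_pos_pos add_nonneg_pos)
  then obtain K1 K2 where K: "compactin weak_topology K1" "\<And>\<eta>. \<eta> \<in> fin_measures - K1 \<Longrightarrow> \<bar>\<Phi> \<eta>\<bar> < \<epsilon> / 2"
    "compactin weak_topology K2" "\<And>\<eta>. \<eta> \<in> fin_measures - K2 \<Longrightarrow> \<bar>\<Theta> \<eta>\<bar> < \<epsilon> / (2 * (\<bar>c\<bar> + 1))"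
    using assms unfolding C_inf_def mem_Collect_eq by meson
  show "\<exists>K. compactin weak_topology K \<and> (\<forall>\<eta>\<in>fin_measures - K. \<bar>\<Phi> \<eta> + c * \<Theta> \<eta>\<bar> < \<epsilon>)"
  proof (intro exI[of _ "K1 \<union> K2"] conjI ballI)
    show "compactin weak_topology (K1 \<union> K2)" using K by (intro compactin_Un)
    fix \<eta> assume "\<eta> \<in> fin_measures - (K1 \<union> K2)"
    then have \<eta>: "\<bar>\<Phi> \<eta>\<bar> < \<epsilon> / 2" "\<bar>\<Theta> \<eta>\<bar> < \<epsilon> / (2 * (\<bar>c\<bar> + 1))" using K by auto
    have "\<bar>c * \<Theta> \<eta>\<bar> \<le> (\<bar>c\<bar> + 1) * \<bar>\<Theta> \<eta>\<bar>" by (simp add: abs_mult distrib_right)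
    also have "\<dots> \<le> (\<bar>c\<bar> + 1) * (\<epsilon> / (2 * (\<bar>c\<bar> + 1)))" using \<eta>(2) by (intro mult_left_mono) auto
    also have "\<dots> = \<epsilon> / 2" by (simp add: field_simps add_eq_0_iff)
    finally show "\<bar>\<Phi> \<eta> + c * \<Theta> \<eta>\<bar> < \<epsilon>" using \<eta>(1) by linarith
  qed
qed

lemma C_inf_zero: "(\<lambda>_. 0) \<in> C_inf"
  by (rule C_inf_compact_support[of _ "{}"]) auto

lemma C0_semigroup_linear:
  assumes "C0_semigroup T" "0 \<le> t" "\<Phi> \<in> C_inf" "\<Theta> \<in> C_inf" "\<eta> \<in> fin_measures"
  shows "T t (\<lambda>\<xi>. c * \<Phi> \<xi> + d * \<Theta> \<xi>) \<eta> = c * T t \<Phi> \<eta> + d * T t \<Theta> \<eta>"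
  using assms(1)[unfolded C0_semigroup_def, THEN conjunct2, THEN conjunct1] assms(2-) by blast

lemma generator_lincomb:
  assumes T: "C0_semigroup T" and 1: "(\<Phi>, \<Theta>) \<in> generator T" and 2: "(\<Phi>', \<Theta>') \<in> generator T"
  shows "(\<lambda>\<eta>. \<Phi> \<eta> + c * \<Phi>' \<eta>, \<lambda>\<eta>. \<Theta> \<eta> + c * \<Theta>' \<eta>) \<in> generator T"
proof -
  note C = 1[unfolded generator_def, simplified] 2[unfolded generator_def, simplified]
  have lin: "T t (\<lambda>\<xi>. \<Phi> \<xi> + c * \<Phi>' \<xi>) \<eta> = T t \<Phi> \<eta> + c * T t \<Phi>' \<eta>" if "0 \<le> t" "\<eta> \<in> fin_measures" for t \<eta>
    using C0_semigroup_linear[OF T that(1) _ _ that(2), of \<Phi> \<Phi>' 1 c] C by simp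
  have "uniform_limit fin_measures (\<lambda>t \<eta>. (T t \<Phi> \<eta> - \<Phi> \<eta>) / t + c * ((T t \<Phi>' \<eta> - \<Phi>' \<eta>) / t)) (\<lambda>\<eta>. \<Theta> \<eta> + c * \<Theta>' \<eta>) (at_right 0)"
    using C by (intro uniform_limit_add bounded_linear.uniform_limit[OF bounded_linear_mult_right]) auto
  then have "uniform_limit fin_measures (\<lambda>t \<eta>. (T t (\<lambda>\<xi>. \<Phi> \<xi> + c * \<Phi>' \<xi>) \<eta> - (\<Phi> \<eta> + c * \<Phi>' \<eta>)) / t) (\<lambda>\<eta>. \<Theta> \<eta> + c * \<Theta>' \<eta>) (at_right 0)"
  proof (rule uniform_limit_cong[THEN iffD1, rotated 2])
    show "\<forall>\<^sub>F t in at_right 0. \<forall>\<eta>\<in>fin_measures. (T t \<Phi> \<eta> - \<Phi> \<eta>) / t + c * ((T t \<Phi>' \<eta> - \<Phi>' \<eta>) / t) =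
        (T t (\<lambda>\<xi>. \<Phi> \<xi> + c * \<Phi>' \<xi>) \<eta> - (\<Phi> \<eta> + c * \<Phi>' \<eta>)) / t"
      using eventually_at_right_less[of "0::real"]
      by eventually_elim (simp add: lin diff_divide_distrib add_divide_distrib right_diff_distrib)
  qed simp
  then show ?thesis using C C_inf_lincomb[of \<Phi> \<Phi>' c] C_inf_lincomb[of \<Theta> \<Theta>' c] by (simp add: generator_def)
qed

lemma generator_zero:
  assumes T: "C0_semigroup T"
  shows "(\<lambda>_. 0, \<lambda>_. 0) \<in> generator T"
proof -
  have "T t (\<lambda>_. 0) \<eta> = 0" if "0 \<le> t" "\<eta> \<in> fin_measures" for t \<eta>
    using C0_semigroup_linear[OF T that(1) C_inf_zero C_inf_zero that(2), of 0 0] by simp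
  then have "\<forall>\<^sub>F t in at_right 0. \<forall>\<eta>\<in>fin_measures. (T t (\<lambda>_. 0) \<eta> - 0) / t = 0"
    using eventually_at_right_less[of "0::real"] by (auto elim!: eventually_mono)
  then have "uniform_limit fin_measures (\<lambda>t \<eta>. (T t (\<lambda>_. 0) \<eta> - 0) / t) (\<lambda>_. 0) (at_right 0)"
    by (intro uniform_limitI) (auto elim!: eventually_mono)
  then show ?thesis using C_inf_zero by (simp add: generator_def)
qed

lemma generator_sum:
  fixes n :: nat
  assumes "C0_semigroup T" "\<And>i. i < n \<Longrightarrow> (\<Phi> i, \<Theta> i) \<in> generator T"
  shows "(\<lambda>\<eta>. \<Sum>i<n. c i * \<Phi> i \<eta>, \<lambda>\<eta>. \<Sum>i<n. c i * \<Theta> i \<eta>) \<in> generator T"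
  using assms(2)
proof (induction n)
  case 0
  then show ?case using generator_zero[OF assms(1)] by simp
next
  case (Suc n)
  then show ?case using generator_lincomb[OF assms(1), of "\<lambda>\<eta>. \<Sum>i<n. c i * \<Phi> i \<eta>" "\<lambda>\<eta>. \<Sum>i<n. c i * \<Theta> i \<eta>" "\<Phi> n" "\<Theta> n" "c n"] by simp
qed

text \<open>Uniform convergence determines the image pointwise, but only on
  \<open>fin_measures\<close>; values elsewhere are arbitrary by the encoding. This suffices because
  \<open>fin_measures\<close> is the whole space of \<open>Q\<close>.\<close>

lemma generator_unique:
  assumes "(\<Phi>, \<Theta>) \<in> generator T" "(\<Phi>, \<Theta>') \<in> generator T" "\<eta> \<in> fin_measures"
  shows "\<Theta> \<eta> = \<Theta>' \<eta>"
proof (rule tendsto_unique)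
  show "((\<lambda>t. (T t \<Phi> \<eta> - \<Phi> \<eta>) / t) \<longlongrightarrow> \<Theta> \<eta>) (at_right 0)" "((\<lambda>t. (T t \<Phi> \<eta> - \<Phi> \<eta>) / t) \<longlongrightarrow> \<Theta>' \<eta>) (at_right 0)"
    using assms by (auto simp: generator_def intro: tendsto_uniform_limitI)
qed simp

lemma exp_in_D_exp: "f \<in> C_pp \<Longrightarrow> (\<lambda>\<eta>. exp (- pairing \<eta> f)) \<in> D_exp"
  unfolding D_exp_def mem_Collect_eq
  by (intro exI[of _ 1] exI[of _ "\<lambda>_. 1"] exI[of _ "\<lambda>_. f"]) auto

text \<open>Besides the uniform limits, the limiting image has to be shown to lie in
  \<open>C_inf\<close>. Its continuity is visible in the explicit formula, and its decay is borrowed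
  from a uniformly close approximant \<open>L (u n)\<close>.\<close>

lemma exp_generator_closure:
  fixes f :: "'a::metric_space \<Rightarrow> real"
  assumes E: "compact (UNIV :: 'a set)" and \<alpha>: "0 < \<alpha>" "\<alpha> < 1" and a: "a \<in> C_pp" and b: "b \<in> C_pp"
    and m: "m \<in> fin_measures" and f: "f \<in> C_pp"
    and exp: "\<And>f :: 'a \<Rightarrow> real. f \<in> C_pp \<Longrightarrow> (\<lambda>\<eta>. exp (- pairing \<eta> f)) \<in> C_inf"
  shows "(\<lambda>\<eta>. exp (- pairing \<eta> f), exp_generator \<alpha> a b m f) \<in> closure_C_inf (op_graph (L_op \<alpha> a b m) F_class)"
proof -
  define u where "u n = (\<lambda>\<eta>. trunc_exp 0 (real n) (pairing \<eta> f))" for n :: nat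
  define L where "L = L_op \<alpha> a b m"
  have u: "u n \<in> F_class" for n unfolding u_def by (rule trunc_exp_F_class[OF f])
  have LC: "L (u n) \<in> C_inf" for n
    unfolding L_def by (rule L_op_F_class_C_inf(2)[OF E \<alpha> C_ppD(1)[OF a] C_ppD(1)[OF b] m exp u])
  obtain K where K: "0 \<le> K" "\<And>N \<eta>. 0 \<le> N \<Longrightarrow> \<eta> \<in> fin_measures \<Longrightarrow>
     \<bar>L_op \<alpha> a b m (\<lambda>\<eta>. trunc_exp 0 N (pairing \<eta> f)) \<eta> - exp_generator \<alpha> a b m f \<eta>\<bar> \<le> K * trunc_err N"
    by (rule L_op_trunc_exp[OF E \<alpha> a b m f]) blast
  have lim: "uniform_limit fin_measures v l sequentially"
    if "0 \<le> C" "\<And>n \<eta>. \<eta> \<in> fin_measures \<Longrightarrow> \<bar>v n \<eta> - l \<eta>\<bar> \<le> C * trunc_err (real n)"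
    for v :: "nat \<Rightarrow> 'a measure \<Rightarrow> real" and l C
  proof (rule uniform_limitI)
    fix e :: real assume "0 < e"
    have "(\<lambda>n. C * trunc_err (real n)) \<longlonglongrightarrow> 0"
      using trunc_err_tendsto by (rule tendsto_mult_right_zero)
    from order_tendstoD(2)[OF this \<open>0 < e\<close>]
    show "\<forall>\<^sub>F n in sequentially. \<forall>\<eta>\<in>fin_measures. dist (v n \<eta>) (l \<eta>) < e"
      by eventually_elim (use that(2) in \<open>auto simp: dist_real_def intro: le_less_trans\<close>)
  qed
  have l1: "uniform_limit fin_measures u (\<lambda>\<eta>. exp (- pairing \<eta> f)) sequentially"
  proof (rule lim[of 1])
    fix n and \<eta> :: "'a measure"
    have p: "0 \<le> pairing \<eta> f" using C_ppD[OF f] by (simp add: pairing_nonneg)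
    have "\<bar>u n \<eta> - exp (- pairing \<eta> f)\<bar> \<le> trunc_err (real n) / (1 + pairing \<eta> f)"
      unfolding u_def using p by (intro trunc_exp_error) auto
    also have "\<dots> \<le> trunc_err (real n)"
    proof -
      have "0 \<le> trunc_err (real n)" by (simp add: trunc_err_def)
      then show ?thesis using p by (simp add: divide_le_eq distrib_left)
    qed
    finally show "\<bar>u n \<eta> - exp (- pairing \<eta> f)\<bar> \<le> 1 * trunc_err (real n)" by simp
  qed simp
  have l2: "uniform_limit fin_measures (\<lambda>n. L (u n)) (exp_generator \<alpha> a b m f) sequentially"
    unfolding L_def u_def by (rule lim[OF K(1)]) (rule K(2), auto)
  have "continuous_map weak_topology euclideanreal (exp_generator \<alpha> a b m f)"
  proof -
    have c: "continuous_map weak_topology euclideanreal (\<lambda>\<eta>. exp (- pairing \<eta> f))"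
      using exp[OF f] by (simp add: C_inf_def)
    have "continuous_on UNIV (\<lambda>r. a r * f r powr (\<alpha> + 1) + b r * f r)"
      using C_ppD[OF a] C_ppD[OF b] C_ppD[OF f] by (auto intro!: continuous_intros)
    from continuous_map_pairing[OF E this]
    have "continuous_map weak_topology euclideanreal (\<lambda>\<eta>. exp (- pairing \<eta> f) *
       (1 / \<alpha> * pairing \<eta> (\<lambda>r. a r * f r powr (\<alpha> + 1) + b r * f r) - pairing m (\<lambda>r. f r powr \<alpha>)))"
      using c by (intro continuous_map_real_mult continuous_map_diff) auto
    then show ?thesis by (simp add: exp_generator_def[abs_def])
  qed
  moreover have "\<exists>K. compactin weak_topology K \<and> (\<forall>\<eta>\<in>fin_measures - K. \<bar>exp_generator \<alpha> a b m f \<eta>\<bar> < \<epsilon>)" if "0 < \<epsilon>" for \<epsilon>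
  proof -
    have "0 < \<epsilon> / 2" using that by simp
    from uniform_limitD[OF l2 this] obtain n where n: "\<And>\<eta>. \<eta> \<in> fin_measures \<Longrightarrow> \<bar>L (u n) \<eta> - exp_generator \<alpha> a b m f \<eta>\<bar> < \<epsilon> / 2"
      by (auto simp: eventually_sequentially dist_real_def)
    obtain K where K: "compactin weak_topology K" "\<And>\<eta>. \<eta> \<in> fin_measures - K \<Longrightarrow> \<bar>L (u n) \<eta>\<bar> < \<epsilon> / 2"
      using LC[of n] \<open>0 < \<epsilon> / 2\<close> unfolding C_inf_def mem_Collect_eq by meson
    have "\<bar>exp_generator \<alpha> a b m f \<eta>\<bar> < \<epsilon>" if "\<eta> \<in> fin_measures - K" for \<eta>
    proof -
      have "\<bar>L (u n) \<eta> - exp_generator \<alpha> a b m f \<eta>\<bar> < \<epsilon> / 2" using that by (intro n) simp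
      with K(2)[OF that] show ?thesis by linarith
    qed
    then show ?thesis using K(1) by blast
  qed
  ultimately have "exp_generator \<alpha> a b m f \<in> C_inf" by (simp add: C_inf_def)
  moreover have "(u n, L (u n)) \<in> op_graph L F_class" for n using u by (auto simp: op_graph_def)
  ultimately show ?thesis
    unfolding closure_C_inf_def L_def[symmetric] mem_Collect_eq prod.case using exp[OF f] l1 l2
    by (intro conjI exI[of _ u] exI[of _ "\<lambda>n. L (u n)"] allI)
qed

section \<open>Essential bounds and the spectral gap\<close>

lemma AE_essinf:
  "f \<in> borel_measurable M \<Longrightarrow> AE x in M. essinf M f \<le> f x"
proof -
  assume f: "f \<in> borel_measurable M"
  then have "essinf M f = - esssup M (\<lambda>x. - f x)"
    using ereal_Liminf_uminus[of "ae_filter M" "\<lambda>x. - f x"] by (simp add: essinf_def esssup_def)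
  then show ?thesis using esssup_AE[where M = M and f = "\<lambda>x. - f x"]
    by (auto elim!: eventually_mono simp: ereal_uminus_le_reorder)
qed

theorem theorem3p2:
  fixes \<alpha> \<gamma> :: real
    and a b :: "'a::metric_space \<Rightarrow> real"
    and m :: "'a measure"
    and \<Lambda> :: "real measure"
    and T :: "real \<Rightarrow> ('a measure \<Rightarrow> real) \<Rightarrow> ('a measure \<Rightarrow> real)"
    and Q :: "'a measure measure"
  assumes compact_E: "compact (UNIV :: 'a set)"
    and alpha: "0 < \<alpha>" "\<alpha> < 1"
    and a: "a \<in> C_pp"
    and b: "b \<in> C_pp"
    and m: "m \<in> nonnull_measures"
    and Lambda: "is_Lambda \<alpha> \<Lambda>"
    and semigroup: "C0_semigroup T"
    and generator_T: "generator T = closure_C_inf (op_graph (L_op \<alpha> a b m) F_class)"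
    and core: "is_core D_exp (generator T)"
    and stationary_Q: "stationary T Q"
    and Q_nonnull: "AE \<eta> in Q. \<eta> \<in> nonnull_measures"
    and Q_Laplace: "\<And>f. f \<in> B_plus \<Longrightarrow>
      (\<integral>\<eta>. exp (- pairing \<eta> f) \<partial>Q)
        = exp (- pairing m (\<lambda>r. inverse (a r) * ln (1 + a r * inverse (b r) * f r powr \<alpha>)))"
    and closable: "closable_L2 Q (op_graph (L_op \<alpha> a b m) F_class)"
    and gamma: "0 < \<gamma>"
    and one_dim: "\<And>F. F \<in> D_exp_real \<Longrightarrow>
      (\<integral>\<^sup>+z. ennreal ((F z - F 0)\<^sup>2) \<partial>\<Lambda>)
        \<le> ennreal (\<gamma> / 2) *
          ((\<integral>\<^sup>+z. ennreal z * (\<integral>\<^sup>+y. ennreal ((F (z + y) - F z)\<^sup>2) \<partial>n_B \<alpha>) \<partial>\<Lambda>)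
           + (\<integral>\<^sup>+y. ennreal ((F y - F 0)\<^sup>2) \<partial>n_I \<alpha>))"
  shows "(\<forall>\<Psi>\<in>D_exp. ereal (prob_space.variance Q \<Psi>)
            \<le> ereal \<gamma> * esssup m (\<lambda>r. ereal (inverse (b r))) * ereal (energy \<alpha> a b m Q \<Psi>))
       \<and> gap \<alpha> a b m Q \<ge> ereal (inverse \<gamma>) * essinf m (\<lambda>r. ereal (b r))"
proof -
  let ?L = "L_op \<alpha> a b m"
  let ?R = "op_graph ?L F_class"
  have mf: "m \<in> fin_measures" and m0: "emeasure m UNIV \<noteq> 0" using m by (auto simp: nonnull_measures_def)
  have Q: "prob_space Q" "sets Q = sets borel_weak" using stationary_Q by (auto simp: stationary_def)
  interpret Q: prob_space Q by (rule Q)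
  have sp: "space Q = fin_measures" using space_borel_weak[OF Q(2)] .
  have Lap: "(\<integral>\<eta>. exp (- pairing \<eta> f) \<partial>Q) = exp (- laplace_exponent \<alpha> a b m f)" if "f \<in> B_plus" for f
    unfolding laplace_exponent_def by (rule Q_Laplace[OF that])
  have gen_C: "\<Phi> \<in> C_inf \<and> \<Theta> \<in> C_inf" if "(\<Phi>, \<Theta>) \<in> generator T" for \<Phi> \<Theta>
    using that by (auto simp: generator_def)
  have D_dom: "D_exp \<subseteq> Domain (generator T)" using core by (simp add: is_core_def)
  \<comment> \<open>The core hypothesis is the source of all compact sets of measures in the
    argument: it puts the exponentials into the domain of the generator, hence into
    \<open>C_inf\<close>.\<close>
  have expC: "(\<lambda>\<eta>. exp (- pairing \<eta> f)) \<in> C_inf" if "f \<in> C_pp" for f :: "'a \<Rightarrow> real"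
    using D_dom exp_in_D_exp[OF that] gen_C by blast
  have gen_exp: "(\<lambda>\<eta>. exp (- pairing \<eta> f), exp_generator \<alpha> a b m f) \<in> generator T" if "f \<in> C_pp" for f
    unfolding generator_T by (rule exp_generator_closure[OF compact_E alpha a b mf that expC])
  have F_C: "\<Phi> \<in> C_inf" "?L \<Phi> \<in> C_inf" if "\<Phi> \<in> F_class" for \<Phi>
    using L_op_F_class_C_inf[OF compact_E alpha C_ppD(1)[OF a] C_ppD(1)[OF b] mf _ that] expC by blast+
  have gen_F: "(\<Phi>, ?L \<Phi>) \<in> generator T" if "\<Phi> \<in> F_class" for \<Phi>
  proof -
    have "(\<Phi>, ?L \<Phi>) \<in> ?R" using that by (auto simp: op_graph_def)
    then show ?thesis
      unfolding generator_T closure_C_inf_def mem_Collect_eq prod.case using F_C[OF that]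
      by (intro conjI exI[of _ "\<lambda>_. \<Phi>"] exI[of _ "\<lambda>_. ?L \<Phi>"] allI uniform_limit_const)
  qed
  have main: "Q.variance \<Psi> \<le> \<gamma> * S * energy \<alpha> a b m Q \<Psi>"
    if S: "AE r in m. inverse (b r) \<le> S" and \<Psi>: "\<Psi> \<in> Lbar_dom \<alpha> a b m Q" for S \<Psi>
  proof -
    have D: "poincare_pair Q (\<gamma> * S) \<Phi> \<Theta>" if "(\<Phi>, \<Theta>) \<in> generator T" "\<Phi> \<in> D_exp" for \<Phi> \<Theta>
    proof -
      obtain n :: nat and c f where f: "\<And>i. i < n \<Longrightarrow> f i \<in> C_pp" "\<Phi> = (\<lambda>\<eta>. \<Sum>i<n. c i * exp (- pairing \<eta> (f i)))"
        using \<open>\<Phi> \<in> D_exp\<close> unfolding D_exp_def by blast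
      have "(\<Phi>, \<lambda>\<eta>. \<Sum>i<n. c i * exp_generator \<alpha> a b m (f i) \<eta>) \<in> generator T"
        unfolding f(2) by (intro generator_sum semigroup gen_exp f(1))
      \<comment> \<open>The image of a combination is identified only on
        \<open>fin_measures\<close>, which is enough for the integral against
        \<open>Q\<close>.\<close>
      then have eq: "\<Theta> \<eta> = (\<Sum>i<n. c i * exp_generator \<alpha> a b m (f i) \<eta>)" if "\<eta> \<in> fin_measures" for \<eta>
        using generator_unique[OF \<open>(\<Phi>, \<Theta>) \<in> generator T\<close> _ that] by blast
      have "(\<integral>\<eta>. - \<Theta> \<eta> * \<Phi> \<eta> \<partial>Q) = (\<integral>\<eta>. - (\<Sum>i<n. c i * exp_generator \<alpha> a b m (f i) \<eta>) * (\<Sum>i<n. c i * exp (- pairing \<eta> (f i))) \<partial>Q)"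
        by (intro Bochner_Integration.integral_cong refl) (simp add: eq sp f(2))
      then show ?thesis
        using variance_le_exp_generator[OF compact_E a b mf Lambda alpha gamma one_dim Q Lap f(1) S, where n = n and c = c]
        unfolding poincare_pair_def f(2) by simp
    qed
    \<comment> \<open>The core property extends the inequality from \<open>D_exp\<close> to every
      pair in the generator. With \<open>gen_F\<close> this reaches \<open>F_class\<close>, on which
      the mean-square closure is built.\<close>
    have gen: "poincare_pair Q (\<gamma> * S) \<Phi> \<Theta>" if "(\<Phi>, \<Theta>) \<in> generator T" for \<Phi> \<Theta>
    proof (rule poincare_pair_closure_C_inf[OF Q])
      show "(\<Phi>, \<Theta>) \<in> closure_C_inf {(\<Phi>, \<Theta>) \<in> generator T. \<Phi> \<in> D_exp}"
        using core that by (simp add: is_core_def)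
    qed (use D gen_C in auto)
    have "(\<Psi>, Lbar \<alpha> a b m Q \<Psi>) \<in> Lbar_graph \<alpha> a b m Q"
      using \<Psi> unfolding Lbar_dom_def Lbar_def by (blast intro: someI[where P = "\<lambda>\<Theta>. (\<Psi>, \<Theta>) \<in> Lbar_graph \<alpha> a b m Q"])
    then obtain u v where uv: "\<Psi> \<in> L2_space Q" "Lbar \<alpha> a b m Q \<Psi> \<in> L2_space Q"
      "\<And>n. (u n, v n) \<in> ?R" "\<And>n. u n \<in> L2_space Q" "\<And>n. v n \<in> L2_space Q"
      "(\<lambda>n. \<integral>\<eta>. (u n \<eta> - \<Psi> \<eta>)\<^sup>2 \<partial>Q) \<longlonglongrightarrow> 0" "(\<lambda>n. \<integral>\<eta>. (v n \<eta> - Lbar \<alpha> a b m Q \<Psi> \<eta>)\<^sup>2 \<partial>Q) \<longlonglongrightarrow> 0"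
      unfolding Lbar_graph_def closure_L2_def by blast
    have "poincare_pair Q (\<gamma> * S) \<Psi> (Lbar \<alpha> a b m Q \<Psi>)"
    proof (rule poincare_pair_closed[OF Q(1) uv(4,1,6,5,2,7)])
      fix n
      have "u n \<in> F_class" "v n = ?L (u n)" using uv(3)[of n] by (auto simp: op_graph_def)
      then show "poincare_pair Q (\<gamma> * S) (u n) (v n)" using gen gen_F by simp
    qed
    then show ?thesis by (simp add: poincare_pair_def energy_def)
  qed
  \<comment> \<open>The mean-square closure starts from \<open>F_class\<close>, so membership of
    \<open>D_exp\<close> has to be proved: the uniform approximants from \<open>F_class\<close>
    converge in mean square as well, since \<open>Q\<close> has mass 1.\<close>
  have D_Lbar: "\<Psi> \<in> Lbar_dom \<alpha> a b m Q" if "\<Psi> \<in> D_exp" for \<Psi>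
  proof -
    have "\<Psi> \<in> Domain (closure_C_inf ?R)" using subsetD[OF D_dom that] by (simp only: generator_T)
    then obtain \<Theta> where "(\<Psi>, \<Theta>) \<in> closure_C_inf ?R" by (rule DomainE)
    then obtain u v where uv: "\<Psi> \<in> C_inf" "\<Theta> \<in> C_inf" "\<And>n. (u n, v n) \<in> ?R"
      "uniform_limit fin_measures u \<Psi> sequentially" "uniform_limit fin_measures v \<Theta> sequentially"
      unfolding closure_C_inf_def by blast
    have C: "u n \<in> C_inf" "v n \<in> C_inf" for n using uv(3)[of n] F_C by (auto simp: op_graph_def)
    have "(\<Psi>, \<Theta>) \<in> Lbar_graph \<alpha> a b m Q"
      unfolding Lbar_graph_def closure_L2_def mem_Collect_eq prod.case
      by (intro conjI exI[of _ u] exI[of _ v] allI uv(3) C_inf_L2[OF Q] C uv(1,2)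
          uniform_limit_L2[OF Q C(1) uv(1,4)] uniform_limit_L2[OF Q C(2) uv(2,5)])
    then show ?thesis by (auto simp: Lbar_dom_def)
  qed
  note Cb = C_ppD[OF b]
  obtain c where c: "0 < c" "\<And>r. c \<le> b r" using b by (auto simp: C_pp_def)
  obtain B where B: "0 < B" "\<And>r. \<bar>b r\<bar> \<le> B" using compact_UNIV_bounded[OF compact_E Cb(1)] by blast
  have "b \<in> borel_measurable borel" using Cb(1) by (rule borel_measurable_continuous_onI)
  then have bm[measurable]: "b \<in> borel_measurable m" using fin_measuresD(1)[OF mf] by (simp cong: measurable_cong_sets)
  \<comment> \<open>As \<open>m\<close> is non-null, what holds almost everywhere holds somewhere.
    This keeps the essential supremum from being minus infinity and the essential infimum from being
    plus infinity, so both are real numbers.\<close>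
  have ex: "\<exists>r. P r" if "AE r in m. P r" for P
  proof (rule ccontr)
    assume "\<not> (\<exists>r. P r)"
    with that have "AE r in m. r \<notin> space m" by simp
    then have "emeasure m (space m) = 0" using AE_iff_null_sets[of "space m" m] by auto
    then show False using m0 fin_measuresD(3)[OF mf] by simp
  qed
  have "\<forall>\<Psi>\<in>D_exp. ereal (Q.variance \<Psi>) \<le> ereal \<gamma> * esssup m (\<lambda>r. ereal (inverse (b r))) * ereal (energy \<alpha> a b m Q \<Psi>)"
  proof
    fix \<Psi> :: "'a measure \<Rightarrow> real" assume \<Psi>: "\<Psi> \<in> D_exp"
    let ?S = "esssup m (\<lambda>r. ereal (inverse (b r)))"
    have AE: "AE r in m. ereal (inverse (b r)) \<le> ?S" by (rule esssup_AE)
    have "?S \<le> ereal (inverse c)"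
      using c Cb by (intro esssup_I) (auto intro!: le_imp_inverse_le)
    moreover obtain r where "ereal (inverse (b r)) \<le> ?S" using ex[OF AE] by blast
    ultimately obtain S where S: "?S = ereal S" by (cases ?S) auto
    have "AE r in m. inverse (b r) \<le> S" using AE unfolding S by simp
    from main[OF this D_Lbar[OF \<Psi>]]
    show "ereal (Q.variance \<Psi>) \<le> ereal \<gamma> * ?S * ereal (energy \<alpha> a b m Q \<Psi>)" unfolding S by simp
  qed
  moreover have "gap \<alpha> a b m Q \<ge> ereal (inverse \<gamma>) * essinf m (\<lambda>r. ereal (b r))"
  proof -
    let ?I = "essinf m (\<lambda>r. ereal (b r))"
    have AE: "AE r in m. ?I \<le> ereal (b r)" by (rule AE_essinf) measurable
    have "ereal c \<le> ?I" using c(2) by (simp add: essinf_def Liminf_bounded)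
    moreover obtain r where "?I \<le> ereal (b r)" using ex[OF AE] by blast
    ultimately obtain I where I: "?I = ereal I" "c \<le> I" by (cases ?I) auto
    have I0: "0 < I" using I(2) c(1) by simp
    \<comment> \<open>With S = 1 / I the constant \<gamma> S becomes \<gamma> divided by the
      essential infimum of b, and variance 1 turns \<open>main\<close> into a lower bound for the
      energy.\<close>
    have S: "AE r in m. inverse (b r) \<le> inverse I"
      using AE unfolding I(1) by eventually_elim (use I0 in \<open>auto intro!: le_imp_inverse_le\<close>)
    show ?thesis
      unfolding gap_def I(1)
    proof (rule Inf_greatest, safe)
      fix \<Psi> assume \<Psi>: "\<Psi> \<in> Lbar_dom \<alpha> a b m Q" "Q.variance \<Psi> = 1"
      have "1 \<le> \<gamma> * inverse I * energy \<alpha> a b m Q \<Psi>" using main[OF S \<Psi>(1)] \<Psi>(2) by simp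
      then have "inverse \<gamma> * I \<le> energy \<alpha> a b m Q \<Psi>" using gamma I0 by (simp add: field_simps)
      then show "ereal (inverse \<gamma>) * ereal I \<le> ereal (energy \<alpha> a b m Q \<Psi>)" by simp
    qed
  qed
  ultimately show ?thesis by blast
qed

end
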